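(* For every integer $r\ge 2$ there exists a real number $\delta_*>0$ such that if $\delta\le\delta_*$, then every graph $G$ on $n$ vertices with $$\alpha(G)<\delta n\quad\text{and}\quad e(G)>\Bigl(\frac{3r-5}{3r-2}+\delta-\delta^2\Bigr)\frac{n^2}{2}$$ contains a $K_{2r}$ (a complete graph on $2r$ vertices) as a subgraph.
   Context: All graphs are finite and simple. $\alpha(G)$ is the maximum size of an independent set of $G$ and $e(G)$ is the number of edges of $G$. *)

theory Defs
  imports Complex_Main "HOL-Library.Ramsey"
begin

text \<open>A graph is a vertex set \<open>V\<close> together with a set \<open>E\<close> of two-element subsets of \<open>V\<close>;
  independent sets and cliques are those of the theory \<open>Ramsey\<close>, where \<open>indep S E\<close> and
  \<open>clique S E\<close> do not by themselves require \<open>S \<subseteq> V\<close>.\<close>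

definition finite_simple_graph :: "'a set \<Rightarrow> 'a set set \<Rightarrow> bool" where
  "finite_simple_graph V E \<longleftrightarrow> finite V \<and> E \<subseteq> [V]\<^bsup>2\<^esup>"

text \<open>For finite \<open>V\<close> the maximum is over a finite set that contains \<open>0\<close>, the size of the empty
  independent set; so it is also meaningful for the graph without vertices.\<close>

definition independence_number :: "'a set \<Rightarrow> 'a set set \<Rightarrow> nat" where
  "independence_number V E = Max {card S |S. S \<subseteq> V \<and> indep S E}"

text \<open>\<open>card K = k\<close> does not force \<open>K\<close> to be finite if \<open>k = 0\<close>, but the finiteness of \<open>V\<close> does.\<close>

definition contains_complete :: "nat \<Rightarrow> 'a set \<Rightarrow> 'a set set \<Rightarrow> bool" where
  "contains_complete k V E \<longleftrightarrow> (\<exists>K \<subseteq> V. card K = k \<and> clique K E)"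

end

(*
  Deleting vertices of small degree reduces the claim to graphs of minimum degree almost
  (1 - 3/(3r-2)) n. In the cell graph of a regular partition, give a pair of cells the weight
  0, 1/2 or 1 according to its density; a weighted clique in which p cells are pairwise joined
  and q further cells are pairwise joined with weight 1 yields K_(p+2q), because every large set contains an
  edge. A weighted clique maximal in a lexicographic sense contains r - 1 cells of pairwise weight 1,
  hence r cells with exactly one pair of weight 1/2, and the minimum degree forces almost every cell to
  look like one of these r cells. This splits the vertices into nearly independent parts
  B_0, ..., B_(r-1), where only B_0, B_1 have density about 1/2.

  For the exact bound, the ends of an edge inside B_0 have almost complementary neighbourhoods in
  B_1, with fewer than a = delta n common neighbours. If t is the number of vertices of B_0 without
  neighbours in B_0, then the neighbourhoods inside B_0 of many vertices are disjoint and form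
  together with these t vertices an independent set; so the edges inside B_0 cost at most a small
  multiple of (a - t) n, while t < a loses about (a - t) n / (3r-2) edges between B_0 and B_1. The
  optimum is t = a without inner edges, and the quadratic form in the part sizes gives the bound.
*)

theory Submission
  imports Defs
begin

section \<open>Edges, degrees and cliques\<close>

text \<open>The term delta - delta^2 is exact, whereas regularity leaves errors proportional to
  \<open>n\<close> that may be huge compared with \<open>a\<close>. Stability therefore only locates
  the parts; afterwards every gain and loss is measured in multiples of \<open>a - t\<close>, which
  is why \<open>t\<close> stays a parameter until the last comparison. The number 3r-2 counts units
  of size \<open>h\<close>: the parts have sizes 2, 2, 3, ..., 3, and every vertex misses about 3
  units, namely its own part of size 3, or its own part of size 2 and half of the other one. The
  gain a n - a^2 in twice the number of edges has two sources. In a part of size 3 the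
  neighbourhoods inside the part are independent, so inner degrees are at most \<open>a\<close>. In
  the pair \<open>B 0\<close>, \<open>B 1\<close> with b and c vertices, at best \<open>a\<close>
  vertices of one side see all c vertices of the other, and the remaining b - a see (c + a) / 2
  each; this adds up to half of b c + a (b + c) - a^2.\<close>

locale sgraph =
  fixes V :: "'a set" and adj :: "'a \<Rightarrow> 'a \<Rightarrow> bool"
  assumes finite_V: "finite V"
    and adj_sym: "adj x y \<Longrightarrow> adj y x"
    and adj_irrefl: "\<not> adj x x"
begin

definition deg_in :: "'a set \<Rightarrow> 'a \<Rightarrow> real" where
  "deg_in X x = real (card {y \<in> X. adj x y})"

text \<open>A vertex of \<open>X\<close> counts among its own non-neighbours; with this convention
  degree and non-degree add up to \<open>card X\<close>.\<close>

definition nondeg_in :: "'a set \<Rightarrow> 'a \<Rightarrow> real" where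
  "nondeg_in X x = real (card {y \<in> X. \<not> adj x y})"

text \<open>Ordered pairs are counted, so \<open>arcs X X\<close> is twice the number of edges
  inside \<open>X\<close>.\<close>

definition arcs :: "'a set \<Rightarrow> 'a set \<Rightarrow> real" where
  "arcs X Y = (\<Sum>x\<in>X. deg_in Y x)"

definition is_clique :: "'a set \<Rightarrow> bool" where
  "is_clique K \<longleftrightarrow> (\<forall>x\<in>K. \<forall>y\<in>K. x \<noteq> y \<longrightarrow> adj x y)"

definition is_indep :: "'a set \<Rightarrow> bool" where
  "is_indep I \<longleftrightarrow> (\<forall>x\<in>I. \<forall>y\<in>I. \<not> adj x y)"

lemma adj_commute: "adj x y \<longleftrightarrow> adj y x"
  using adj_sym by blast

lemma fin: "X \<subseteq> V \<Longrightarrow> finite X"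
  using finite_V finite_subset by blast

lemma deg_in_sum: "finite X \<Longrightarrow> deg_in X x = (\<Sum>y\<in>X. of_bool (adj x y))"
  by (simp add: deg_in_def sum.If_cases of_bool_def Int_def)

lemma deg_in_nonneg [simp]: "0 \<le> deg_in X x"
  by (simp add: deg_in_def)

lemma nondeg_in_nonneg [simp]: "0 \<le> nondeg_in X x"
  by (simp add: nondeg_in_def)

lemma arcs_nonneg [simp]: "0 \<le> arcs X Y"
  by (simp add: arcs_def sum_nonneg)

lemma deg_in_mono: "X \<subseteq> Y \<Longrightarrow> finite Y \<Longrightarrow> deg_in X x \<le> deg_in Y x"
  unfolding deg_in_def by (simp, rule card_mono) auto

lemma nondeg_in_mono: "X \<subseteq> Y \<Longrightarrow> finite Y \<Longrightarrow> nondeg_in X x \<le> nondeg_in Y x"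
  unfolding nondeg_in_def by (simp, rule card_mono) auto

lemma deg_in_nondeg_in: "finite X \<Longrightarrow> deg_in X x + nondeg_in X x = real (card X)"
proof -
  assume f: "finite X"
  have "card X = card ({y \<in> X. adj x y} \<union> {y \<in> X. \<not> adj x y})"
    by (rule arg_cong[where f=card]) auto
  also have "\<dots> = card {y \<in> X. adj x y} + card {y \<in> X. \<not> adj x y}"
    by (rule card_Un_disjoint) (use f in auto)
  finally show ?thesis by (simp add: deg_in_def nondeg_in_def)
qed

lemma deg_in_le_card: "finite X \<Longrightarrow> deg_in X x \<le> card X"
  using deg_in_nondeg_in[of X x] nondeg_in_nonneg[of X x] by linarith

lemma deg_in_Un: "finite X \<Longrightarrow> finite Y \<Longrightarrow> X \<inter> Y = {} \<Longrightarrow> deg_in (X \<union> Y) x = deg_in X x + deg_in Y x"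
  by (simp add: deg_in_sum sum.union_disjoint del: sum_of_bool_eq)

lemma deg_in_Diff: "finite Y \<Longrightarrow> X \<subseteq> Y \<Longrightarrow> deg_in (Y - X) x = deg_in Y x - deg_in X x"
  by (simp add: deg_in_sum sum_diff finite_subset del: sum_of_bool_eq)

lemma arcs_sym: "finite X \<Longrightarrow> finite Y \<Longrightarrow> arcs X Y = arcs Y X"
  by (simp add: arcs_def deg_in_sum del: sum_of_bool_eq, subst sum.swap, simp add: adj_commute del: sum_of_bool_eq)

lemma nondeg_in_sum_swap: "finite X \<Longrightarrow> finite Y \<Longrightarrow> (\<Sum>x\<in>X. nondeg_in Y x) = (\<Sum>y\<in>Y. nondeg_in X y)"
proof -
  assume f: "finite X" "finite Y"
  have "(\<Sum>x\<in>X. nondeg_in Y x) = (\<Sum>x\<in>X. real (card Y)) - arcs X Y"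
    unfolding arcs_def sum_subtractf[symmetric] using deg_in_nondeg_in[OF f(2)] by (intro sum.cong) (auto simp: algebra_simps)
  also have "\<dots> = (\<Sum>y\<in>Y. real (card X)) - arcs Y X"
    using arcs_sym[OF f] by simp
  also have "\<dots> = (\<Sum>y\<in>Y. nondeg_in X y)"
    unfolding arcs_def sum_subtractf[symmetric] using deg_in_nondeg_in[OF f(1)] by (intro sum.cong) (auto simp: algebra_simps)
  finally show ?thesis .
qed

lemma arcs_Un_right: "finite Y \<Longrightarrow> finite Z \<Longrightarrow> Y \<inter> Z = {} \<Longrightarrow> arcs X (Y \<union> Z) = arcs X Y + arcs X Z"
  by (simp add: arcs_def deg_in_Un sum.distrib)

lemma arcs_le_prod: "finite Y \<Longrightarrow> arcs X Y \<le> real (card X) * real (card Y)"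
  unfolding arcs_def using sum_bounded_above[of X "deg_in Y" "real (card Y)"] deg_in_le_card by simp

lemma common_nb:
  assumes "finite Z" "finite Y"
  shows "real (card {y \<in> Y. \<forall>z\<in>Z. adj z y}) \<ge> real (card Y) - (\<Sum>z\<in>Z. nondeg_in Y z)"
proof -
  have "Y \<subseteq> {y \<in> Y. \<forall>z\<in>Z. adj z y} \<union> (\<Union>z\<in>Z. {y \<in> Y. \<not> adj z y})" by auto
  then have "card Y \<le> card ({y \<in> Y. \<forall>z\<in>Z. adj z y} \<union> (\<Union>z\<in>Z. {y \<in> Y. \<not> adj z y}))"
    by (rule card_mono[rotated]) (use assms in auto)
  also have "\<dots> \<le> card {y \<in> Y. \<forall>z\<in>Z. adj z y} + card (\<Union>z\<in>Z. {y \<in> Y. \<not> adj z y})"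
    by (rule card_Un_le)
  also have "card (\<Union>z\<in>Z. {y \<in> Y. \<not> adj z y}) \<le> (\<Sum>z\<in>Z. card {y \<in> Y. \<not> adj z y})"
    by (rule card_UN_le[OF assms(1)])
  finally have "real (card Y) \<le> real (card {y \<in> Y. \<forall>z\<in>Z. adj z y} + (\<Sum>z\<in>Z. card {y \<in> Y. \<not> adj z y}))"
    by linarith
  then show ?thesis by (simp add: nondeg_in_def)
qed

lemma markov:
  fixes f :: "'b \<Rightarrow> real"
  assumes "finite X" "\<And>x. x \<in> X \<Longrightarrow> 0 \<le> f x"
  shows "t * real (card {x \<in> X. f x > t}) \<le> (\<Sum>x\<in>X. f x)"
proof -
  have "t * real (card {x \<in> X. f x > t}) = (\<Sum>x\<in>{x \<in> X. f x > t}. t)" by simp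
  also have "\<dots> \<le> (\<Sum>x\<in>{x \<in> X. f x > t}. f x)" by (rule sum_mono) auto
  also have "\<dots> \<le> (\<Sum>x\<in>X. f x)" by (rule sum_mono2) (use assms in auto)
  finally show ?thesis .
qed

end

locale rt_graph = sgraph +
  fixes r :: nat and a :: real
  assumes r2: "r \<ge> 2"
    and no_clique: "K \<subseteq> V \<Longrightarrow> is_clique K \<Longrightarrow> card K < 2 * r"
    and indep: "I \<subseteq> V \<Longrightarrow> is_indep I \<Longrightarrow> real (card I) < a"
begin

lemma a_pos: "a > 0"
  using indep[of "{}"] by (simp add: is_indep_def)

lemma edge_ex:
  assumes "X \<subseteq> V" "real (card X) \<ge> a"
  obtains x y where "x \<in> X" "y \<in> X" "adj x y"
  using assms indep[of X] by (force simp: is_indep_def)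

text \<open>A set of at least \<open>a\<close> vertices spans an edge. Once an edge is chosen in one
  set, every other set is cut down to the common neighbourhood of its two ends and loses at most
  \<open>2 * \<tau>\<close> vertices; the surplus over \<open>a\<close> pays for all rounds.\<close>

lemma extend_edges:
  assumes "finite J" "\<And>j. j \<in> J \<Longrightarrow> Y j \<subseteq> V" "0 \<le> \<tau>"
    and "\<And>j. j \<in> J \<Longrightarrow> real (card (Y j)) \<ge> a + 2 * real (card J) * \<tau>"
    and "\<And>i j x. i \<in> J \<Longrightarrow> j \<in> J \<Longrightarrow> i \<noteq> j \<Longrightarrow> x \<in> Y i \<Longrightarrow> nondeg_in (Y j) x \<le> \<tau>"
  shows "\<exists>K \<subseteq> (\<Union>j\<in>J. Y j). is_clique K \<and> card K = 2 * card J"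
  using assms
proof (induction J arbitrary: Y rule: finite_induct)
  case empty
  then show ?case by (auto simp: is_clique_def)
next
  case (insert i J)
  have "0 \<le> 2 * real (card (insert i J)) * \<tau>" using insert.prems(2) by simp
  then have "real (card (Y i)) \<ge> a"
    using insert.prems(3)[OF insertI1] by linarith
  then obtain x y where xy: "x \<in> Y i" "y \<in> Y i" "adj x y"
    using edge_ex[of "Y i"] insert.prems(1) by blast
  define Z where "Z j = {z \<in> Y j. \<forall>w\<in>{x,y}. adj w z}" for j
  have xy': "x \<noteq> y" using xy adj_irrefl by auto
  have "\<exists>K \<subseteq> (\<Union>j\<in>J. Z j). is_clique K \<and> card K = 2 * card J"
  proof (rule insert.IH)
    show "Z j \<subseteq> V" if "j \<in> J" for j using insert.prems(1) that by (auto simp: Z_def)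
    show "0 \<le> \<tau>" by fact
    show "a + 2 * real (card J) * \<tau> \<le> real (card (Z j))" if j: "j \<in> J" for j
    proof -
      have ij: "i \<noteq> j" using insert.hyps j by auto
      have "finite (Y j)" using fin insert.prems(1) j by auto
      then have "real (card (Z j)) \<ge> real (card (Y j)) - (\<Sum>z\<in>{x,y}. nondeg_in (Y j) z)"
        unfolding Z_def by (intro common_nb) auto
      moreover have "(\<Sum>z\<in>{x,y}. nondeg_in (Y j) z) \<le> 2 * \<tau>"
        using xy' insert.prems(4)[of i j x] insert.prems(4)[of i j y] ij j xy by auto
      moreover have "real (card (Y j)) \<ge> a + 2 * real (card (insert i J)) * \<tau>"
        using insert.prems(3) j by auto
      ultimately show ?thesis using insert.hyps by (simp add: algebra_simps)
    qed
    show "nondeg_in (Z j) z \<le> \<tau>" if "k \<in> J" "j \<in> J" "k \<noteq> j" "z \<in> Z k" for k j z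
    proof -
      have "nondeg_in (Z j) z \<le> nondeg_in (Y j) z"
        by (rule nondeg_in_mono) (use fin insert.prems(1) that in \<open>auto simp: Z_def\<close>)
      also have "\<dots> \<le> \<tau>" using insert.prems(4)[of k j z] that by (auto simp: Z_def)
      finally show ?thesis .
    qed
  qed
  then obtain K where K: "K \<subseteq> (\<Union>j\<in>J. Z j)" "is_clique K" "card K = 2 * card J" by blast
  have "K \<subseteq> V" using K(1) insert.prems(1) by (fastforce simp: Z_def)
  then have fK: "finite K" by (rule fin)
  have nin: "x \<notin> K" "y \<notin> K" using K(1) adj_irrefl by (auto simp: Z_def)
  have adjK: "adj x z" "adj y z" if "z \<in> K" for z using K(1) that by (auto simp: Z_def)
  have "is_clique ({x,y} \<union> K)"
    using K(2) xy(3) adjK adj_sym unfolding is_clique_def by blast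
  moreover have "card ({x,y} \<union> K) = 2 * card (insert i J)"
    using nin fK xy' K(3) insert.hyps by simp
  moreover have "{x,y} \<union> K \<subseteq> (\<Union>j\<in>insert i J. Y j)" using K(1) xy by (auto simp: Z_def)
  ultimately show ?case by blast
qed

text \<open>Without the non-neighbours of \<open>K\<close> every \<open>Y j\<close> still supplies
  an edge, and these edges form a clique together with \<open>K\<close>. This is the form in which
  the absence of a K_(2r) is used for explicit parts.\<close>

lemma extend_bound:
  assumes K0: "is_clique K" "K \<subseteq> V"
    and J: "finite J" and Y: "\<And>j. j \<in> J \<Longrightarrow> Y j \<subseteq> V" and \<tau>: "0 \<le> \<tau>"
    and big: "\<And>j. j \<in> J \<Longrightarrow> real (card (Y j)) - (\<Sum>z\<in>K. nondeg_in (Y j) z) \<ge> a + 2 * real (card J) * \<tau>"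
    and m: "\<And>i j x. i \<in> J \<Longrightarrow> j \<in> J \<Longrightarrow> i \<noteq> j \<Longrightarrow> x \<in> Y i \<Longrightarrow> nondeg_in (Y j) x \<le> \<tau>"
  shows "card K + 2 * card J < 2 * r"
proof -
  define Z where "Z j = {y \<in> Y j. \<forall>z\<in>K. adj z y}" for j
  have fK: "finite K" using K0 fin by auto
  have "\<exists>L \<subseteq> (\<Union>j\<in>J. Z j). is_clique L \<and> card L = 2 * card J"
  proof (rule extend_edges[OF J _ \<tau>])
    show "Z j \<subseteq> V" if "j \<in> J" for j using Y that by (auto simp: Z_def)
    show "a + 2 * real (card J) * \<tau> \<le> real (card (Z j))" if "j \<in> J" for j
      using common_nb[OF fK fin[OF Y[OF that]]] big[OF that] by (simp add: Z_def)
    show "nondeg_in (Z j) x \<le> \<tau>" if "i \<in> J" "j \<in> J" "i \<noteq> j" "x \<in> Z i" for i j x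
    proof -
      have "nondeg_in (Z j) x \<le> nondeg_in (Y j) x"
        by (rule nondeg_in_mono) (use fin Y that in \<open>auto simp: Z_def\<close>)
      also have "\<dots> \<le> \<tau>" using m[of i j x] that by (auto simp: Z_def)
      finally show ?thesis .
    qed
  qed
  then obtain L where L: "L \<subseteq> (\<Union>j\<in>J. Z j)" "is_clique L" "card L = 2 * card J" by blast
  have LV: "L \<subseteq> V" using L(1) Y by (fastforce simp: Z_def)
  have KL: "adj x y" if "x \<in> K" "y \<in> L" for x y using that L(1) by (auto simp: Z_def)
  have "is_clique (K \<union> L)" using K0(1) L(2) KL adj_sym unfolding is_clique_def by blast
  moreover have "K \<inter> L = {}" using KL adj_irrefl by blast
  then have "card (K \<union> L) = card K + 2 * card J" using L fK fin[OF LV] by (simp add: card_Un_disjoint)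
  ultimately show ?thesis using no_clique[of "K \<union> L"] K0(2) LV by simp
qed

end

section \<open>A regularity lemma\<close>

text \<open>Bounds the number of sets that define the cells after \<open>i\<close> refinements:
  \<open>m\<close> sets have at most \<open>2 ^ m\<close> cells, and each ordered pair of cells adds
  at most two sets.\<close>

primrec reg_bound :: "nat \<Rightarrow> nat" where
  "reg_bound 0 = 0"
| "reg_bound (Suc i) = reg_bound i + 2 * (2 ^ reg_bound i)\<^sup>2"

context sgraph
begin

text \<open>A partition is encoded by a family \<open>S\<close> of sets, whose atoms are the cells.
  Refining means adding sets, so a witness of irregularity is simply put into
  \<open>S\<close>.\<close>

definition cell :: "'a set set \<Rightarrow> 'a \<Rightarrow> 'a set" where
  "cell S x = {y \<in> V. \<forall>A\<in>S. x \<in> A \<longleftrightarrow> y \<in> A}"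

text \<open>The saturated sets, that is, the unions of cells; averaging over cells preserves sums
  over them.\<close>

definition sat :: "'a set set \<Rightarrow> 'a set \<Rightarrow> bool" where
  "sat S X \<longleftrightarrow> X \<subseteq> V \<and> (\<forall>x\<in>X. cell S x \<subseteq> X)"

definition dens :: "'a set \<Rightarrow> 'a set \<Rightarrow> real" where
  "dens X Y = arcs X Y / (real (card X) * real (card Y))"

text \<open>Indexed by vertices rather than cells, so that a sum over pairs of vertices weights each
  pair of cells by the product of their sizes.\<close>

definition cdens :: "'a set set \<Rightarrow> 'a \<Rightarrow> 'a \<Rightarrow> real" where
  "cdens S x y = dens (cell S x) (cell S y)"

text \<open>One-sided: only subsets of too low density count as a witness, because the embedding
  uses lower bounds on degrees alone.\<close>

definition irreg :: "real \<Rightarrow> 'a set \<Rightarrow> 'a set \<Rightarrow> bool" where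
  "irreg \<epsilon> X Y \<longleftrightarrow> (\<exists>A B. A \<subseteq> X \<and> B \<subseteq> Y \<and> \<epsilon> * real (card X) \<le> real (card A) \<and>
     \<epsilon> * real (card Y) \<le> real (card B) \<and> arcs A B < (dens X Y - \<epsilon>) * (real (card A) * real (card B)))"

lemma cell_subset: "cell S x \<subseteq> V"
  by (auto simp: cell_def)

lemma finite_cell [simp]: "finite (cell S x)"
  using cell_subset fin by blast

lemma cell_self: "x \<in> V \<Longrightarrow> x \<in> cell S x"
  by (auto simp: cell_def)

lemma cell_eq: "y \<in> cell S x \<Longrightarrow> cell S y = cell S x"
  by (auto simp: cell_def)

lemma cell_commute: "x \<in> V \<Longrightarrow> y \<in> V \<Longrightarrow> y \<in> cell S x \<longleftrightarrow> x \<in> cell S y"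
  by (auto simp: cell_def)

lemma card_cell_pos: "x \<in> V \<Longrightarrow> 0 < card (cell S x)"
  using cell_self[of x S] by (simp add: card_gt_0_iff) blast

lemma cell_mono: "S \<subseteq> S' \<Longrightarrow> cell S' x \<subseteq> cell S x"
  by (auto simp: cell_def)

lemma sat_V: "sat S V"
  by (auto simp: sat_def cell_def)

lemma sat_cell: "S \<subseteq> S' \<Longrightarrow> sat S' (cell S x)"
  unfolding sat_def using cell_subset cell_mono[of S S'] cell_eq[of _ S x] by blast

lemma sat_member: "A \<in> S \<Longrightarrow> A \<subseteq> V \<Longrightarrow> sat S A"
  by (auto simp: sat_def cell_def)

lemma card_cells: "finite S \<Longrightarrow> card (cell S ` V) \<le> 2 ^ card S"
proof -
  assume f: "finite S"
  let ?g = "\<lambda>T. {y \<in> V. \<forall>A\<in>S. A \<in> T \<longleftrightarrow> y \<in> A}"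
  have "cell S ` V \<subseteq> ?g ` Pow S"
  proof
    fix C assume "C \<in> cell S ` V"
    then obtain x where "C = cell S x" by blast
    then have "C = ?g {A \<in> S. x \<in> A}" by (auto simp: cell_def)
    then show "C \<in> ?g ` Pow S" by blast
  qed
  then have "card (cell S ` V) \<le> card (?g ` Pow S)" by (rule card_mono[rotated]) (use f in auto)
  also have "\<dots> \<le> card (Pow S)" by (rule card_image_le) (use f in auto)
  finally show ?thesis by (simp add: card_Pow f)
qed

text \<open>After the sums are swapped, \<open>F x'\<close> occurs with the factor
  \<open>1 / c\<close> once for each of the \<open>c\<close> vertices of its own cell.\<close>

lemma avg_sum:
  assumes "sat S X"
  shows "(\<Sum>x\<in>X. (\<Sum>x'\<in>cell S x. F x') / real (card (cell S x))) = (\<Sum>x\<in>X. F x)"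
proof -
  have XV: "X \<subseteq> V" and cl: "\<And>x. x \<in> X \<Longrightarrow> cell S x \<subseteq> X" using assms by (auto simp: sat_def)
  have fX: "finite X" using fin XV by auto
  have "(\<Sum>x\<in>X. (\<Sum>x'\<in>cell S x. F x') / real (card (cell S x)))
      = (\<Sum>x\<in>X. \<Sum>x'\<in>X. if x' \<in> cell S x then F x' / real (card (cell S x)) else 0)"
  proof (rule sum.cong[OF refl])
    fix x assume "x \<in> X"
    then have "cell S x = {x' \<in> X. x' \<in> cell S x}" using cl by auto
    then have "(\<Sum>x'\<in>cell S x. F x' / real (card (cell S x)))
      = (\<Sum>x'\<in>{x' \<in> X. x' \<in> cell S x}. F x' / real (card (cell S x)))" by (rule sum.cong) auto
    also have "\<dots> = (\<Sum>x'\<in>X. if x' \<in> cell S x then F x' / real (card (cell S x)) else 0)"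
      using fX by (simp add: sum.inter_filter)
    finally show "(\<Sum>x'\<in>cell S x. F x') / real (card (cell S x))
      = (\<Sum>x'\<in>X. if x' \<in> cell S x then F x' / real (card (cell S x)) else 0)"
      by (simp add: sum_divide_distrib)
  qed
  also have "\<dots> = (\<Sum>x'\<in>X. \<Sum>x\<in>X. if x' \<in> cell S x then F x' / real (card (cell S x)) else 0)"
    by (rule sum.swap)
  also have "\<dots> = (\<Sum>x'\<in>X. F x')"
  proof (rule sum.cong[OF refl])
    fix x' assume x': "x' \<in> X"
    have "(\<Sum>x\<in>X. if x' \<in> cell S x then F x' / real (card (cell S x)) else 0)
        = (\<Sum>x\<in>X. if x \<in> cell S x' then F x' / real (card (cell S x')) else 0)"
      using XV x' cell_commute cell_eq by (intro sum.cong refl) (smt (verit) subset_iff)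
    also have "\<dots> = (\<Sum>x\<in>{x \<in> X. x \<in> cell S x'}. F x' / real (card (cell S x')))"
      by (rule sum.inter_filter[OF fX, symmetric])
    also have "{x \<in> X. x \<in> cell S x'} = cell S x'" using cl x' by auto
    finally show "(\<Sum>x\<in>X. if x' \<in> cell S x then F x' / real (card (cell S x)) else 0) = F x'"
      using card_cell_pos[of x' S] XV x' by auto
  qed
  finally show ?thesis .
qed

lemma avg_sum2:
  assumes "sat S X" "sat S Y"
  shows "(\<Sum>x\<in>X. \<Sum>y\<in>Y. (\<Sum>x'\<in>cell S x. \<Sum>y'\<in>cell S y. F x' y') / (real (card (cell S x)) * real (card (cell S y))))
    = (\<Sum>x\<in>X. \<Sum>y\<in>Y. F x y)"
proof -
  let ?c = "\<lambda>x. real (card (cell S x))"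
  have "(\<Sum>x\<in>X. \<Sum>y\<in>Y. (\<Sum>x'\<in>cell S x. \<Sum>y'\<in>cell S y. F x' y') / (?c x * ?c y))
      = (\<Sum>x\<in>X. \<Sum>y\<in>Y. (\<Sum>y'\<in>cell S y. (\<Sum>x'\<in>cell S x. F x' y') / ?c x) / ?c y)"
    by (intro sum.cong refl) (subst sum.swap, simp add: sum_divide_distrib)
  also have "\<dots> = (\<Sum>x\<in>X. \<Sum>y\<in>Y. (\<Sum>x'\<in>cell S x. F x' y) / ?c x)"
    by (simp add: avg_sum[OF assms(2)])
  also have "\<dots> = (\<Sum>y\<in>Y. \<Sum>x\<in>X. (\<Sum>x'\<in>cell S x. F x' y) / ?c x)" by (rule sum.swap)
  also have "\<dots> = (\<Sum>y\<in>Y. \<Sum>x\<in>X. F x y)" by (simp add: avg_sum[OF assms(1)])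
  also have "\<dots> = (\<Sum>x\<in>X. \<Sum>y\<in>Y. F x y)" by (rule sum.swap)
  finally show ?thesis .
qed

lemma arcs_double: "finite Y \<Longrightarrow> arcs X Y = (\<Sum>x\<in>X. \<Sum>y\<in>Y. of_bool (adj x y))"
  by (simp add: arcs_def deg_in_sum del: sum_of_bool_eq)

lemma sum_cdens:
  assumes "sat S X" "sat S Y"
  shows "(\<Sum>x\<in>X. \<Sum>y\<in>Y. cdens S x y) = arcs X Y"
  using avg_sum2[OF assms, of "\<lambda>x y. of_bool (adj x y)"] assms
  by (simp add: cdens_def dens_def arcs_double sat_def fin del: sum_of_bool_eq)

lemma dens_nonneg [simp]: "0 \<le> dens X Y"
  by (simp add: dens_def)

lemma dens_le_1: "finite Y \<Longrightarrow> dens X Y \<le> 1"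
  using arcs_le_prod[of Y X] unfolding dens_def
  by (smt (verit) divide_le_eq_1 mult_nonneg_nonneg of_nat_0_le_iff)

lemma dens_sym: "finite X \<Longrightarrow> finite Y \<Longrightarrow> dens X Y = dens Y X"
  using arcs_sym[of X Y] by (simp add: dens_def mult.commute)

lemma cdens_sym: "cdens S x y = cdens S y x"
  by (simp add: cdens_def dens_sym)

lemma cdens_bounds: "0 \<le> cdens S x y" "cdens S x y \<le> 1"
  by (simp_all add: cdens_def dens_le_1)

lemma irreg_sym: "finite X \<Longrightarrow> finite Y \<Longrightarrow> irreg \<epsilon> X Y \<Longrightarrow> irreg \<epsilon> Y X"
proof -
  assume f: "finite X" "finite Y" and "irreg \<epsilon> X Y"
  then obtain A B where AB: "A \<subseteq> X" "B \<subseteq> Y" "\<epsilon> * real (card X) \<le> real (card A)"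
     "\<epsilon> * real (card Y) \<le> real (card B)" "arcs A B < (dens X Y - \<epsilon>) * (real (card A) * real (card B))"
    by (auto simp: irreg_def)
  moreover have "arcs A B = arcs B A" using arcs_sym f AB(1,2) finite_subset by metis
  ultimately show ?thesis unfolding irreg_def
    by (intro exI[of _ B] exI[of _ A]) (simp add: dens_sym[OF f] mult.commute)
qed

section \<open>Energy of a partition and its growth under refinement\<close>

definition energy :: "'a set set \<Rightarrow> real" where
  "energy S = (\<Sum>x\<in>V. \<Sum>y\<in>V. (cdens S x y)\<^sup>2)"

lemma energy_le: "energy S \<le> (real (card V))\<^sup>2"
proof -
  have "(cdens S x y)\<^sup>2 \<le> 1" for x y
    using cdens_bounds[of S x y] by (simp add: power_le_one)
  then have "energy S \<le> (\<Sum>x\<in>V. \<Sum>y\<in>V. 1)" unfolding energy_def by (intro sum_mono)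
  then show ?thesis by (simp add: power2_eq_square)
qed

text \<open>Pythagoras: the cell densities of \<open>S\<close> are the orthogonal projection of those of a refinement.\<close>

lemma energy_refine:
  assumes "S \<subseteq> S'"
  shows "energy S' - energy S = (\<Sum>x\<in>V. \<Sum>y\<in>V. (cdens S' x y - cdens S x y)\<^sup>2)"
proof -
  let ?c = "\<lambda>x. real (card (cell S x))"
  \<comment> \<open>The mixed term reduces to \<open>energy S\<close>, since \<open>cdens S\<close>
    is constant on a pair of cells of \<open>S\<close> and is the average of \<open>cdens S'\<close>
    there.\<close>
  have "(\<Sum>x\<in>V. \<Sum>y\<in>V. cdens S' x y * cdens S x y)
    = (\<Sum>x\<in>V. \<Sum>y\<in>V. (\<Sum>x'\<in>cell S x. \<Sum>y'\<in>cell S y. cdens S' x' y' * cdens S x' y') / (?c x * ?c y))"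
    by (rule avg_sum2[OF sat_V sat_V, symmetric])
  also have "\<dots> = (\<Sum>x\<in>V. \<Sum>y\<in>V. (\<Sum>x'\<in>cell S x. \<Sum>y'\<in>cell S y. cdens S' x' y') * cdens S x y / (?c x * ?c y))"
  proof (intro sum.cong refl arg_cong2[where f="(/)"])
    fix x y
    have "cdens S x' y' = cdens S x y" if "x' \<in> cell S x" "y' \<in> cell S y" for x' y'
      using that by (simp add: cdens_def cell_eq)
    then show "(\<Sum>x'\<in>cell S x. \<Sum>y'\<in>cell S y. cdens S' x' y' * cdens S x' y')
      = (\<Sum>x'\<in>cell S x. \<Sum>y'\<in>cell S y. cdens S' x' y') * cdens S x y"
      by (simp add: sum_distrib_right)
  qed
  also have "\<dots> = energy S"
    unfolding energy_def
    by (intro sum.cong refl, subst sum_cdens[OF sat_cell[OF assms] sat_cell[OF assms]])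
       (simp add: cdens_def dens_def power2_eq_square)
  finally have "(\<Sum>x\<in>V. \<Sum>y\<in>V. cdens S' x y * cdens S x y) = energy S" .
  then show ?thesis
    by (simp add: power2_diff sum.distrib sum_subtractf energy_def mult.assoc sum_distrib_left[symmetric])
qed

text \<open>The witnesses of all irregular pairs are added at once. On a witness the new densities
  lie on average more than \<open>\<epsilon>\<close> below the old one, and a witness fills at least
  a fraction \<open>\<epsilon>\<^sup>2\<close> of its pair of cells; hence the factor
  \<open>\<epsilon> ^ 4\<close>.\<close>

lemma energy_increment:
  assumes \<epsilon>: "0 < \<epsilon>" and S: "finite S"
  obtains S' where "finite S'" "card S' \<le> card S + 2 * (2 ^ card S)\<^sup>2"
    "energy S' \<ge> energy S + \<epsilon> ^ 4 * real (card {(x, y) \<in> V \<times> V. irreg \<epsilon> (cell S x) (cell S y)})"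
proof -
  define wit where "wit C C' A B \<longleftrightarrow> A \<subseteq> C \<and> B \<subseteq> C' \<and> \<epsilon> * real (card C) \<le> real (card A) \<and>
     \<epsilon> * real (card C') \<le> real (card B) \<and> arcs A B < (dens C C' - \<epsilon>) * (real (card A) * real (card B))" for C C' A B
  define w where "w C C' = (SOME p. wit C C' (fst p) (snd p))" for C C'
  have w: "wit C C' (fst (w C C')) (snd (w C C'))" if "irreg \<epsilon> C C'" for C C'
  proof -
    have "\<exists>A B. wit C C' A B" using that by (simp only: irreg_def wit_def)
    then obtain A B where "wit C C' A B" by blast
    then have "wit C C' (fst (A, B)) (snd (A, B))" by simp
    then show ?thesis unfolding w_def by (rule someI)
  qed
  define S' where "S' = S \<union> (\<Union>(C, C')\<in>cell S ` V \<times> cell S ` V. {fst (w C C'), snd (w C C')})"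
  have SS': "S \<subseteq> S'" by (auto simp: S'_def)
  have f': "finite S'" using S finite_V by (auto simp: S'_def)
  let ?P = "cell S ` V \<times> cell S ` V"
  have "card (\<Union>(C, C')\<in>?P. {fst (w C C'), snd (w C C')}) \<le> (\<Sum>(C, C')\<in>?P. card {fst (w C C'), snd (w C C')})"
    using card_UN_le[of ?P "\<lambda>(C, C'). {fst (w C C'), snd (w C C')}"] finite_V by (simp add: case_prod_beta)
  also have "\<dots> \<le> (\<Sum>(C, C')\<in>?P. 2)"
    by (intro sum_mono) (auto simp: card_insert_if)
  also have "\<dots> = 2 * (card (cell S ` V))\<^sup>2" by (simp add: card_cartesian_product power2_eq_square)
  also have "\<dots> \<le> 2 * (2 ^ card S)\<^sup>2"
    using power_mono[OF card_cells[OF S], of 2] by simp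
  finally have "card S' \<le> card S + 2 * (2 ^ card S)\<^sup>2"
    using card_Un_le[of S "\<Union>(C, C')\<in>?P. {fst (w C C'), snd (w C C')}"] unfolding S'_def by linarith
  moreover have "energy S' \<ge> energy S + \<epsilon> ^ 4 * real (card {(x, y) \<in> V \<times> V. irreg \<epsilon> (cell S x) (cell S y)})"
  proof -
    let ?d = "\<lambda>x y. (cdens S' x y - cdens S x y)\<^sup>2"
    let ?c = "\<lambda>x. real (card (cell S x))"
    let ?A = "\<lambda>x y. (\<Sum>x'\<in>cell S x. \<Sum>y'\<in>cell S y. ?d x' y') / (?c x * ?c y)"
    have key: "?A x y \<ge> (if irreg \<epsilon> (cell S x) (cell S y) then \<epsilon> ^ 4 else 0)" if xy: "x \<in> V" "y \<in> V" for x y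
    proof (cases "irreg \<epsilon> (cell S x) (cell S y)")
      case False
      then show ?thesis by (simp add: sum_nonneg)
    next
      case True
      define A B where "A = fst (w (cell S x) (cell S y))" and "B = snd (w (cell S x) (cell S y))"
      have AB: "A \<subseteq> cell S x" "B \<subseteq> cell S y" "\<epsilon> * ?c x \<le> real (card A)" "\<epsilon> * ?c y \<le> real (card B)"
        "arcs A B < (cdens S x y - \<epsilon>) * (real (card A) * real (card B))"
        using w[OF True] by (auto simp: A_def B_def cdens_def wit_def)
      have fAB: "finite A" "finite B" using AB finite_subset finite_cell by metis+
      have "A \<in> S'" "B \<in> S'" using xy unfolding S'_def A_def B_def by auto
      then have sat: "sat S' A" "sat S' B" using AB cell_subset by (meson sat_member order_trans)+
      have "\<epsilon>\<^sup>2 * (real (card A) * real (card B))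
        \<le> - 2 * \<epsilon> * (arcs A B - cdens S x y * (real (card A) * real (card B))) - \<epsilon>\<^sup>2 * (real (card A) * real (card B))"
      proof -
        have "\<epsilon> * (arcs A B - cdens S x y * (real (card A) * real (card B)))
          \<le> \<epsilon> * (- \<epsilon> * (real (card A) * real (card B)))"
          using AB(5) \<epsilon> by (intro mult_left_mono) (auto simp: algebra_simps)
        then show ?thesis by (simp add: power2_eq_square algebra_simps)
      qed
      also have "\<dots> = (\<Sum>x'\<in>A. \<Sum>y'\<in>B. - 2 * \<epsilon> * (cdens S' x' y' - cdens S x y) - \<epsilon>\<^sup>2)"
        unfolding sum_cdens[OF sat, symmetric]
        by (simp add: sum_subtractf sum.distrib sum_negf sum_distrib_left algebra_simps)
      also have "\<dots> \<le> (\<Sum>x'\<in>A. \<Sum>y'\<in>B. ?d x' y')"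
      proof (intro sum_mono)
        fix x' y' assume m: "x' \<in> A" "y' \<in> B"
        have e: "cdens S x' y' = cdens S x y" using m AB(1,2) by (auto simp: cdens_def cell_eq dest!: subsetD)
        \<comment> \<open>A linear bound instead of the Cauchy-Schwarz inequality: a square
          \<open>x\<^sup>2\<close> is at least
          \<open>- 2 * \<epsilon> * x - \<epsilon>\<^sup>2\<close>, and the differences
          \<open>x\<close> average below \<open>- \<epsilon>\<close>.\<close>
        have "0 \<le> (cdens S' x' y' - cdens S x y + \<epsilon>)\<^sup>2" by simp
        then show "- 2 * \<epsilon> * (cdens S' x' y' - cdens S x y) - \<epsilon>\<^sup>2 \<le> ?d x' y'"
          unfolding e by (simp add: power2_eq_square algebra_simps)
      qed
      also have "\<dots> \<le> (\<Sum>x'\<in>cell S x. \<Sum>y'\<in>cell S y. ?d x' y')"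
        by (rule order_trans[OF sum_mono sum_mono2]) (use AB in \<open>auto intro!: sum_mono2 sum_nonneg\<close>)
      finally have 1: "\<epsilon>\<^sup>2 * (real (card A) * real (card B)) \<le> (\<Sum>x'\<in>cell S x. \<Sum>y'\<in>cell S y. ?d x' y')" .
      have "\<epsilon> ^ 4 * (?c x * ?c y) = \<epsilon>\<^sup>2 * ((\<epsilon> * ?c x) * (\<epsilon> * ?c y))"
        by (simp add: power_def numeral_eq_Suc)
      also have "\<dots> \<le> \<epsilon>\<^sup>2 * (real (card A) * real (card B))"
        using AB \<epsilon> by (intro mult_left_mono mult_mono) auto
      also note 1
      finally have "\<epsilon> ^ 4 * (?c x * ?c y) \<le> (\<Sum>x'\<in>cell S x. \<Sum>y'\<in>cell S y. ?d x' y')" .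
      moreover have "0 < ?c x * ?c y" using card_cell_pos xy by simp
      ultimately show ?thesis using True by (simp add: pos_le_divide_eq)
    qed
    have "\<epsilon> ^ 4 * real (card {(x, y) \<in> V \<times> V. irreg \<epsilon> (cell S x) (cell S y)})
      = (\<Sum>(x, y)\<in>V \<times> V. if irreg \<epsilon> (cell S x) (cell S y) then \<epsilon> ^ 4 else 0)"
    proof -
      have "{(x, y) \<in> V \<times> V. irreg \<epsilon> (cell S x) (cell S y)} = {p \<in> V \<times> V. irreg \<epsilon> (cell S (fst p)) (cell S (snd p))}"
        by auto
      then show ?thesis using finite_V by (simp add: sum.inter_filter[symmetric] case_prod_beta)
    qed
    also have "\<dots> = (\<Sum>x\<in>V. \<Sum>y\<in>V. if irreg \<epsilon> (cell S x) (cell S y) then \<epsilon> ^ 4 else 0)"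
      by (rule sum.cartesian_product[symmetric])
    also have "\<dots> \<le> (\<Sum>x\<in>V. \<Sum>y\<in>V. ?A x y)"
      by (intro sum_mono key)
    also have "\<dots> = energy S' - energy S"
      unfolding energy_refine[OF SS'] by (rule avg_sum2[OF sat_V sat_V])
    finally show ?thesis by linarith
  qed
  ultimately show ?thesis using that f' by blast
qed

text \<open>Every failed round raises the energy by at least \<open>\<epsilon> ^ 5\<close> times the
  square of \<open>card V\<close>, and the energy never exceeds that square; so \<open>K\<close>
  rounds cannot all fail. Irregularity is counted in pairs of vertices, hence cells of different
  sizes do no harm.\<close>

theorem regularity:
  assumes \<epsilon>: "0 < \<epsilon>" and K: "real K * \<epsilon> ^ 5 > 1"
  shows "\<exists>S. finite S \<and> card S \<le> reg_bound K \<and>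
    real (card {(x, y) \<in> V \<times> V. irreg \<epsilon> (cell S x) (cell S y)}) \<le> \<epsilon> * (real (card V))\<^sup>2"
proof (rule ccontr)
  assume H: "\<not> ?thesis"
  have mono: "reg_bound i \<le> reg_bound j" if "i \<le> j" for i j
    using that by (induction j rule: dec_induct) auto
  have "\<exists>S. finite S \<and> card S \<le> reg_bound i \<and> energy S \<ge> real i * \<epsilon> ^ 5 * (real (card V))\<^sup>2" if "i \<le> K" for i
    using that
  proof (induction i)
    case 0
    show ?case by (intro exI[of _ "{}"]) (simp add: energy_def sum_nonneg)
  next
    case (Suc i)
    then obtain S where S: "finite S" "card S \<le> reg_bound i" "energy S \<ge> real i * \<epsilon> ^ 5 * (real (card V))\<^sup>2" by auto
    obtain S' where S': "finite S'" "card S' \<le> card S + 2 * (2 ^ card S)\<^sup>2"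
      "energy S' \<ge> energy S + \<epsilon> ^ 4 * real (card {(x, y) \<in> V \<times> V. irreg \<epsilon> (cell S x) (cell S y)})"
      using energy_increment[OF \<epsilon> S(1)] .
    have "card S \<le> reg_bound K" using S(2) mono[of i K] Suc.prems by linarith
    then have "real (card {(x, y) \<in> V \<times> V. irreg \<epsilon> (cell S x) (cell S y)}) > \<epsilon> * (real (card V))\<^sup>2"
      using H S(1) by force
    then have "\<epsilon> ^ 4 * real (card {(x, y) \<in> V \<times> V. irreg \<epsilon> (cell S x) (cell S y)}) \<ge> \<epsilon> ^ 4 * (\<epsilon> * (real (card V))\<^sup>2)"
      using \<epsilon> by (intro mult_left_mono) auto
    moreover have "\<epsilon> ^ 4 * (\<epsilon> * (real (card V))\<^sup>2) = \<epsilon> ^ 5 * (real (card V))\<^sup>2"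
      by (simp add: power_def numeral_eq_Suc)
    ultimately have "energy S' \<ge> real (Suc i) * \<epsilon> ^ 5 * (real (card V))\<^sup>2"
      using S(3) S'(3) distrib_right[of "real i" 1 "\<epsilon> ^ 5 * (real (card V))\<^sup>2"]
      by (simp only: of_nat_Suc mult.assoc mult_1 add.commute)
    moreover have "card S' \<le> reg_bound (Suc i)"
    proof -
      have "(2 ^ card S)\<^sup>2 \<le> (2 ^ reg_bound i :: nat)\<^sup>2"
        using S(2) by (intro power_mono power_increasing) auto
      then show ?thesis unfolding reg_bound.simps using S'(2) S(2) by linarith
    qed
    ultimately show ?case using S'(1) by blast
  qed
  from this[of K] obtain S where "energy S \<ge> real K * \<epsilon> ^ 5 * (real (card V))\<^sup>2" by blast
  then have le: "real K * \<epsilon> ^ 5 * (real (card V))\<^sup>2 \<le> (real (card V))\<^sup>2" using energy_le[of S] by linarith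
  show False
  \<comment> \<open>Without vertices the energy estimate only says \<open>0 \<le> 0\<close>; the
    empty family is then a solution.\<close>
  proof (cases "V = {}")
    case True
    have "finite {} \<and> card {} \<le> reg_bound K \<and>
      real (card {(x, y) \<in> V \<times> V. irreg \<epsilon> (cell {} x) (cell {} y)}) \<le> \<epsilon> * (real (card V))\<^sup>2"
      by (simp add: True)
    then show False using H by blast
  next
    case False
    then have "0 < (real (card V))\<^sup>2" using finite_V by (simp add: card_gt_0_iff)
    then show False using le K by (simp add: mult_le_cancel_right1)
  qed
qed

end

section \<open>Embedding cliques into regular cells\<close>

context rt_graph
begin

text \<open>Too many vertices of low degree would be, together with \<open>Y\<close>, a witness of
  irregularity.\<close>

lemma few_low_degree:
  assumes reg: "\<not> irreg \<epsilon> C D" and C: "C \<subseteq> V" "C \<noteq> {}" and Y: "Y \<subseteq> D" "\<epsilon> * real (card D) \<le> real (card Y)"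
    and \<epsilon>: "0 < \<epsilon>"
  shows "real (card {x \<in> C. deg_in Y x < (dens C D - \<epsilon>) * real (card Y)}) \<le> \<epsilon> * real (card C)"
proof (rule ccontr)
  let ?L = "{x \<in> C. deg_in Y x < (dens C D - \<epsilon>) * real (card Y)}"
  assume "\<not> ?thesis"
  then have big: "\<epsilon> * real (card C) < real (card ?L)" by simp
  have fC: "finite C" using C fin by blast
  have "0 \<le> \<epsilon> * real (card C)" using \<epsilon> by simp
  then have "?L \<noteq> {}" using big by (metis card.empty less_le_not_le of_nat_0)
  then have "arcs ?L Y < (\<Sum>x\<in>?L. (dens C D - \<epsilon>) * real (card Y))"
    unfolding arcs_def by (intro sum_strict_mono) (use fC in auto)
  also have "\<dots> = (dens C D - \<epsilon>) * (real (card ?L) * real (card Y))" by simp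
  finally have "irreg \<epsilon> C D" unfolding irreg_def using big Y by (intro exI[of _ ?L] exI[of _ Y]) auto
  then show False using reg by simp
qed

text \<open>Each \<open>j\<close> spoils at most an \<open>\<epsilon>\<close> share of the cell, so
  one such share of \<open>Y i\<close> survives.\<close>

lemma many_typical:
  fixes C :: "'i \<Rightarrow> 'a set"
  assumes R: "finite R" and C: "C i \<subseteq> V" "C i \<noteq> {}" and \<epsilon>: "0 < \<epsilon>"
    and reg: "\<And>j. j \<in> R \<Longrightarrow> \<not> irreg \<epsilon> (C i) (C j)"
    and Y: "Y i \<subseteq> C i" "\<And>j. j \<in> R \<Longrightarrow> Y j \<subseteq> C j \<and> \<epsilon> * real (card (C j)) \<le> real (card (Y j))"
    and big: "(real (card R) + 1) * \<epsilon> * real (card (C i)) \<le> real (card (Y i))"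
  shows "\<epsilon> * real (card (C i))
    \<le> real (card {x \<in> Y i. \<forall>j\<in>R. (dens (C i) (C j) - \<epsilon>) * real (card (Y j)) \<le> deg_in (Y j) x})"
    (is "_ \<le> real (card ?G)")
proof -
  define low where "low j = {x \<in> C i. deg_in (Y j) x < (dens (C i) (C j) - \<epsilon>) * real (card (Y j))}" for j
  have low: "real (card (low j)) \<le> \<epsilon> * real (card (C i))" if j: "j \<in> R" for j
    unfolding low_def by (rule few_low_degree[OF reg[OF j] C _ _ \<epsilon>]) (use Y(2)[OF j] in auto)
  have f: "finite (C i)" "finite (Y i)" using C(1) Y(1) fin by blast+
  have "card (Y i) \<le> card (?G \<union> (\<Union>j\<in>R. low j))"
    by (rule card_mono) (use R f Y(1) in \<open>auto simp: low_def not_le\<close>)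
  also have "\<dots> \<le> card ?G + card (\<Union>j\<in>R. low j)" by (rule card_Un_le)
  also have "card (\<Union>j\<in>R. low j) \<le> (\<Sum>j\<in>R. card (low j))" by (rule card_UN_le[OF R])
  finally have "card (Y i) \<le> card ?G + (\<Sum>j\<in>R. card (low j))" by simp
  then have "real (card (Y i)) \<le> real (card ?G + (\<Sum>j\<in>R. card (low j)))" by (rule of_nat_mono)
  also have "\<dots> = real (card ?G) + (\<Sum>j\<in>R. real (card (low j)))" by simp
  also have "(\<Sum>j\<in>R. real (card (low j))) \<le> (\<Sum>j\<in>R. \<epsilon> * real (card (C i)))" by (intro sum_mono low)
  finally show ?thesis using big by (simp add: algebra_simps)
qed

text \<open>The typical vertices of one cell span an edge, both ends of which see at least a share
  \<open>1 / 2 + \<gamma> / 2\<close> of every other \<open>Y j\<close>; so their common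
  neighbourhood keeps at least a share \<open>\<gamma> / 2\<close>. The share \<open>\<rho>\<close>
  of the cells still in use shrinks by this factor in each round, which explains the power in the
  last assumption, while \<open>m\<close> is a fixed bound on the number of rounds.\<close>

lemma embed_edges:
  fixes C :: "'i \<Rightarrow> 'a set"
  assumes "finite Q"
    and C: "\<And>i. i \<in> Q \<Longrightarrow> C i \<subseteq> V" "\<And>i. i \<in> Q \<Longrightarrow> a \<le> \<epsilon> * real (card (C i))"
    and reg: "\<And>i j. i \<in> Q \<Longrightarrow> j \<in> Q \<Longrightarrow> i \<noteq> j \<Longrightarrow> \<not> irreg \<epsilon> (C i) (C j) \<and> dens (C i) (C j) \<ge> 1 / 2 + \<gamma>"
    and Y: "\<And>i. i \<in> Q \<Longrightarrow> Y i \<subseteq> C i \<and> \<rho> * real (card (C i)) \<le> real (card (Y i))"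
    and \<epsilon>: "0 < \<epsilon>" "2 * \<epsilon> \<le> \<gamma>" "\<gamma> \<le> 1" "0 \<le> \<rho>"
    and m: "card Q \<le> m" "(real m + 1) * \<epsilon> \<le> \<rho> * (\<gamma> / 2) ^ card Q"
  shows "\<exists>K \<subseteq> (\<Union>i\<in>Q. Y i). is_clique K \<and> card K = 2 * card Q"
  using assms
proof (induction Q arbitrary: Y \<rho> rule: finite_induct)
  case empty
  then show ?case by (auto simp: is_clique_def)
next
  case (insert i Q)
  note C = insert.prems(1,2) and reg = insert.prems(3) and Y = insert.prems(4) and \<epsilon> = insert.prems(5-8) and m = insert.prems(9,10)
  have e1: "0 < \<gamma> / 2" "\<gamma> / 2 \<le> 1" using \<epsilon> by auto
  have \<rho>m: "(real m + 1) * \<epsilon> \<le> \<rho>"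
  proof -
    have "\<rho> * (\<gamma> / 2) ^ card (insert i Q) \<le> \<rho> * 1"
      using e1 \<epsilon> by (intro mult_left_mono power_le_one) auto
    then show ?thesis using m(2) by linarith
  qed
  have m1: "\<epsilon> \<le> (real m + 1) * \<epsilon>" using \<epsilon> by (simp add: mult_le_cancel_right1)
  have cC: "real (card (C j)) > 0" if "j \<in> insert i Q" for j
    using C(2)[OF that] a_pos \<epsilon> by (metis less_le_trans mult_zero_right not_less_iff_gr_or_eq of_nat_0_less_iff of_nat_0 gr0I)
  have fC: "finite (C j)" if "j \<in> insert i Q" for j using C(1)[OF that] fin by blast
  have Yj: "\<epsilon> * real (card (C j)) \<le> real (card (Y j))" if "j \<in> insert i Q" for j
  proof -
    have "\<epsilon> * real (card (C j)) \<le> \<rho> * real (card (C j))" using \<rho>m m1 by (intro mult_right_mono) auto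
    then show ?thesis using Y[OF that] by linarith
  qed
  define G where "G = {x \<in> Y i. \<forall>j\<in>Q. (dens (C i) (C j) - \<epsilon>) * real (card (Y j)) \<le> deg_in (Y j) x}"
  have "real (card G) \<ge> a"
  proof -
    have "\<epsilon> * real (card (C i)) \<le> real (card G)"
      unfolding G_def
    proof (rule many_typical[OF insert.hyps(1) C(1) _ \<epsilon>(1)])
      show "\<not> irreg \<epsilon> (C i) (C j)" if "j \<in> Q" for j using reg[of i j] insert.hyps that by auto
      show "(real (card Q) + 1) * \<epsilon> * real (card (C i)) \<le> real (card (Y i))"
      proof -
        have "(real (card Q) + 1) * \<epsilon> \<le> (real m + 1) * \<epsilon>"
          using m(1) insert.hyps \<epsilon>(1) by (intro mult_right_mono) auto
        then have "(real (card Q) + 1) * \<epsilon> * real (card (C i)) \<le> \<rho> * real (card (C i))"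
          using \<rho>m by (intro mult_right_mono) auto
        then show ?thesis using Y[of i] by simp
      qed
    qed (use Y Yj cC[of i] in auto)
    then show ?thesis using C(2)[of i] by simp
  qed
  moreover have "G \<subseteq> V" using Y[of i] C(1)[of i] by (auto simp: G_def)
  ultimately obtain x y where xy: "x \<in> G" "y \<in> G" "adj x y" using edge_ex[of G] by blast
  define Z where "Z j = {z \<in> Y j. \<forall>v\<in>{x, y}. adj v z}" for j
  have ne: "x \<noteq> y" using xy adj_irrefl by auto
  have Zc: "real (card (Z j)) \<ge> \<gamma> / 2 * real (card (Y j))" if j: "j \<in> Q" for j
  proof -
    have ij: "i \<noteq> j" using j insert.hyps by auto
    have d: "dens (C i) (C j) \<ge> 1 / 2 + \<gamma>" using reg[of i j] ij j by auto
    have deg_in: "deg_in (Y j) v \<ge> (1 / 2 + \<gamma> / 2) * real (card (Y j))" if "v \<in> G" for v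
    proof -
      have "deg_in (Y j) v \<ge> (dens (C i) (C j) - \<epsilon>) * real (card (Y j))" using that j by (auto simp: G_def)
      moreover have "(1 / 2 + \<gamma> / 2) * real (card (Y j)) \<le> (dens (C i) (C j) - \<epsilon>) * real (card (Y j))"
        using d \<epsilon> by (intro mult_right_mono) auto
      ultimately show ?thesis by linarith
    qed
    have fY: "finite (Y j)" using Y[of j] fC[of j] j finite_subset by auto
    have "real (card (Z j)) \<ge> real (card (Y j)) - (\<Sum>v\<in>{x, y}. nondeg_in (Y j) v)"
      unfolding Z_def by (rule common_nb) (use fY in auto)
    then have "real (card (Z j)) \<ge> deg_in (Y j) x + deg_in (Y j) y - real (card (Y j))"
      using ne deg_in_nondeg_in[OF fY, of x] deg_in_nondeg_in[OF fY, of y] by simp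
    moreover have "0 \<le> \<gamma> / 2 * real (card (Y j))" using \<epsilon> by simp
    ultimately show ?thesis using deg_in[OF xy(1)] deg_in[OF xy(2)] by (simp add: algebra_simps)
  qed
  have "\<exists>K \<subseteq> (\<Union>j\<in>Q. Z j). is_clique K \<and> card K = 2 * card Q"
  proof (rule insert.IH[of Z "\<rho> * (\<gamma> / 2)"])
    show "Z j \<subseteq> C j \<and> \<rho> * (\<gamma> / 2) * real (card (C j)) \<le> real (card (Z j))" if j: "j \<in> Q" for j
    proof
      show "Z j \<subseteq> C j" using Y[of j] j by (auto simp: Z_def)
      have "\<rho> * (\<gamma> / 2) * real (card (C j)) = \<gamma> / 2 * (\<rho> * real (card (C j)))" by simp
      also have "\<dots> \<le> \<gamma> / 2 * real (card (Y j))" using Y[of j] j e1 by (intro mult_left_mono) auto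
      finally show "\<rho> * (\<gamma> / 2) * real (card (C j)) \<le> real (card (Z j))" using Zc[OF j] by linarith
    qed
    show "(real m + 1) * \<epsilon> \<le> \<rho> * (\<gamma> / 2) * (\<gamma> / 2) ^ card Q" using m(2) insert.hyps by (simp add: mult.assoc)
  qed (use C reg \<epsilon> m insert.hyps e1 in auto)
  then obtain K where K: "K \<subseteq> (\<Union>j\<in>Q. Z j)" "is_clique K" "card K = 2 * card Q" by blast
  have "K \<subseteq> V" using K(1) Y C(1) by (fastforce simp: Z_def)
  then have fK: "finite K" by (rule fin)
  have nin: "x \<notin> K" "y \<notin> K" using K(1) adj_irrefl by (auto simp: Z_def)
  have adjK: "adj x z" "adj y z" if "z \<in> K" for z using K(1) that by (auto simp: Z_def)
  have "is_clique ({x,y} \<union> K)" using K(2) xy(3) adjK adj_sym unfolding is_clique_def by blast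
  moreover have "card ({x,y} \<union> K) = 2 * card (insert i Q)" using nin fK ne K(3) insert.hyps by simp
  moreover have "{x,y} \<union> K \<subseteq> (\<Union>j\<in>insert i Q. Y j)" using K(1) xy by (auto simp: Z_def G_def)
  ultimately show ?case by blast
qed

text \<open>Every index in \<open>P\<close> contributes one vertex and every index in \<open>Q\<close> an edge. The vertices are chosen first,
  since the common neighbourhood of the ends of an edge is large only for densities above \<open>1 / 2\<close>.\<close>

lemma embed:
  fixes C :: "'i \<Rightarrow> 'a set"
  assumes "finite P" "finite Q" "P \<inter> Q = {}"
    and C: "\<And>i. i \<in> P \<union> Q \<Longrightarrow> C i \<subseteq> V" "\<And>i. i \<in> P \<union> Q \<Longrightarrow> a \<le> \<epsilon> * real (card (C i))"
    and reg: "\<And>i j. i \<in> P \<union> Q \<Longrightarrow> j \<in> P \<union> Q \<Longrightarrow> i \<noteq> j \<Longrightarrow> \<not> irreg \<epsilon> (C i) (C j) \<and> dens (C i) (C j) \<ge> \<gamma>"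
    and full: "\<And>i j. i \<in> Q \<Longrightarrow> j \<in> Q \<Longrightarrow> i \<noteq> j \<Longrightarrow> dens (C i) (C j) \<ge> 1 / 2 + \<gamma>"
    and Y: "\<And>i. i \<in> P \<union> Q \<Longrightarrow> Y i \<subseteq> C i \<and> \<rho> * real (card (C i)) \<le> real (card (Y i))"
    and \<epsilon>: "0 < \<epsilon>" "2 * \<epsilon> \<le> \<gamma>" "\<gamma> \<le> 1" "0 \<le> \<rho>"
    and m: "card P + card Q \<le> m" "(real m + 1) * \<epsilon> \<le> \<rho> * (\<gamma> / 2) ^ (card P + card Q)"
  shows "\<exists>K \<subseteq> (\<Union>i\<in>P \<union> Q. Y i). is_clique K \<and> card K = card P + 2 * card Q"
  using assms
proof (induction P arbitrary: Y \<rho> rule: finite_induct)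
  case empty
  have "\<exists>K \<subseteq> (\<Union>i\<in>Q. Y i). is_clique K \<and> card K = 2 * card Q"
    by (rule embed_edges[where C = C and \<epsilon> = \<epsilon> and \<gamma> = \<gamma> and \<rho> = \<rho> and m = m]) (use empty in auto)
  then show ?case by simp
next
  case (insert i P)
  note fQ = insert.prems(1) and disj = insert.prems(2) and C = insert.prems(3,4) and reg = insert.prems(5)
    and full = insert.prems(6) and Y = insert.prems(7) and \<epsilon> = insert.prems(8-11) and m = insert.prems(12,13)
  let ?R = "P \<union> Q"
  have iR: "i \<notin> ?R" "finite ?R" using insert.hyps disj fQ by auto
  have cR: "card ?R = card P + card Q" using insert.hyps disj fQ by (intro card_Un_disjoint) auto
  have e1: "0 < \<gamma> / 2" "\<gamma> / 2 \<le> 1" using \<epsilon> by auto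
  have \<rho>m: "(real m + 1) * \<epsilon> \<le> \<rho>"
  proof -
    have "\<rho> * (\<gamma> / 2) ^ (card (insert i P) + card Q) \<le> \<rho> * 1"
      using e1 \<epsilon> by (intro mult_left_mono power_le_one) auto
    then show ?thesis using m(2) by linarith
  qed
  have m1: "\<epsilon> \<le> (real m + 1) * \<epsilon>" using \<epsilon> by (simp add: mult_le_cancel_right1)
  have cC: "real (card (C j)) > 0" if "j \<in> insert i P \<union> Q" for j
    using C(2)[OF that] a_pos \<epsilon> by (metis less_le_trans mult_zero_right not_less_iff_gr_or_eq of_nat_0_less_iff of_nat_0 gr0I)
  have Yj: "\<epsilon> * real (card (C j)) \<le> real (card (Y j))" if "j \<in> insert i P \<union> Q" for j
  proof -
    have "\<epsilon> * real (card (C j)) \<le> \<rho> * real (card (C j))" using \<rho>m m1 by (intro mult_right_mono) auto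
    then show ?thesis using Y[OF that] by linarith
  qed
  define G where "G = {x \<in> Y i. \<forall>j\<in>?R. (dens (C i) (C j) - \<epsilon>) * real (card (Y j)) \<le> deg_in (Y j) x}"
  have "real (card G) > 0"
  proof -
    have "\<epsilon> * real (card (C i)) \<le> real (card G)"
      unfolding G_def
    proof (rule many_typical[OF iR(2) C(1) _ \<epsilon>(1)])
      show "\<not> irreg \<epsilon> (C i) (C j)" if "j \<in> ?R" for j using reg[of i j] iR that by auto
      show "(real (card ?R) + 1) * \<epsilon> * real (card (C i)) \<le> real (card (Y i))"
      proof -
        have "(real (card ?R) + 1) * \<epsilon> \<le> (real m + 1) * \<epsilon>"
          using m(1) insert.hyps cR \<epsilon>(1) by (intro mult_right_mono) auto
        then have "(real (card ?R) + 1) * \<epsilon> * real (card (C i)) \<le> \<rho> * real (card (C i))"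
          using \<rho>m by (intro mult_right_mono) auto
        then show ?thesis using Y[of i] by simp
      qed
    qed (use Y Yj cC[of i] in auto)
    then show ?thesis using C(2)[of i] a_pos by simp
  qed
  then obtain x where x: "x \<in> G" by (metis card.empty ex_in_conv less_irrefl of_nat_0)
  define Z where "Z j = {z \<in> Y j. adj x z}" for j
  have Zc: "real (card (Z j)) \<ge> \<gamma> / 2 * real (card (Y j))" if j: "j \<in> ?R" for j
  proof -
    have ij: "i \<noteq> j" using j iR by auto
    have d: "dens (C i) (C j) \<ge> \<gamma>" using reg[of i j] ij j by auto
    have "deg_in (Y j) x \<ge> (dens (C i) (C j) - \<epsilon>) * real (card (Y j))" using x j by (auto simp: G_def)
    moreover have "\<gamma> / 2 * real (card (Y j)) \<le> (dens (C i) (C j) - \<epsilon>) * real (card (Y j))"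
      using d \<epsilon> by (intro mult_right_mono) auto
    ultimately show ?thesis by (simp add: Z_def deg_in_def)
  qed
  have "\<exists>K \<subseteq> (\<Union>j\<in>?R. Z j). is_clique K \<and> card K = card P + 2 * card Q"
  proof (rule insert.IH[of Z "\<rho> * (\<gamma> / 2)"])
    show "Z j \<subseteq> C j \<and> \<rho> * (\<gamma> / 2) * real (card (C j)) \<le> real (card (Z j))" if j: "j \<in> ?R" for j
    proof
      show "Z j \<subseteq> C j" using Y[of j] j by (auto simp: Z_def)
      have "\<rho> * (\<gamma> / 2) * real (card (C j)) = \<gamma> / 2 * (\<rho> * real (card (C j)))" by simp
      also have "\<dots> \<le> \<gamma> / 2 * real (card (Y j))" using Y[of j] j e1 by (intro mult_left_mono) auto
      finally show "\<rho> * (\<gamma> / 2) * real (card (C j)) \<le> real (card (Z j))" using Zc[OF j] by linarith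
    qed
    show "(real m + 1) * \<epsilon> \<le> \<rho> * (\<gamma> / 2) * (\<gamma> / 2) ^ (card P + card Q)"
      using m(2) insert.hyps by (simp add: mult.assoc)
    show "card P + card Q \<le> m" using m(1) insert.hyps by simp
    show "\<And>k j. k \<in> ?R \<Longrightarrow> j \<in> ?R \<Longrightarrow> k \<noteq> j \<Longrightarrow> \<not> irreg \<epsilon> (C k) (C j) \<and> \<gamma> \<le> dens (C k) (C j)" using reg by auto
    show "\<And>k j. k \<in> Q \<Longrightarrow> j \<in> Q \<Longrightarrow> k \<noteq> j \<Longrightarrow> 1 / 2 + \<gamma> \<le> dens (C k) (C j)" using full by auto
    show "0 \<le> \<rho> * (\<gamma> / 2)" using \<epsilon> e1 by simp
  qed (use C \<epsilon> disj fQ in auto)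
  then obtain K where K: "K \<subseteq> (\<Union>j\<in>?R. Z j)" "is_clique K" "card K = card P + 2 * card Q" by blast
  have "K \<subseteq> V" using K(1) Y C(1) by (fastforce simp: Z_def)
  then have fK: "finite K" by (rule fin)
  have adjK: "adj x z" if "z \<in> K" for z using K(1) that by (auto simp: Z_def)
  then have nin: "x \<notin> K" using adj_irrefl by blast
  have "is_clique (insert x K)" using K(2) adjK adj_sym unfolding is_clique_def by blast
  moreover have "card (insert x K) = card (insert i P) + 2 * card Q" using nin fK K(3) insert.hyps by simp
  moreover have "insert x K \<subseteq> (\<Union>j\<in>insert i P \<union> Q. Y j)" using K(1) x by (auto simp: Z_def G_def)
  ultimately show ?case by blast
qed

end

section \<open>Weighted cliques\<close>

text \<open>The extremal weighted graph has \<open>r\<close> parts of sizes proportional to \<open>part_weight\<close>, with weights \<open>pattern\<close> between them.\<close>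

definition pattern :: "nat \<Rightarrow> nat \<Rightarrow> real" where
  "pattern i j = (if i = j then 0 else if i < 2 \<and> j < 2 then 1 / 2 else 1)"

definition part_weight :: "nat \<Rightarrow> real" where
  "part_weight i = (if i < 2 then 2 else 3)"

lemma pattern_sym: "pattern i j = pattern j i"
  by (auto simp: pattern_def)

lemma two_le_sum:
  fixes f :: "'b \<Rightarrow> real"
  assumes "finite S" "x \<in> S" "y \<in> S" "x \<noteq> y" "\<And>z. z \<in> S \<Longrightarrow> 0 \<le> f z"
  shows "f x + f y \<le> sum f S"
proof -
  have "sum f {x, y} \<le> sum f S" by (rule sum_mono2) (use assms in auto)
  then show ?thesis using assms by simp
qed

lemma three_le_sum:
  fixes f :: "'b \<Rightarrow> real"
  assumes "finite S" "x \<in> S" "y \<in> S" "z \<in> S" "x \<noteq> y" "x \<noteq> z" "y \<noteq> z" "\<And>z. z \<in> S \<Longrightarrow> 0 \<le> f z"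
  shows "f x + f y + f z \<le> sum f S"
proof -
  have "sum f {x, y, z} \<le> sum f S" by (rule sum_mono2) (use assms in auto)
  then show ?thesis using assms by (simp add: add.assoc)
qed

text \<open>In the application \<open>w x y\<close> is \<open>0\<close>, \<open>1 / 2\<close> or \<open>1\<close> according to whether the density between the cells
  of \<open>x\<close> and \<open>y\<close> is negligible, at most about \<open>1 / 2\<close>, or larger; a pair \<open>(Q, P)\<close> as in the last
  assumption then yields a clique with two vertices in each cell of \<open>Q\<close> and one in each cell of \<open>P\<close>.\<close>

locale wgraph =
  fixes V :: "'a set" and w :: "'a \<Rightarrow> 'a \<Rightarrow> real" and r :: nat
  assumes fV: "finite V"
    and w_sym: "w x y = w y x"
    and w_vals: "w x y = 0 \<or> w x y = 1 / 2 \<or> w x y = 1"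
    and w_refl: "x \<in> V \<Longrightarrow> w x x = 0"
    and r2: "r \<ge> 2"
    and no_weighted_clique: "Q \<subseteq> V \<Longrightarrow> P \<subseteq> V \<Longrightarrow> Q \<inter> P = {} \<Longrightarrow>
      (\<And>x y. x \<in> Q \<Longrightarrow> y \<in> Q \<Longrightarrow> x \<noteq> y \<Longrightarrow> w x y = 1) \<Longrightarrow>
      (\<And>x y. x \<in> Q \<union> P \<Longrightarrow> y \<in> Q \<union> P \<Longrightarrow> x \<noteq> y \<Longrightarrow> w x y > 0) \<Longrightarrow>
      2 * card Q + card P < 2 * r"
begin

lemma w_bounds [simp]: "0 \<le> w x y" "w x y \<le> 1"
  using w_vals[of x y] by auto

definition weighted_clique :: "'a set \<Rightarrow> 'a set \<Rightarrow> bool" where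
  "weighted_clique Q P \<longleftrightarrow> Q \<subseteq> V \<and> P \<subseteq> V \<and> Q \<inter> P = {} \<and> (\<forall>x\<in>Q. \<forall>y\<in>Q. x \<noteq> y \<longrightarrow> w x y = 1) \<and>
     (\<forall>x\<in>Q \<union> P. \<forall>y\<in>Q \<union> P. x \<noteq> y \<longrightarrow> w x y > 0)"

lemma weighted_clique_bound: "weighted_clique Q P \<Longrightarrow> 2 * card Q + card P < 2 * r"
  unfolding weighted_clique_def by (intro no_weighted_clique) auto

lemma weighted_clique_fin: "weighted_clique Q P \<Longrightarrow> finite Q \<and> finite P"
  unfolding weighted_clique_def using fV finite_subset by blast

definition wsum :: "'a set \<Rightarrow> real" where
  "wsum S = (\<Sum>x\<in>S. \<Sum>y\<in>S. w x y)"

text \<open>A weighted clique has fewer than \<open>2 * r\<close> vertices, so its total weight is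
  at most \<open>(2 * r)\<^sup>2\<close>.\<close>

definition big :: real where "big = 4 * (real r)\<^sup>2 + 1"

text \<open>A lexicographic potential: first the clique size \<open>2 |Q| + |P|\<close>, then \<open>|Q|\<close>, then the
  total weight, which is less than \<open>big\<close>.\<close>

definition potential :: "'a set \<Rightarrow> 'a set \<Rightarrow> real" where
  "potential Q P = real (2 * card Q + card P) * big\<^sup>2 + real (card Q) * big + wsum (Q \<union> P)"

definition is_max :: "'a set \<Rightarrow> 'a set \<Rightarrow> bool" where
  "is_max Q P \<longleftrightarrow> weighted_clique Q P \<and> (\<forall>Q' P'. weighted_clique Q' P' \<longrightarrow> potential Q' P' \<le> potential Q P)"

lemma max_exists: obtains Q P where "is_max Q P"
proof -
  let ?A = "{(Q, P). weighted_clique Q P}"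
  have "?A \<subseteq> Pow V \<times> Pow V" by (auto simp: weighted_clique_def)
  then have fA: "finite ?A" by (rule finite_subset) (simp add: fV)
  let ?f = "\<lambda>x. potential (fst x) (snd x)"
  have "({}, {}) \<in> ?A" by (auto simp: weighted_clique_def)
  then have ne: "?f ` ?A \<noteq> {}" by blast
  have "Max (?f ` ?A) \<in> ?f ` ?A" by (rule Max_in[OF finite_imageI[OF fA] ne])
  then obtain x where x: "x \<in> ?A" "Max (?f ` ?A) = ?f x" by blast
  have "potential Q' P' \<le> ?f x" if "weighted_clique Q' P'" for Q' P'
  proof -
    have "?f (Q', P') \<le> Max (?f ` ?A)" by (rule Max_ge[OF finite_imageI[OF fA] imageI]) (use that in simp)
    then show ?thesis using x by simp
  qed
  then show ?thesis using x that[of "fst x" "snd x"] by (auto simp: is_max_def)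
qed

lemma wsum_bounds: "weighted_clique Q P \<Longrightarrow> 0 \<le> wsum (Q \<union> P)" "weighted_clique Q P \<Longrightarrow> wsum (Q \<union> P) < big"
proof -
  show "0 \<le> wsum (Q \<union> P)" by (simp add: wsum_def sum_nonneg)
  assume st: "weighted_clique Q P"
  have "wsum (Q \<union> P) \<le> (\<Sum>x\<in>Q \<union> P. \<Sum>y\<in>Q \<union> P. 1)" unfolding wsum_def by (intro sum_mono) simp
  also have "\<dots> = (real (card (Q \<union> P)))\<^sup>2" by (simp add: power2_eq_square)
  also have "\<dots> \<le> (real (2 * r))\<^sup>2"
    using weighted_clique_bound[OF st] card_Un_le[of Q P] by (intro power_mono) auto
  finally show "wsum (Q \<union> P) < big" by (simp add: big_def power2_eq_square)
qed

lemma big_ge: "big \<ge> 1" "big \<le> big\<^sup>2"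
proof -
  show 1: "big \<ge> 1" by (simp add: big_def)
  show "big \<le> big\<^sup>2" by (rule self_le_power) (use 1 in auto)
qed

text \<open>The first of three exchange rules read off from the potential: one more unit of clique
  size gains \<open>big\<^sup>2\<close>, which outweighs any change of the total weight as long as
  \<open>card Q\<close> does not drop.\<close>

lemma improve1:
  assumes "is_max Q P" "weighted_clique Q' P'" "2 * card Q' + card P' = Suc (2 * card Q + card P)" "card Q' \<ge> card Q"
  shows False
proof -
  have "potential Q' P' \<le> potential Q P" "weighted_clique Q P" using assms by (auto simp: is_max_def)
  moreover have "real (card Q) * big \<le> real (card Q') * big"
    using assms(4) big_ge by (intro mult_right_mono) auto
  moreover have "real (2 * card Q' + card P') * big\<^sup>2 = real (2 * card Q + card P) * big\<^sup>2 + big\<^sup>2"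
    unfolding assms(3) by (simp add: algebra_simps)
  ultimately show False
    using wsum_bounds[of Q P] wsum_bounds[of Q' P'] assms(2) big_ge unfolding potential_def by linarith
qed

lemma improve2:
  assumes "is_max Q P" "weighted_clique Q' P'" "2 * card Q' + card P' = 2 * card Q + card P" "card Q' = Suc (card Q)"
  shows False
proof -
  have "potential Q' P' \<le> potential Q P" "weighted_clique Q P" using assms by (auto simp: is_max_def)
  moreover have "real (card Q') * big = real (card Q) * big + big"
    using assms(4) by (simp add: algebra_simps)
  moreover have "real (2 * card Q' + card P') * big\<^sup>2 = real (2 * card Q + card P) * big\<^sup>2"
    unfolding assms(3) ..
  ultimately show False
    using wsum_bounds[of Q P] wsum_bounds[of Q' P'] assms(2,3) big_ge unfolding potential_def by linarith
qed

lemma improve3: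
  assumes "is_max Q P" "weighted_clique Q' P'" "card Q' = card Q" "card P' = card P"
  shows "wsum (Q' \<union> P') \<le> wsum (Q \<union> P)"
    and "wsum (Q' \<union> P') = wsum (Q \<union> P) \<Longrightarrow> is_max Q' P'"
proof -
  have "potential Q' P' \<le> potential Q P" using assms by (simp add: is_max_def)
  then show "wsum (Q' \<union> P') \<le> wsum (Q \<union> P)" unfolding potential_def assms(3,4) by simp
  assume "wsum (Q' \<union> P') = wsum (Q \<union> P)"
  then have "potential Q' P' = potential Q P" unfolding potential_def assms(3,4) by simp
  then show "is_max Q' P'" using assms(1,2) by (simp add: is_max_def)
qed

lemma wsum_insert:
  assumes "finite T" "v \<notin> T" "v \<in> V"
  shows "wsum (insert v T) = wsum T + 2 * (\<Sum>y\<in>T. w v y)"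
proof -
  have "(\<Sum>x\<in>T. w x v) = (\<Sum>y\<in>T. w v y)" by (intro sum.cong refl w_sym)
  then show ?thesis using assms by (simp add: wsum_def sum.distrib w_refl)
qed

lemma weighted_clique_subset:
  assumes "weighted_clique Q P" "Q' \<subseteq> Q" "P' \<subseteq> Q \<union> P" "Q' \<inter> P' = {}"
  shows "weighted_clique Q' P'"
  using assms unfolding weighted_clique_def by blast

lemma weighted_clique_insert:
  assumes "weighted_clique Q P" "v \<in> V" "v \<notin> Q \<union> P" "\<And>y. y \<in> Q \<union> P \<Longrightarrow> w v y > 0"
  shows "weighted_clique Q (insert v P)" "(\<And>y. y \<in> Q \<Longrightarrow> w v y = 1) \<Longrightarrow> weighted_clique (insert v Q) P"
proof -
  have pos: "w x y > 0" if xy: "x \<in> insert v (Q \<union> P)" "y \<in> insert v (Q \<union> P)" "x \<noteq> y" for x y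
  proof -
    consider "x = v" "y \<in> Q \<union> P" | "y = v" "x \<in> Q \<union> P" | "x \<in> Q \<union> P" "y \<in> Q \<union> P" using xy by blast
    then show ?thesis
    proof cases
      case 1 then show ?thesis using assms(4) by simp
    next
      case 2 then show ?thesis using assms(4)[of x] w_sym[of x y] by simp
    next
      case 3 then show ?thesis using assms(1) xy(3) unfolding weighted_clique_def by blast
    qed
  qed
  then show "weighted_clique Q (insert v P)" using assms(1-3) by (auto simp: weighted_clique_def)
  assume f: "\<And>y. y \<in> Q \<Longrightarrow> w v y = 1"
  have "w x y = 1" if xy: "x \<in> insert v Q" "y \<in> insert v Q" "x \<noteq> y" for x y
  proof -
    consider "x = v" "y \<in> Q" | "y = v" "x \<in> Q" | "x \<in> Q" "y \<in> Q" using xy by blast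
    then show ?thesis
    proof cases
      case 1 then show ?thesis using f by simp
    next
      case 2 then show ?thesis using f[of x] w_sym[of x y] by simp
    next
      case 3 then show ?thesis using assms(1) xy(3) unfolding weighted_clique_def by blast
    qed
  qed
  then show "weighted_clique (insert v Q) P" using assms(1-3) pos by (auto simp: weighted_clique_def)
qed

section \<open>Replacing a member of a maximal weighted clique\<close>

definition mult :: "'a set \<Rightarrow> 'a \<Rightarrow> real" where
  "mult Q u = (if u \<in> Q then 2 else 1)"

text \<open>The weight that \<open>v\<close> misses towards the clique. Members of \<open>Q\<close>
  count twice, so the multiplicities add up to the clique size, which is at most
  \<open>2 * r - 1\<close>.\<close>

definition deficiency :: "'a set \<Rightarrow> 'a set \<Rightarrow> 'a \<Rightarrow> real" where
  "deficiency Q P v = (\<Sum>u\<in>Q \<union> P. mult Q u * (1 - w v u))"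

text \<open>\<open>swappable Q P v z\<close>: replacing \<open>z\<close> by \<open>v\<close> gives an equally good weighted clique.\<close>

definition swappable :: "'a set \<Rightarrow> 'a set \<Rightarrow> 'a \<Rightarrow> 'a \<Rightarrow> bool" where
  "swappable Q P v z \<longleftrightarrow> w v z = 0 \<and>
     (z \<in> Q \<and> (\<forall>y\<in>Q \<union> P - {z}. w v y = 1) \<or>
      z \<in> P \<and> (\<exists>u\<in>Q. w v u = 1 / 2 \<and> (\<forall>y\<in>Q \<union> P - {z, u}. w v y = 1)))"

lemma weighted_clique_card_add:
  assumes "weighted_clique Q P"
  shows "v \<notin> Q \<Longrightarrow> card (insert v Q) = Suc (card Q)" "v \<notin> P \<Longrightarrow> card (insert v P) = Suc (card P)"
    "v \<in> P \<Longrightarrow> Suc (card (P - {v})) = card P" "v \<in> Q \<Longrightarrow> Suc (card (Q - {v})) = card Q"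
  using weighted_clique_fin[OF assms] card_Suc_Diff1[of P v] card_Suc_Diff1[of Q v] by (blast intro: card_insert_disjoint)+

text \<open>A vertex that missed less than 2 could enter and enlarge the clique. All contributions
  are multiples of \<open>1 / 2\<close>, so below \<open>5 / 2\<close> the value is exactly 2, and
  three configurations remain: a zero to \<open>Q\<close>, a half to \<open>Q\<close> with a zero to
  \<open>P\<close>, or two zeros to \<open>P\<close>. The last one is impossible because
  \<open>v\<close> could then enlarge \<open>Q\<close>.\<close>

lemma deficiency_main:
  assumes mx: "is_max Q P" and v: "v \<in> V"
  shows "deficiency Q P v \<ge> 2 \<and> (deficiency Q P v < 5 / 2 \<longrightarrow> (\<exists>z. swappable Q P v z))"
proof -
  let ?f = "\<lambda>u. mult Q u * (1 - w v u)"
  have st: "weighted_clique Q P" using mx by (simp add: is_max_def)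
  have fQ: "finite Q" "finite P" "finite (Q \<union> P)" using weighted_clique_fin[OF st] by auto
  have QP: "Q \<inter> P = {}" "Q \<subseteq> V" "P \<subseteq> V" using st by (auto simp: weighted_clique_def)
  have pos: "w x y > 0" if "x \<in> Q \<union> P" "y \<in> Q \<union> P" "x \<noteq> y" for x y using st that by (auto simp: weighted_clique_def)
  have full: "w x y = 1" if "x \<in> Q" "y \<in> Q" "x \<noteq> y" for x y using st that by (auto simp: weighted_clique_def)
  have nn: "0 \<le> ?f u" for u by (simp add: mult_def)
  note one = member_le_sum[of _ "Q \<union> P" ?f, OF _ nn fQ(3), folded deficiency_def]
  note two = two_le_sum[of "Q \<union> P" _ _ ?f, OF fQ(3) _ _ _ nn, folded deficiency_def]
  note three = three_le_sum[of "Q \<union> P" _ _ _ ?f, OF fQ(3) _ _ _ _ _ _ nn, folded deficiency_def]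
  have half: "?f y \<ge> 1 / 2" if "w v y \<noteq> 1" for y
    using that w_vals[of v y] by (auto simp: mult_def)
  consider (A) z where "z \<in> Q" "w v z = 0" | (B) "\<forall>z\<in>Q. w v z > 0"
    by (metis w_bounds(1) order_le_less)
  then show ?thesis
  proof cases
    case A
    have fz: "?f z = 2" using A by (simp add: mult_def)
    have "deficiency Q P v \<ge> 2" using one[of z] fz A by simp
    moreover have "swappable Q P v z" if "deficiency Q P v < 5 / 2"
    proof -
      have "w v y = 1" if y: "y \<in> Q \<union> P - {z}" for y
      proof (rule ccontr)
        assume "w v y \<noteq> 1"
        then show False using half[of y] two[of z y] fz A y \<open>deficiency Q P v < 5 / 2\<close> by auto
      qed
      then show ?thesis using A by (auto simp: swappable_def)
    qed
    ultimately show ?thesis by blast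
  next
    case B
    have "\<exists>p\<in>P. w v p = 0"
    proof (rule ccontr)
      assume "\<not> ?thesis"
      then have p: "w v p > 0" if "p \<in> P" for p using that w_vals[of v p] by auto
      have vn: "v \<notin> Q" "v \<notin> P" using B p w_refl[OF v] by force+
      have "weighted_clique Q (insert v P)" by (rule weighted_clique_insert(1)[OF st v]) (use vn p B in auto)
      then show False using improve1[OF mx, of Q "insert v P"] weighted_clique_card_add[OF st] vn by simp
    qed
    then obtain p where p: "p \<in> P" "w v p = 0" by blast
    have pQ: "p \<notin> Q" using p QP by auto
    have fp: "?f p = 1" using p pQ by (simp add: mult_def)
    show ?thesis
    proof (cases "\<forall>u\<in>Q. w v u = 1")
      case True
      have vQ: "v \<notin> Q" using B w_refl[OF v] by force
      have "\<exists>p'\<in>P. p' \<noteq> p \<and> w v p' = 0"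
      proof (rule ccontr)
        assume n: "\<not> ?thesis"
        then have pp: "w v p' > 0" if "p' \<in> P - {p}" for p' using that w_vals[of v p'] by auto
        have vP: "v \<notin> P - {p}" using pp w_refl[OF v] by force
        \<comment> \<open>If \<open>p\<close> is the only obstacle, \<open>v\<close> enters
          \<open>Q\<close> at the expense of \<open>p\<close>, and the clique size grows by
          \<open>2 - 1\<close>.\<close>
        have "weighted_clique Q (P - {p})" by (rule weighted_clique_subset[OF st]) (use QP in auto)
        then have "weighted_clique (insert v Q) (P - {p})"
          by (rule weighted_clique_insert(2)[OF _ v]) (use vQ vP pp True in auto)
        then show False
          using improve1[OF mx, of "insert v Q" "P - {p}"] weighted_clique_card_add(1)[OF st vQ] weighted_clique_card_add(3)[OF st p(1)] by simp
      qed
      then obtain p' where p': "p' \<in> P" "p' \<noteq> p" "w v p' = 0" by blast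
      have fp': "?f p' = 1" using p' QP by (auto simp: mult_def)
      have "deficiency Q P v \<ge> 2" using two[of p p'] fp fp' p p' by auto
      moreover have False if lt: "deficiency Q P v < 5 / 2"
      proof -
        have pp: "w v y = 1" if "y \<in> P - {p, p'}" for y
        proof (rule ccontr)
          assume "w v y \<noteq> 1"
          then show False using three[of p p' y] half[of y] fp fp' p p' that lt by auto
        qed
        have vP: "v \<notin> P - {p, p'}" using pp w_refl[OF v] by force
        \<comment> \<open>Trading \<open>p\<close> and \<open>p'\<close> for \<open>v\<close> in
          \<open>Q\<close> preserves the clique size but enlarges \<open>Q\<close>.\<close>
        have "weighted_clique Q (P - {p, p'})" by (rule weighted_clique_subset[OF st]) (use QP in auto)
        then have "weighted_clique (insert v Q) (P - {p, p'})"
          by (rule weighted_clique_insert(2)[OF _ v]) (use vQ vP pp True in auto)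
        moreover have "Suc (Suc (card (P - {p, p'}))) = card P"
          using p p' fQ card_Diff_subset[of "{p,p'}" P] card_mono[of P "{p,p'}"] by simp
        ultimately show False
          using improve2[OF mx, of "insert v Q" "P - {p, p'}"] weighted_clique_card_add(1)[OF st vQ] by simp
      qed
      ultimately show ?thesis by blast
    next
      case False
      then obtain u where u: "u \<in> Q" "w v u = 1 / 2" using B w_vals[of v] by force
      have fu: "?f u = 1" using u by (simp add: mult_def)
      have up: "u \<noteq> p" using u pQ by auto
      have "deficiency Q P v \<ge> 2" using two[of p u] fp fu p u up by auto
      moreover have "swappable Q P v p" if lt: "deficiency Q P v < 5 / 2"
      proof -
        have "w v y = 1" if "y \<in> Q \<union> P - {p, u}" for y
        proof (rule ccontr)
          assume "w v y \<noteq> 1"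
          then show False using three[of p u y] half[of y] fp fu p u up that lt by auto
        qed
        then show ?thesis using p u unfolding swappable_def by blast
      qed
      ultimately show ?thesis by blast
    qed
  qed
qed

text \<open>Replacing \<open>z\<close> by \<open>v\<close> preserves both cardinalities, so by
  maximality of the total weight \<open>z\<close> sees the rest of the clique at least as well as
  \<open>v\<close>. Hence \<open>z\<close> is of the same kind as \<open>v\<close>, the new pair is
  again maximal, and only one summand of the deficiency changes.\<close>

lemma swappable_swap:
  assumes mx: "is_max Q P" and v: "v \<in> V" and l: "swappable Q P v z"
  shows "swappable Q P z z"
    and "\<exists>Q' P'. is_max Q' P' \<and> (\<forall>x. deficiency Q' P' x = deficiency Q P x - mult Q z * (1 - w x z) + mult Q z * (1 - w x v))"
proof -
  have st: "weighted_clique Q P" using mx by (simp add: is_max_def)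
  have fQ: "finite Q" "finite P" "finite (Q \<union> P)" using weighted_clique_fin[OF st] by auto
  have QP: "Q \<inter> P = {}" "Q \<subseteq> V" "P \<subseteq> V" using st by (auto simp: weighted_clique_def)
  have zS: "z \<in> Q \<union> P" using l by (auto simp: swappable_def)
  have "swappable Q P z z \<and> (\<exists>Q' P'. is_max Q' P' \<and> (\<forall>x. deficiency Q' P' x = deficiency Q P x - mult Q z * (1 - w x z) + mult Q z * (1 - w x v)))"
  proof (cases "v = z")
    case True
    then show ?thesis using l mx by auto
  next
    case False
    have vpos: "w v y > 0" if y: "y \<in> Q \<union> P - {z}" for y
    proof -
      from l consider "w v y = 1" | u where "u \<in> Q" "w v u = 1 / 2" "\<forall>y\<in>Q \<union> P - {z, u}. w v y = 1"
        using y unfolding swappable_def by blast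
      then show ?thesis
      proof cases
        case 2
        then show ?thesis using y by (cases "y = u") auto
      qed simp
    qed
    have vS: "v \<notin> Q \<union> P" using vpos[of v] False w_refl[OF v] by auto
    define T where "T = Q \<union> P - {z}"
    have T: "finite T" "v \<notin> T" "z \<notin> T" "insert z T = Q \<union> P" using fQ vS zS by (auto simp: T_def)
    define Q' P' where "Q' = (if z \<in> Q then insert v (Q - {z}) else Q)"
      and "P' = (if z \<in> Q then P else insert v (P - {z}))"
    have QP': "Q' \<union> P' = insert v T" using zS QP by (auto simp: Q'_def P'_def T_def)
    have st': "weighted_clique Q' P'"
    proof (cases "z \<in> Q")
      case True
      then have v1: "w v y = 1" if "y \<in> Q \<union> P - {z}" for y using l that QP by (auto simp: swappable_def)
      have sub: "Q - {z} \<union> P \<subseteq> Q \<union> P - {z}" using True QP by blast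
      have "weighted_clique (Q - {z}) P" by (rule weighted_clique_subset[OF st]) (use QP in auto)
      then have "weighted_clique (insert v (Q - {z})) P"
        by (rule weighted_clique_insert(2)[OF _ v]) (use vS vpos v1 sub in blast)+
      then show ?thesis using True by (simp add: Q'_def P'_def)
    next
      case zQ: False
      have "weighted_clique Q (P - {z})" by (rule weighted_clique_subset[OF st]) (use QP in auto)
      then have "weighted_clique Q (insert v (P - {z}))"
        by (rule weighted_clique_insert(1)[OF _ v]) (use vS vpos zQ in auto)
      then show ?thesis using zQ by (simp add: Q'_def P'_def)
    qed
    have "Suc (card (Q - {z})) = card Q" if "z \<in> Q" using weighted_clique_card_add(4)[OF st that] .
    moreover have "Suc (card (P - {z})) = card P" if "z \<in> P" using weighted_clique_card_add(3)[OF st that] .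
    ultimately have cards: "card Q' = card Q" "card P' = card P"
      using vS fQ zS by (auto simp: Q'_def P'_def)
    have zV: "z \<in> V" using zS QP by auto
    have e: "wsum (Q' \<union> P') = wsum T + 2 * (\<Sum>y\<in>T. w v y)" "wsum (Q \<union> P) = wsum T + 2 * (\<Sum>y\<in>T. w z y)"
      using wsum_insert[of T v] wsum_insert[of T z] T QP' v zV by auto
    have le: "(\<Sum>y\<in>T. w v y) \<le> (\<Sum>y\<in>T. w z y)"
      using improve3(1)[OF mx st' cards] e by linarith
    have lzz: "swappable Q P z z \<and> (\<Sum>y\<in>T. w v y) = (\<Sum>y\<in>T. w z y)"
    proof (cases "z \<in> Q")
      case True
      then have v1: "w v y = 1" if "y \<in> T" for y using l that QP by (auto simp: swappable_def T_def)
      have s: "(\<Sum>y\<in>T. 1 - w z y) \<le> 0" using le v1 by (simp add: sum_subtractf)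
      have z1: "w z y = 1" if "y \<in> T" for y
      proof -
        have "1 - w z y \<le> (\<Sum>y\<in>T. 1 - w z y)" by (rule member_le_sum[OF that]) (use T in auto)
        then show ?thesis using s w_vals[of z y] by linarith
      qed
      then show ?thesis using True w_refl[OF zV] v1 by (auto simp: swappable_def T_def)
    next
      case zQ: False
      then have zP: "z \<in> P" using zS by auto
      obtain u where u: "u \<in> Q" "w v u = 1 / 2" "\<forall>y\<in>Q \<union> P - {z, u}. w v y = 1"
        using l zQ by (auto simp: swappable_def)
      have uT: "u \<in> T" using u zQ by (auto simp: T_def)
      have sv: "(\<Sum>y\<in>T. 1 - w v y) = 1 / 2"
        using sum.remove[OF T(1) uT, of "\<lambda>y. 1 - w v y"] u sum.neutral[of "T - {u}" "\<lambda>y. 1 - w v y"]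
        by (auto simp: T_def)
      have s: "(\<Sum>y\<in>T. 1 - w z y) \<le> 1 / 2" using le sv by (simp add: sum_subtractf)
      \<comment> \<open>Otherwise \<open>z\<close> could move from \<open>P\<close> to
        \<open>Q\<close>, which would increase the clique size.\<close>
      have "\<exists>u'\<in>Q. w z u' \<noteq> 1"
      proof (rule ccontr)
        assume "\<not> ?thesis"
        moreover have "weighted_clique Q (P - {z})" by (rule weighted_clique_subset[OF st]) (use QP in auto)
        ultimately have "weighted_clique (insert z Q) (P - {z})"
          by (intro weighted_clique_insert(2)[OF _ zV]) (use st zP zQ in \<open>auto simp: weighted_clique_def\<close>)
        then show False using improve1[OF mx, of "insert z Q" "P - {z}"] weighted_clique_card_add(1)[OF st zQ]
          weighted_clique_card_add(3)[OF st zP] by simp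
      qed
      then obtain u' where u': "u' \<in> Q" "w z u' \<noteq> 1" by blast
      have "u' \<in> T" using u' zQ by (auto simp: T_def)
      have "z \<noteq> u'" using u' zQ by auto
      then have "w z u' > 0" using st u' zP unfolding weighted_clique_def by blast
      then have u'h: "w z u' = 1 / 2" using u' w_vals[of z u'] by auto
      have z1: "w z y = 1" if "y \<in> T - {u'}" for y
      proof -
        have "(1 - w z u') + (1 - w z y) \<le> (\<Sum>y\<in>T. 1 - w z y)"
          by (rule two_le_sum[OF T(1) \<open>u' \<in> T\<close>]) (use that in auto)
        then show ?thesis using s u'h w_vals[of z y] by linarith
      qed
      have sz: "(\<Sum>y\<in>T. 1 - w z y) = 1 / 2"
        using sum.remove[OF T(1) \<open>u' \<in> T\<close>, of "\<lambda>y. 1 - w z y"] u'h z1 sum.neutral[of "T - {u'}" "\<lambda>y. 1 - w z y"]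
        by auto
      have "swappable Q P z z" unfolding swappable_def using zP w_refl[OF zV] u'(1) u'h z1 by (auto simp: T_def)
      moreover have "(\<Sum>y\<in>T. w v y) = (\<Sum>y\<in>T. w z y)" using sv sz by (simp add: sum_subtractf)
      ultimately show ?thesis by blast
    qed
    have mx': "is_max Q' P'" using improve3(2)[OF mx st' cards] e lzz by auto
    have mu: "mult Q' y = mult Q y" if "y \<in> T" for y using that vS by (auto simp: mult_def Q'_def T_def)
    have mv: "mult Q' v = mult Q z" using vS by (auto simp: mult_def Q'_def)
    have "deficiency Q' P' x = deficiency Q P x - mult Q z * (1 - w x z) + mult Q z * (1 - w x v)" for x
    proof -
      have "deficiency Q' P' x = mult Q' v * (1 - w x v) + (\<Sum>u\<in>T. mult Q' u * (1 - w x u))"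
        unfolding deficiency_def QP' using T by simp
      also have "(\<Sum>u\<in>T. mult Q' u * (1 - w x u)) = (\<Sum>u\<in>T. mult Q u * (1 - w x u))"
        by (intro sum.cong) (auto simp: mu)
      finally have 1: "deficiency Q' P' x = mult Q z * (1 - w x v) + (\<Sum>u\<in>T. mult Q u * (1 - w x u))"
        by (simp add: mv)
      have "deficiency Q P x = mult Q z * (1 - w x z) + (\<Sum>u\<in>T. mult Q u * (1 - w x u))"
        using sum.insert[OF T(1,3), of "\<lambda>u. mult Q u * (1 - w x u)"] unfolding deficiency_def T(4) .
      with 1 show ?thesis by simp
    qed
    then show ?thesis using mx' lzz by blast
  qed
  then show "swappable Q P z z" "\<exists>Q' P'. is_max Q' P' \<and> (\<forall>x. deficiency Q' P' x = deficiency Q P x - mult Q z * (1 - w x z) + mult Q z * (1 - w x v))"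
    by blast+
qed

text \<open>When \<open>v\<close> takes the place of \<open>z\<close>, the deficiency of
  \<open>v'\<close> drops by \<open>w v' v\<close> or twice that. It must stay at least 2 and was
  below \<open>5 / 2\<close>, which leaves no room for a positive weight.\<close>

lemma swappable_independent:
  assumes mx: "is_max Q P" and v: "v \<in> V" "v' \<in> V" and l: "swappable Q P v z" "swappable Q P v' z"
    and lt: "deficiency Q P v' < 5 / 2"
  shows "w v' v = 0"
proof -
  obtain Q' P' where *: "is_max Q' P'"
    "deficiency Q' P' v' = deficiency Q P v' - mult Q z * (1 - w v' z) + mult Q z * (1 - w v' v)"
    using swappable_swap(2)[OF mx v(1) l(1)] by blast
  have "deficiency Q' P' v' \<ge> 2" using deficiency_main[OF *(1) v(2)] by blast
  moreover have "w v' z = 0" using l(2) by (simp add: swappable_def)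
  ultimately have "mult Q z * w v' v < 1 / 2" using *(2) lt by (simp add: algebra_simps)
  then show ?thesis using w_vals[of v' v] by (auto simp: mult_def split: if_splits)
qed

text \<open>An injection into \<open>Q\<close> maps a member of \<open>Q\<close> to itself and a
  member of \<open>P\<close> to its partner in \<open>Q\<close>, the vertex at weight
  \<open>1 / 2\<close>. If two members of \<open>P\<close> shared the partner \<open>u\<close>, both
  could move to \<open>Q\<close> and \<open>u\<close> to \<open>P\<close>, and the clique size would
  grow by one.\<close>

lemma card_swappable:
  assumes mx: "is_max Q P"
  shows "card {z. swappable Q P z z} \<le> card Q"
proof -
  have st: "weighted_clique Q P" using mx by (simp add: is_max_def)
  have fQ: "finite Q" "finite P" using weighted_clique_fin[OF st] by auto
  have QP: "Q \<inter> P = {}" using st by (auto simp: weighted_clique_def)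
  define R where "R z u \<longleftrightarrow> u \<in> Q \<and> w z u = 1 / 2 \<and> (\<forall>y\<in>Q \<union> P - {z, u}. w z y = 1)" for z u
  define g where "g z = (if z \<in> Q then z else (SOME u. R z u))" for z
  have g: "z \<in> P \<and> g z \<in> Q \<and> w z (g z) = 1 / 2 \<and> (\<forall>y\<in>Q \<union> P - {z, g z}. w z y = 1)"
    if "swappable Q P z z" "z \<notin> Q" for z
  proof -
    have *: "z \<in> P" "\<exists>u. R z u"
      using that unfolding swappable_def R_def by blast+
    have "g z = (SOME u. R z u)" using that(2) by (simp add: g_def)
    then have "R z (g z)" using someI_ex[OF *(2)] by simp
    then show ?thesis using *(1) unfolding R_def by blast
  qed
  have gQ: "g z = z" if "z \<in> Q" for z using that by (simp add: g_def)
  have fullQ: "w z y = 1" if "swappable Q P z z" "z \<in> Q" "y \<in> Q \<union> P" "y \<noteq> z" for z y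
    using that QP by (auto simp: swappable_def)
  have "inj_on g {z. swappable Q P z z}"
  proof (rule inj_onI, rule ccontr)
    fix z z' assume z: "z \<in> {z. swappable Q P z z}" "z' \<in> {z. swappable Q P z z}" and e: "g z = g z'" and ne: "z \<noteq> z'"
    consider "z \<in> Q" "z' \<in> Q" | "z \<in> Q" "z' \<notin> Q" | "z \<notin> Q" "z' \<in> Q" | "z \<notin> Q" "z' \<notin> Q" by blast
    then show False
    proof cases
      case 1 then show False using e ne gQ by auto
    next
      case 2
      then show False using g[of z'] gQ[of z] fullQ[of z z'] z e ne w_sym[of z z'] by auto
    next
      case 3
      then show False using g[of z] gQ[of z'] fullQ[of z' z] z e ne w_sym[of z z'] by auto
    next
      case 4
      define u where "u = g z"
      have u: "u \<in> Q" "z \<in> P" "z' \<in> P" "\<forall>y\<in>Q \<union> P - {z, u}. w z y = 1" "\<forall>y\<in>Q \<union> P - {z', u}. w z' y = 1"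
        "w z u = 1 / 2" "w z' u = 1 / 2"
        using g[of z] g[of z'] z e 4 by (auto simp: u_def)
      have uP: "u \<notin> P" using u QP by auto
      let ?Q = "insert z (insert z' (Q - {u}))" and ?P = "insert u (P - {z, z'})"
      have zz: "w z z' = 1" using u uP ne by auto
      have "weighted_clique ?Q ?P" unfolding weighted_clique_def
      proof (intro conjI ballI impI)
        show "?Q \<subseteq> V" "?P \<subseteq> V" using st u by (auto simp: weighted_clique_def)
        show "?Q \<inter> ?P = {}" using QP u uP 4 by auto
        show "w x y = 1" if "x \<in> ?Q" "y \<in> ?Q" "x \<noteq> y" for x y
        proof -
          have a: "w z y = 1" if "y \<in> Q - {u}" for y using u that 4 by auto
          have b: "w z' y = 1" if "y \<in> Q - {u}" for y using u that 4 by auto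
          have c: "w x y = 1" if "x \<in> Q" "y \<in> Q" "x \<noteq> y" for x y using st that by (auto simp: weighted_clique_def)
          have zz': "w z' z = 1" using zz w_sym[of z z'] by simp
          have a': "w y z = 1" if "y \<in> Q - {u}" for y using a[OF that] w_sym[of y z] by simp
          have b': "w y z' = 1" if "y \<in> Q - {u}" for y using b[OF that] w_sym[of y z'] by simp
          show ?thesis using that a b a' b' c zz zz' by blast
        qed
        show "w x y > 0" if "x \<in> ?Q \<union> ?P" "y \<in> ?Q \<union> ?P" "x \<noteq> y" for x y
          using that st u by (auto simp: weighted_clique_def)
      qed
      moreover have "card ?Q = Suc (card Q)"
        using 4 ne fQ u weighted_clique_card_add(4)[OF st u(1)] by (simp add: card_insert_if)
      moreover have "Suc (card ?P) = card P"
        using u uP fQ ne card_Diff_subset[of "{z,z'}" P] card_mono[of P "{z,z'}"] by (simp add: card_insert_if)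
      ultimately show False using improve1[OF mx, of ?Q ?P] by simp
    qed
  qed
  moreover have "g ` {z. swappable Q P z z} \<subseteq> Q" using g gQ by (metis (mono_tags, lifting) image_subsetI mem_Collect_eq)
  ultimately show ?thesis using card_inj_on_le fQ(1) by blast
qed

end

section \<open>Stability for weighted graphs\<close>

text \<open>The bound on \<open>\<eta>\<close> is the margin of the averaging in
  \<open>full_clique\<close>, where \<open>5 * (3 * r - 2)\<close> exceeds
  \<open>3 * (5 * r - 4)\<close> by 2.\<close>

locale wgraph_deg = wgraph +
  fixes \<eta> :: real
  assumes V_ne: "V \<noteq> {}" and eta: "0 \<le> \<eta>" "5 * real r * \<eta> * (3 * real r - 2) < 2"
    and mindeg: "x \<in> V \<Longrightarrow> (1 - 3 / (3 * real r - 2) - \<eta>) * real (card V) \<le> (\<Sum>y\<in>V. w x y)"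
begin

definition gap :: real where "gap = 3 / (3 * real r - 2) + \<eta>"

lemma L_pos: "3 * real r - 2 > 0"
  using r2 by simp

lemma k_pos: "real (card V) > 0"
  using V_ne fV by (simp add: card_gt_0_iff)

lemma gap_L: "gap * (3 * real r - 2) = 3 + \<eta> * (3 * real r - 2)"
  using L_pos by (simp add: gap_def field_simps)

lemma eta_L: "0 \<le> \<eta> * (3 * real r - 2)" "5 * real r * (\<eta> * (3 * real r - 2)) < 2"
  using eta L_pos by (simp_all add: mult_ac)

lemma gap_pos: "gap > 0"
  using L_pos eta by (simp add: gap_def add_pos_nonneg)

lemma missing: "u \<in> V \<Longrightarrow> (\<Sum>v\<in>V. 1 - w v u) \<le> gap * real (card V)"
proof -
  assume u: "u \<in> V"
  have "(\<Sum>v\<in>V. 1 - w v u) = real (card V) - (\<Sum>v\<in>V. w v u)" by (simp add: sum_subtractf)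
  also have "(\<Sum>v\<in>V. w v u) = (\<Sum>v\<in>V. w u v)" by (intro sum.cong refl w_sym)
  finally show ?thesis using mindeg[OF u] by (simp add: gap_def algebra_simps)
qed

lemma avg_missing:
  assumes "finite S" "S \<subseteq> V" "\<And>u. u \<in> S \<Longrightarrow> 0 \<le> c u"
  shows "(\<Sum>v\<in>V. \<Sum>u\<in>S. c u * (1 - w v u)) \<le> (\<Sum>u\<in>S. c u) * gap * real (card V)"
proof -
  have "(\<Sum>v\<in>V. \<Sum>u\<in>S. c u * (1 - w v u)) = (\<Sum>u\<in>S. c u * (\<Sum>v\<in>V. 1 - w v u))"
    by (subst sum.swap) (simp add: sum_distrib_left)
  also have "\<dots> \<le> (\<Sum>u\<in>S. c u * (gap * real (card V)))"
    using assms missing by (intro sum_mono mult_left_mono) auto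
  finally show ?thesis by (simp add: sum_distrib_right mult.assoc)
qed

lemma low_exists:
  assumes "(\<Sum>v\<in>V. f v) < c * real (card V)"
  obtains v where "v \<in> V" "f v < (c::real)"
proof -
  have "\<exists>v\<in>V. f v < c"
  proof (rule ccontr)
    assume "\<not> ?thesis"
    then have "(\<Sum>v\<in>V. c) \<le> (\<Sum>v\<in>V. f v)" by (intro sum_mono) auto
    then show False using assms by (simp add: mult.commute)
  qed
  then show ?thesis using that by blast
qed

text \<open>The average deficiency is at most \<open>(2 * r - 1) * gap\<close>, so many vertices lie
  below \<open>5 / 2\<close>. They fall into classes of pairwise weight 0, one for each
  \<open>z\<close> in \<open>Z\<close>, and such a class has at most \<open>gap * card V\<close>
  members. Hence there are at least \<open>r - 1\<close> classes, and \<open>card_swappable\<close>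
  turns them into members of \<open>Q\<close>.\<close>

lemma full_clique:
  obtains Q where "weighted_clique Q {}" "card Q = r - 1"
proof -
  obtain Q P where mx: "is_max Q P" by (rule max_exists)
  have st: "weighted_clique Q P" using mx by (simp add: is_max_def)
  have fQ: "finite Q" "finite P" "finite (Q \<union> P)" using weighted_clique_fin[OF st] by auto
  have QP: "Q \<inter> P = {}" "Q \<union> P \<subseteq> V" using st by (auto simp: weighted_clique_def)
  let ?k = "real (card V)"
  define F where "F = {v \<in> V. deficiency Q P v < 5 / 2}"
  define Z where "Z = {z. swappable Q P z z}"
  have ZS: "Z \<subseteq> Q \<union> P" by (auto simp: Z_def swappable_def)
  have fZ: "finite Z" using ZS fQ finite_subset by blast
  have FV: "F \<subseteq> V" "finite F" using fV by (auto simp: F_def)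
  have m: "(\<Sum>u\<in>Q \<union> P. mult Q u) = 2 * real (card Q) + real (card P)"
  proof -
    have "(\<Sum>u\<in>P. mult Q u) = (\<Sum>u\<in>P. 1)" using QP by (intro sum.cong) (auto simp: mult_def)
    then show ?thesis using sum.union_disjoint[OF fQ(1,2) QP(1), of "mult Q"] by (simp add: mult_def)
  qed
  have up: "(\<Sum>v\<in>V. deficiency Q P v) \<le> (2 * real r - 1) * gap * ?k"
  proof -
    have "(\<Sum>v\<in>V. deficiency Q P v) \<le> (\<Sum>u\<in>Q \<union> P. mult Q u) * gap * ?k"
      unfolding deficiency_def by (rule avg_missing[OF fQ(3) QP(2)]) (simp add: mult_def)
    also have "\<dots> \<le> (2 * real r - 1) * gap * ?k"
      using weighted_clique_bound[OF st] gap_pos by (intro mult_right_mono) (auto simp: m)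
    finally show ?thesis .
  qed
  have lo: "(\<Sum>v\<in>V. deficiency Q P v) \<ge> 5 / 2 * ?k - 1 / 2 * real (card F)"
  proof -
    have "(\<Sum>v\<in>V. deficiency Q P v) \<ge> (\<Sum>v\<in>V. 5 / 2 - 1 / 2 * of_bool (v \<in> F))"
      using deficiency_main[OF mx] by (intro sum_mono) (auto simp: F_def of_bool_def)
    also have "(\<Sum>v\<in>V. 5 / 2 - 1 / 2 * of_bool (v \<in> F)) = 5 / 2 * ?k - 1 / 2 * (\<Sum>v\<in>V. of_bool (v \<in> F))"
      by (simp add: sum_subtractf sum_distrib_left del: sum_of_bool_eq)
    also have "(\<Sum>v\<in>V. of_bool (v \<in> F)) = real (card F)"
      using FV fV by (simp add: Int_absorb1)
    finally show ?thesis .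
  qed
  have Fz: "real (card {v \<in> F. swappable Q P v z}) \<le> gap * ?k" for z
  proof (cases "{v \<in> F. swappable Q P v z} = {}")
    case True
    then show ?thesis using gap_pos by (simp del: Collect_empty_eq)
  next
    case False
    then obtain v0 where v0: "v0 \<in> F" "swappable Q P v0 z" by blast
    have "(\<Sum>v\<in>{v \<in> F. swappable Q P v z}. 1 - w v v0) \<le> (\<Sum>v\<in>V. 1 - w v v0)"
      by (rule sum_mono2) (use FV fV in auto)
    moreover have "w v v0 = 0" if "v \<in> {v \<in> F. swappable Q P v z}" for v
      by (rule swappable_independent[OF mx, of v0 v z]) (use that v0 FV in \<open>auto simp: F_def\<close>)
    ultimately have "real (card {v \<in> F. swappable Q P v z}) \<le> (\<Sum>v\<in>V. 1 - w v v0)" by simp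
    also have "\<dots> \<le> gap * ?k" using missing v0 FV by blast
    finally show ?thesis .
  qed
  have "F \<subseteq> (\<Union>z\<in>Z. {v \<in> F. swappable Q P v z})"
  proof
    fix v assume v: "v \<in> F"
    then obtain z where z: "swappable Q P v z" using deficiency_main[OF mx, of v] by (auto simp: F_def)
    then have "z \<in> Z" using swappable_swap(1)[OF mx _ z] v FV by (auto simp: Z_def)
    then show "v \<in> (\<Union>z\<in>Z. {v \<in> F. swappable Q P v z})" using v z by blast
  qed
  then have "card F \<le> card (\<Union>z\<in>Z. {v \<in> F. swappable Q P v z})"
    by (rule card_mono[rotated]) (use fZ FV in auto)
  also have "\<dots> \<le> (\<Sum>z\<in>Z. card {v \<in> F. swappable Q P v z})" by (rule card_UN_le[OF fZ])
  finally have "real (card F) \<le> (\<Sum>z\<in>Z. real (card {v \<in> F. swappable Q P v z}))"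
    by (metis of_nat_mono of_nat_sum)
  also have "\<dots> \<le> (\<Sum>z\<in>Z. gap * ?k)" by (intro sum_mono Fz)
  finally have cF: "real (card F) \<le> real (card Z) * gap * ?k" by simp
  have "card Z \<ge> r - 1"
  proof (rule ccontr)
    assume "\<not> ?thesis"
    then have "real (card Z) \<le> real r - 2" using r2 by linarith
    then have "real (card Z) * (gap * ?k) \<le> (real r - 2) * (gap * ?k)"
      using gap_pos by (intro mult_right_mono) auto
    then have "5 * ?k \<le> 2 * ((2 * real r - 1) * (gap * ?k)) + (real r - 2) * (gap * ?k)"
      using cF lo up by (simp add: mult.assoc)
    also have "\<dots> = ((5 * real r - 4) * gap) * ?k" by (simp add: algebra_simps)
    finally have "5 \<le> (5 * real r - 4) * gap" using k_pos by simp
    then have "5 * (3 * real r - 2) \<le> (5 * real r - 4) * gap * (3 * real r - 2)"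
      using L_pos by (intro mult_right_mono) auto
    also have "\<dots> = (5 * real r - 4) * (3 + \<eta> * (3 * real r - 2))" by (simp add: gap_L mult.assoc)
    also have "\<dots> \<le> 15 * real r - 12 + 5 * real r * (\<eta> * (3 * real r - 2))"
      using eta_L(1) by (simp add: distrib_left left_diff_distrib)
    finally have le: "5 * (3 * real r - 2) \<le> 15 * real r - 12 + 5 * real r * (\<eta> * (3 * real r - 2))" .
    define T where "T = 5 * real r * (\<eta> * (3 * real r - 2))"
    show False using le eta_L(2) unfolding T_def[symmetric] by (simp add: algebra_simps)
  qed
  then have "r - 1 \<le> card Q" using card_swappable[OF mx] by (simp add: Z_def)
  then have "card Q = r - 1" using weighted_clique_bound[OF st] by linarith
  moreover have "weighted_clique Q {}" by (rule weighted_clique_subset[OF st]) auto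
  ultimately show ?thesis using that by blast
qed

section \<open>Frames: copies of the extremal pattern\<close>

definition frame :: "(nat \<Rightarrow> 'a) \<Rightarrow> bool" where
  "frame u \<longleftrightarrow> (\<forall>i<r. u i \<in> V) \<and> (\<forall>i<r. \<forall>j<r. w (u i) (u j) = pattern i j)"

text \<open>Towards \<open>r - 1\<close> vertices of pairwise weight 1 the average missing weight is
  below 1, so some \<open>v\<close> misses less than 1. It cannot have weight 1 to all of them,
  hence it has weight \<open>1 / 2\<close> to exactly one, and these two receive the indices 0 and
  1.\<close>

lemma frame_exists: obtains u where "frame u"
proof -
  obtain Q where wQ: "weighted_clique Q {}" and cQ: "card Q = r - 1" by (rule full_clique)
  then have Q: "Q \<subseteq> V" "\<And>x y. x \<in> Q \<Longrightarrow> y \<in> Q \<Longrightarrow> x \<noteq> y \<Longrightarrow> w x y = 1" "card Q = r - 1"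
    by (auto simp: weighted_clique_def)
  have fQ: "finite Q" using Q fV finite_subset by blast
  let ?k = "real (card V)"
  have "(\<Sum>v\<in>V. \<Sum>u\<in>Q. 1 * (1 - w v u)) \<le> (\<Sum>u\<in>Q. 1) * gap * ?k"
    by (rule avg_missing[OF fQ Q(1)]) simp
  also have "\<dots> = ((real r - 1) * gap) * ?k" using Q(3) r2 by (simp add: of_nat_diff)
  also have "\<dots> < 1 * ?k"
  proof -
    have "(real r - 1) * gap * (3 * real r - 2) = (real r - 1) * (3 + \<eta> * (3 * real r - 2))"
      by (simp add: gap_L mult.assoc)
    also have "\<dots> \<le> 3 * real r - 3 + real r * (\<eta> * (3 * real r - 2))"
      using eta_L(1) by (simp add: distrib_left left_diff_distrib)
    also have "\<dots> < 3 * real r - 2" using eta_L by linarith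
    finally have "(real r - 1) * gap < 1" using L_pos by simp
    then show ?thesis using k_pos by (intro mult_strict_right_mono) auto
  qed
  finally obtain v where v: "v \<in> V" "(\<Sum>u\<in>Q. 1 - w v u) < 1"
    using low_exists[of "\<lambda>v. \<Sum>u\<in>Q. 1 - w v u" 1] by auto
  have pos: "w v u > 0" if "u \<in> Q" for u
  proof -
    have "1 - w v u \<le> (\<Sum>u\<in>Q. 1 - w v u)" by (rule member_le_sum[OF that]) (use fQ in auto)
    then show ?thesis using v(2) by linarith
  qed
  have vQ: "v \<notin> Q" using pos[of v] w_refl[OF v(1)] by auto
  have "\<exists>u\<in>Q. w v u \<noteq> 1"
  proof (rule ccontr)
    assume "\<not> ?thesis"
    then have "weighted_clique (insert v Q) {}" by (intro weighted_clique_insert(2)[OF wQ v(1)]) (use vQ pos in auto)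
    from weighted_clique_bound[OF this] show False using vQ fQ Q(3) r2 by simp
  qed
  then obtain u1 where u1: "u1 \<in> Q" "w v u1 \<noteq> 1" by blast
  have u1h: "w v u1 = 1 / 2" using pos[OF u1(1)] u1(2) w_vals[of v u1] by auto
  have rest: "w v u = 1" if "u \<in> Q" "u \<noteq> u1" for u
  proof -
    have "(1 - w v u1) + (1 - w v u) \<le> (\<Sum>u\<in>Q. 1 - w v u)"
      by (rule two_le_sum[OF fQ u1(1)]) (use that in auto)
    then show ?thesis using v(2) u1h w_vals[of v u] by linarith
  qed
  have "card (Q - {u1}) = r - 2" using fQ u1 Q(3) by simp
  then obtain h where h: "bij_betw h {0..<r - 2} (Q - {u1})"
    using ex_bij_betw_nat_finite[of "Q - {u1}"] fQ by auto
  define u where "u i = (if i = 0 then v else if i = 1 then u1 else h (i - 2))" for i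
  have hQ: "h (i - 2) \<in> Q" "h (i - 2) \<noteq> u1" if "2 \<le> i" "i < r" for i
    using bij_betw_apply[OF h, of "i - 2"] that by auto
  have hinj: "h (i - 2) \<noteq> h (j - 2)" if "2 \<le> i" "i < r" "2 \<le> j" "j < r" "i \<noteq> j" for i j
  proof
    assume "h (i - 2) = h (j - 2)"
    then have "i - 2 = j - 2" by (rule inj_onD[OF bij_betw_imp_inj_on[OF h]]) (use that in auto)
    then show False using that by linarith
  qed
  have "frame u"
    unfolding frame_def
  proof (intro conjI allI impI)
    show "u i \<in> V" if "i < r" for i using v u1 Q hQ[of i] that by (auto simp: u_def)
    have lt: "w (u i) (u j) = pattern i j" if "i < j" "j < r" for i j
    proof -
      consider "i = 0" "j = 1" | "i = 0" "2 \<le> j" | "i = 1" "2 \<le> j" | "2 \<le> i" "2 \<le> j" using \<open>i < j\<close> by linarith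
      then show ?thesis
      proof cases
        case 1 then show ?thesis using u1h by (simp add: u_def pattern_def)
      next
        case 2 then show ?thesis using rest hQ[of j] that by (simp add: u_def pattern_def)
      next
        case 3 then show ?thesis using Q(2)[of u1 "h (j - 2)"] u1 hQ[of j] that by (simp add: u_def pattern_def)
      next
        case 4 then show ?thesis using Q(2)[of "h (i - 2)" "h (j - 2)"] hinj[of i j] hQ[of i] hQ[of j] that
          by (simp add: u_def pattern_def)
      qed
    qed
    show "w (u i) (u j) = pattern i j" if "i < r" "j < r" for i j
    proof (cases i j rule: linorder_cases)
      case less then show ?thesis using lt that by blast
    next
      case equal then show ?thesis using w_refl \<open>\<And>i. i < r \<Longrightarrow> u i \<in> V\<close> that by (simp add: pattern_def)
    next
      case greater then show ?thesis using lt[of j i] that w_sym[of "u i" "u j"] pattern_sym[of i j] by simp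
    qed
  qed
  then show ?thesis by (rule that)
qed

text \<open>With the weights \<open>part_weight\<close> every vertex that behaves like a member of
  the frame has the value 3, which up to \<open>\<eta>\<close> is also the average that the minimum
  degree permits.\<close>

definition frame_deficiency :: "(nat \<Rightarrow> 'a) \<Rightarrow> 'a \<Rightarrow> real" where
  "frame_deficiency u v = (\<Sum>i<r. part_weight i * (1 - w v (u i)))"

text \<open>The vertices that can take the place of \<open>u i\<close>; see
  \<open>frame_upd\<close>.\<close>

definition frame_class :: "(nat \<Rightarrow> 'a) \<Rightarrow> nat \<Rightarrow> 'a set" where
  "frame_class u i = {v \<in> V. \<forall>j<r. w v (u j) = pattern i j}"

lemma frame_weighted_clique:
  assumes "frame u" "A \<subseteq> {..<r}" "B \<subseteq> {..<r}" "A \<inter> B = {}" "\<not> (0 \<in> A \<and> 1 \<in> A)"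
  shows "weighted_clique (u ` A) (u ` B)" "card (u ` A) = card A" "card (u ` B) = card B"
proof -
  have p: "w (u i) (u j) > 0" if "i < r" "j < r" "i \<noteq> j" for i j
    using assms(1) that by (auto simp: frame_def pattern_def)
  have inj: "inj_on u {..<r}"
    by (rule inj_onI) (metis assms(1) frame_def less_irrefl lessThan_iff p w_refl)
  have A1: "w (u i) (u j) = 1" if "i \<in> A" "j \<in> A" "i \<noteq> j" for i j
  proof -
    have "\<not> (i < 2 \<and> j < 2)" using that assms(5) by (metis less_2_cases One_nat_def)
    then have "pattern i j = 1" using that(3) by (simp add: pattern_def)
    moreover have "i < r" "j < r" using that assms(2) by auto
    ultimately show ?thesis using assms(1) by (simp add: frame_def)
  qed
  show "weighted_clique (u ` A) (u ` B)"
    unfolding weighted_clique_def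
  proof (intro conjI ballI impI)
    show "u ` A \<subseteq> V" "u ` B \<subseteq> V" using assms by (auto simp: frame_def)
    show "u ` A \<inter> u ` B = {}" using inj_on_image_Int[OF inj assms(2,3)] assms(4) by simp
    show "w x y = 1" if "x \<in> u ` A" "y \<in> u ` A" "x \<noteq> y" for x y
      using that A1 by blast
    show "w x y > 0" if xy: "x \<in> u ` A \<union> u ` B" "y \<in> u ` A \<union> u ` B" "x \<noteq> y" for x y
    proof -
      obtain i j where "x = u i" "y = u j" "i \<in> A \<union> B" "j \<in> A \<union> B" using xy by blast
      moreover from this have "i \<noteq> j" "i < r" "j < r" using xy assms(2,3) by auto
      ultimately show ?thesis using p by blast
    qed
  qed
  show "card (u ` A) = card A" "card (u ` B) = card B"
    using card_image inj_on_subset[OF inj] assms by blast+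
qed

lemma frame_bound:
  assumes fr: "frame u" and AB: "A \<subseteq> {..<r}" "B \<subseteq> {..<r}" "A \<inter> B = {}" "\<not> (0 \<in> A \<and> 1 \<in> A)"
    and v: "v \<in> V" "\<And>i. i \<in> A \<Longrightarrow> w v (u i) = 1" "\<And>i. i \<in> B \<Longrightarrow> w v (u i) > 0"
  shows "2 * card A + 2 + card B < 2 * r" "2 * card A + 1 + card B < 2 * r"
proof -
  note * = frame_weighted_clique[OF fr AB]
  have pos: "w v y > 0" if "y \<in> u ` A \<union> u ` B" for y using that v by auto
  have vn: "v \<notin> u ` A \<union> u ` B" using pos[of v] w_refl[OF v(1)] by auto
  have "weighted_clique (insert v (u ` A)) (u ` B)" by (rule weighted_clique_insert(2)[OF *(1) v(1) vn pos]) (use v in auto)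
  from weighted_clique_bound[OF this] weighted_clique_fin[OF this] show "2 * card A + 2 + card B < 2 * r" using vn *(2,3) by simp
  then show "2 * card A + 1 + card B < 2 * r" by simp
qed

text \<open>Weights that would give a smaller value put \<open>v\<close> together with members of
  the frame into a weighted clique of size \<open>2 * r\<close>. The step from 3 to
  \<open>7 / 2\<close> is what later limits the number of vertices outside the classes.\<close>

lemma frame_deficiency_class:
  assumes fr: "frame u" and v: "v \<in> V"
  shows "frame_deficiency u v \<ge> 3 \<and> (frame_deficiency u v < 7 / 2 \<longrightarrow> (\<exists>i<r. v \<in> frame_class u i))"
proof -
  let ?f = "\<lambda>i. part_weight i * (1 - w v (u i))"
  let ?R = "{2..<r}"
  have nn: "0 \<le> ?f i" for i by (simp add: part_weight_def)
  have f1: "?f i \<ge> 1" if "w v (u i) \<noteq> 1" for i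
    using that w_vals[of v "u i"] by (auto simp: part_weight_def)
  have fR: "?f i \<ge> 3 / 2" if "w v (u i) \<noteq> 1" "i \<in> ?R" for i
    using that w_vals[of v "u i"] by (auto simp: part_weight_def)
  note one = member_le_sum[of _ "{..<r}" ?f, OF _ nn finite_lessThan, folded frame_deficiency_def]
  note two = two_le_sum[of "{..<r}" _ _ ?f, OF finite_lessThan _ _ _ nn, folded frame_deficiency_def]
  note three = three_le_sum[of "{..<r}" _ _ _ ?f, OF finite_lessThan _ _ _ _ _ _ nn, folded frame_deficiency_def]
  have r01: "0 < r" "1 < r" using r2 by auto
  have cR: "card ?R = r - 2" by simp
  define x y where "x = w v (u 0)" and "y = w v (u 1)"
  have f01: "?f 0 = 2 * (1 - x)" "?f 1 = 2 * (1 - y)" by (simp_all add: part_weight_def x_def y_def)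
  have s01: "2 * (1 - x) + 2 * (1 - y) \<le> frame_deficiency u v" using two[of 0 1] f01 r01 by simp
  have xy: "x = 0 \<or> x = 1 / 2 \<or> x = 1" "y = 0 \<or> y = 1 / 2 \<or> y = 1"
    using w_vals by (auto simp: x_def y_def)
  show ?thesis
  proof (cases "\<forall>i\<in>?R. w v (u i) = 1")
    case True
    have c0: "\<not> (x > 0 \<and> y > 0)"
    proof
      assume a: "x > 0 \<and> y > 0"
      \<comment> \<open>Here \<open>v\<close> and the indices from 2 on are doubled, and 0 and 1 are
        single: \<open>2 * (r - 1) + 2\<close>.\<close>
      have "2 * card ?R + 2 + card {0::nat, 1} < 2 * r"
        by (rule frame_bound(1)[OF fr _ _ _ _ v]) (use True a r2 in \<open>auto simp: x_def y_def\<close>)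
      then show False using cR r2 by simp
    qed
    have c1: "\<not> y = 1"
    proof
      assume a: "y = 1"
      have "2 * card (insert 1 ?R) + 2 + card ({} :: nat set) < 2 * r"
        by (rule frame_bound(1)[OF fr _ _ _ _ v]) (use True a r2 in \<open>auto simp: x_def y_def\<close>)
      then show False using cR r2 by simp
    qed
    have c2: "\<not> x = 1"
    proof
      assume a: "x = 1"
      have "2 * card (insert 0 ?R) + 2 + card ({} :: nat set) < 2 * r"
        by (rule frame_bound(1)[OF fr _ _ _ _ v]) (use True a r2 in \<open>auto simp: x_def y_def\<close>)
      then show False using cR r2 by simp
    qed
    consider "x = 0" "y = 0" | "x = 0" "y = 1 / 2" | "x = 1 / 2" "y = 0" using xy c0 c1 c2 by force
    then show ?thesis
    proof cases
      case 1 then show ?thesis using s01 by simp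
    next
      case 2
      have "w v (u j) = pattern 0 j" if j: "j < r" for j
      proof -
        consider "j = 0" | "j = 1" | "j \<in> ?R" using j by fastforce
        then show ?thesis using 2 True by cases (auto simp: x_def y_def pattern_def)
      qed
      then have c: "v \<in> frame_class u 0" using v by (auto simp: frame_class_def)
      show ?thesis by (intro conjI impI exI[of _ 0]) (use c s01 2 r01 in auto)
    next
      case 3
      have "w v (u j) = pattern 1 j" if j: "j < r" for j
      proof -
        consider "j = 0" | "j = 1" | "j \<in> ?R" using j by fastforce
        then show ?thesis using 3 True by cases (auto simp: x_def y_def pattern_def)
      qed
      then have c: "v \<in> frame_class u 1" using v by (auto simp: frame_class_def)
      show ?thesis by (intro conjI impI exI[of _ 1]) (use c s01 3 r01 in auto)
    qed
  next
    case False
    then obtain i where i: "i \<in> ?R" "w v (u i) \<noteq> 1" by blast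
    have ir: "i < r" "i \<noteq> 0" "i \<noteq> 1" using i by auto
    show ?thesis
    proof (cases "w v (u i) = 0")
      case True
      have fi: "?f i = 3" using True i by (simp add: part_weight_def)
      have ge: "frame_deficiency u v \<ge> 3" using one[of i] fi ir by simp
      moreover have "v \<in> frame_class u i" if lt: "frame_deficiency u v < 7 / 2"
      proof -
        have "w v (u j) = pattern i j" if j: "j < r" for j
        proof (cases "j = i")
          case True then show ?thesis using \<open>w v (u i) = 0\<close> by (simp add: pattern_def)
        next
          case False
          have "w v (u j) = 1"
          proof (rule ccontr)
            assume "w v (u j) \<noteq> 1"
            then show False using f1[of j] two[of i j] fi ir j False lt by auto
          qed
          then show ?thesis using False i by (simp add: pattern_def)
        qed
        then show ?thesis using v by (auto simp: frame_class_def)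
      qed
      ultimately show ?thesis using ir by blast
    next
      case nz: False
      then have ih: "w v (u i) = 1 / 2" using i w_vals[of v "u i"] by auto
      have fi: "?f i = 3 / 2" using ih i by (simp add: part_weight_def)
      show ?thesis
      proof (cases "\<exists>j\<in>?R. j \<noteq> i \<and> w v (u j) \<noteq> 1")
        case True
        then obtain j where j: "j \<in> ?R" "j \<noteq> i" "w v (u j) \<noteq> 1" by blast
        have ge: "frame_deficiency u v \<ge> 3" using two[of i j] fi fR[OF j(3,1)] ir j by auto
        moreover have False if lt: "frame_deficiency u v < 7 / 2"
        proof -
          have full: "w v (u l) = 1" if l: "l < r" "l \<noteq> i" "l \<noteq> j" for l
          proof (rule ccontr)
            assume "w v (u l) \<noteq> 1"
            then show False using three[of i j l] fi fR[OF j(3,1)] f1[of l] ir j l lt by auto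
          qed
          have jp: "w v (u j) > 0"
          proof (rule ccontr)
            assume "\<not> ?thesis"
            then have "?f j = 3" using j w_bounds(1)[of v "u j"] by (simp add: part_weight_def)
            then show False using two[of i j] fi ir j lt by auto
          qed
          have vp: "w v (u l) > 0" if "l < r" for l using full[OF that] ih jp by (cases "l = i"; cases "l = j") auto
          \<comment> \<open>As \<open>v\<close> has weight \<open>1 / 2\<close> to both
            \<open>i\<close> and \<open>j\<close>, it can only be single: the indices from 1 on are
            doubled, and 0 and \<open>v\<close> are single.\<close>
          let ?A = "{1..<r}" and ?B = "{0::nat}"
          note * = frame_weighted_clique[OF fr, of ?A ?B]
          have st: "weighted_clique (u ` ?A) (u ` ?B)" by (rule *(1)) (use r2 in auto)
          have pos: "w v z > 0" if "z \<in> u ` ?A \<union> u ` ?B" for z using that vp r01 by auto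
          have vn: "v \<notin> u ` ?A \<union> u ` ?B" using pos[of v] w_refl[OF v] by auto
          have "weighted_clique (u ` ?A) (insert v (u ` ?B))" by (rule weighted_clique_insert(1)[OF st v vn pos])
          from weighted_clique_bound[OF this] have "2 * card (u ` ?A) + card (insert v (u ` ?B)) < 2 * r" .
          moreover have "card (u ` ?A) = card ?A" by (rule *(2)) (use r01 in auto)
          moreover have "card (insert v (u ` ?B)) = 2" using vn by auto
          ultimately show False using r2 by simp
        qed
        ultimately show ?thesis by blast
      next
        case False
        then have full: "w v (u l) = 1" if "l \<in> ?R - {i}" for l using that by auto
        have cRi: "Suc (card (?R - {i})) = r - 2" using card_Suc_Diff1[OF _ i(1)] by simp
        have c1: "\<not> (y = 1 \<and> x > 0)"
        proof
          assume a: "y = 1 \<and> x > 0"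
          have "2 * card (insert 1 (?R - {i})) + 2 + card {0, i} < 2 * r"
            by (rule frame_bound(1)[OF fr _ _ _ _ v]) (use full a r2 ir ih in \<open>auto simp: x_def y_def\<close>)
          then show False using cRi ir r2 by (simp add: card_insert_if del: card_Diff_insert)
        qed
        have c2: "\<not> (x = 1 \<and> y > 0)"
        proof
          assume a: "x = 1 \<and> y > 0"
          have "2 * card (insert 0 (?R - {i})) + 2 + card {1, i} < 2 * r"
            by (rule frame_bound(1)[OF fr _ _ _ _ v]) (use full a r2 ir ih in \<open>auto simp: x_def y_def\<close>)
          then show False using cRi ir r2 by (simp add: card_insert_if del: card_Diff_insert)
        qed
        have "x + y \<le> 1" using xy c1 c2 by force
        then have "2 * (1 - x) + 2 * (1 - y) \<ge> 2" by simp
        moreover have "?f 0 + ?f 1 + ?f i \<le> frame_deficiency u v" using three[of 0 1 i] ir r01 by auto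
        ultimately show ?thesis using f01 fi by linarith
      qed
    qed
  qed
qed

lemma sum_pattern: "i < r \<Longrightarrow> (\<Sum>j<r. part_weight j * (1 - pattern i j)) = 3"
proof -
  assume i: "i < r"
  show ?thesis
  proof (cases "i < 2")
    case True
    have "(\<Sum>j<r. part_weight j * (1 - pattern i j)) = (\<Sum>j\<in>{0, 1}. part_weight j * (1 - pattern i j))"
      by (rule sum.mono_neutral_right) (use r2 True in \<open>auto simp: pattern_def\<close>)
    then show ?thesis using True by (auto simp: pattern_def part_weight_def less_2_cases_iff)
  next
    case False
    have "(\<Sum>j<r. part_weight j * (1 - pattern i j)) = (\<Sum>j\<in>{i}. part_weight j * (1 - pattern i j))"
      by (rule sum.mono_neutral_right) (use i False in \<open>auto simp: pattern_def\<close>)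
    then show ?thesis using False by (simp add: pattern_def part_weight_def)
  qed
qed

lemma frame_deficiency_upd:
  assumes "i < r" "l < r" "v' \<in> frame_class u l"
  shows "frame_deficiency (u(i := v)) v' = 3 - part_weight i * (1 - pattern l i) + part_weight i * (1 - w v' v)"
proof -
  have f: "finite {..<r}" "i \<in> {..<r}" using assms by auto
  have "frame_deficiency (u(i := v)) v' = part_weight i * (1 - w v' v) + (\<Sum>j\<in>{..<r} - {i}. part_weight j * (1 - w v' ((u(i := v)) j)))"
    unfolding frame_deficiency_def by (subst sum.remove[OF f]) simp
  also have "(\<Sum>j\<in>{..<r} - {i}. part_weight j * (1 - w v' ((u(i := v)) j))) = (\<Sum>j\<in>{..<r} - {i}. part_weight j * (1 - pattern l j))"
    using assms(3) by (intro sum.cong) (auto simp: frame_class_def)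
  also have "\<dots> = 3 - part_weight i * (1 - pattern l i)"
    using sum_pattern[OF assms(2)] sum.remove[OF f, of "\<lambda>j. part_weight j * (1 - pattern l j)"] by simp
  finally show ?thesis by (simp only: add.commute)
qed

lemma frame_upd:
  assumes "frame u" "i < r" "v \<in> frame_class u i"
  shows "frame (u(i := v))"
proof -
  have v: "v \<in> V" "\<And>j. j < r \<Longrightarrow> w v (u j) = pattern i j" using assms(3) by (auto simp: frame_class_def)
  have "w (u j) v = pattern j i" if "j < r" for j using v(2)[OF that] w_sym[of "u j" v] pattern_sym[of i j] by simp
  then show ?thesis using assms(1) v w_refl[OF v(1)] by (auto simp: frame_def pattern_def)
qed

text \<open>Averaging \<open>frame_deficiency\<close> bounds the exceptional vertices. For the
  weights inside and between classes, one of the two vertices replaces its member of the frame; the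
  other one must still have deficiency at least 3, and this limits the weight between them.\<close>

theorem weighted_stability:
  obtains u where "frame u" "real (card (V - (\<Union>i<r. frame_class u i))) \<le> 2 * (3 * real r - 2) * \<eta> * real (card V)"
    "\<And>i v v'. i < r \<Longrightarrow> v \<in> frame_class u i \<Longrightarrow> v' \<in> frame_class u i \<Longrightarrow> w v v' = 0"
    "\<And>v v'. v \<in> frame_class u 0 \<Longrightarrow> v' \<in> frame_class u 1 \<Longrightarrow> w v v' \<le> 1 / 2"
proof -
  obtain u where fr: "frame u" by (rule frame_exists)
  let ?k = "real (card V)"
  have uV: "u ` {..<r} \<subseteq> V" using fr by (auto simp: frame_def)
  have part_weight: "(\<Sum>i<r. part_weight i) = 3 * real r - 2"
  proof -
    have "(\<Sum>i<r. part_weight i) = (\<Sum>i<r. 3 - (if i < 2 then 1 else 0))" by (intro sum.cong) (auto simp: part_weight_def)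
    also have "\<dots> = 3 * real r - real (card {i. i < r \<and> i < 2})"
      by (simp add: sum_subtractf sum.If_cases Int_def)
    also have "{i. i < r \<and> i < 2} = {0, 1}" using r2 by (auto simp: less_2_cases_iff)
    finally show ?thesis by simp
  qed
  let ?B = "V - (\<Union>i<r. frame_class u i)"
  have "(\<Sum>v\<in>V. frame_deficiency u v) = (\<Sum>i<r. part_weight i * (\<Sum>v\<in>V. 1 - w v (u i)))"
    unfolding frame_deficiency_def by (subst sum.swap) (simp add: sum_distrib_left)
  also have "\<dots> \<le> (\<Sum>i<r. part_weight i * (gap * ?k))"
    using missing uV by (intro sum_mono mult_left_mono) (auto simp: part_weight_def)
  also have "\<dots> = gap * (3 * real r - 2) * ?k"
    by (simp add: sum_distrib_right[symmetric] part_weight mult_ac)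
  also have "\<dots> = (3 + \<eta> * (3 * real r - 2)) * ?k" by (simp only: gap_L)
  finally have up: "(\<Sum>v\<in>V. frame_deficiency u v) \<le> (3 + \<eta> * (3 * real r - 2)) * ?k" .
  have "(\<Sum>v\<in>V. 3 + 1 / 2 * of_bool (v \<in> ?B)) \<le> (\<Sum>v\<in>V. frame_deficiency u v)"
  proof (intro sum_mono)
    fix v assume v: "v \<in> V"
    show "3 + 1 / 2 * of_bool (v \<in> ?B) \<le> frame_deficiency u v"
      using frame_deficiency_class[OF fr v] by (cases "v \<in> ?B") auto
  qed
  also have "(\<Sum>v\<in>V. 3 + 1 / 2 * of_bool (v \<in> ?B)) = 3 * ?k + 1 / 2 * (\<Sum>v\<in>V. of_bool (v \<in> ?B))"
    by (simp add: sum.distrib sum_distrib_left del: sum_of_bool_eq Diff_iff)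
  also have "(\<Sum>v\<in>V. of_bool (v \<in> ?B)) = real (card ?B)"
    using fV by (simp add: Int_def set_diff_eq)
  finally have "real (card ?B) \<le> 2 * (3 * real r - 2) * \<eta> * ?k" using up by (simp add: algebra_simps)
  moreover have "w v v' = 0" if i: "i < r" and v: "v \<in> frame_class u i" "v' \<in> frame_class u i" for i v v'
  proof -
    have "v \<in> V" "v' \<in> V" using v by (auto simp: frame_class_def)
    then have "3 \<le> frame_deficiency (u(i := v')) v" using frame_deficiency_class[OF frame_upd[OF fr i v(2)]] by blast
    then show ?thesis using frame_deficiency_upd[OF i i v(1), of v'] w_vals[of v v']
      by (auto simp: pattern_def part_weight_def algebra_simps split: if_splits)
  qed
  moreover have "w v v' \<le> 1 / 2" if v: "v \<in> frame_class u 0" "v' \<in> frame_class u 1" for v v'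
  proof -
    have "v' \<in> V" using v by (auto simp: frame_class_def)
    have r01: "0 < r" "1 < r" using r2 by auto
    have "3 \<le> frame_deficiency (u(0 := v)) v'" using frame_deficiency_class[OF frame_upd[OF fr r01(1) v(1)] \<open>v' \<in> V\<close>] by blast
    then show ?thesis using frame_deficiency_upd[OF r01 v(2), of v] w_sym[of v v']
      by (simp add: pattern_def part_weight_def)
  qed
  ultimately show ?thesis using that fr by blast
qed

end

section \<open>The exact bound for graphs with an extremal partition\<close>

lemma card_Un3_ge:
  assumes "finite X" "finite Y" "finite Z"
  shows "real (card X) + real (card Y) + real (card Z)
    \<le> real (card (X \<union> Y \<union> Z)) + real (card (X \<inter> Y)) + real (card (X \<inter> Z)) + real (card (Y \<inter> Z))"
proof -
  have "card X + card Y = card (X \<union> Y) + card (X \<inter> Y)" using assms by (intro card_Un_Int) auto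
  moreover have "card (X \<union> Y) + card Z = card (X \<union> Y \<union> Z) + card ((X \<union> Y) \<inter> Z)"
    using assms by (intro card_Un_Int) auto
  moreover have "card ((X \<union> Y) \<inter> Z) \<le> card (X \<inter> Z) + card (Y \<inter> Z)"
    unfolding Int_Un_distrib2 by (rule card_Un_le)
  ultimately show ?thesis by linarith
qed

text \<open>A chosen point removes its conflicts and, by reflexivity, itself: at most
  \<open>s\<close> points in each round.\<close>

lemma greedy_independent:
  fixes s :: real
  assumes "finite L" "\<And>x. x \<in> L \<Longrightarrow> R x x" "\<And>x y. R x y \<Longrightarrow> R y x"
    and "\<And>x. x \<in> L \<Longrightarrow> real (card {y \<in> L. R x y}) \<le> s" "0 < s" "real m * s \<le> real (card L)"
  shows "\<exists>M \<subseteq> L. card M = m \<and> (\<forall>x\<in>M. \<forall>y\<in>M. x \<noteq> y \<longrightarrow> \<not> R x y)"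
  using assms
proof (induction m arbitrary: L)
  case 0
  then show ?case by (intro exI[of _ "{}"]) simp
next
  case (Suc m)
  have "card L > 0" using Suc.prems(5,6) by (metis of_nat_0_less_iff mult_pos_pos order_less_le_trans zero_less_Suc)
  then obtain x where x: "x \<in> L" by (metis card_gt_0_iff ex_in_conv)
  let ?L = "{y \<in> L. \<not> R x y}"
  have "card L = card ({y \<in> L. R x y} \<union> ?L)" by (rule arg_cong[where f=card]) auto
  also have "\<dots> = card {y \<in> L. R x y} + card ?L" by (rule card_Un_disjoint) (use Suc.prems(1) in auto)
  finally have "real m * s \<le> real (card ?L)" using Suc.prems(6) Suc.prems(4)[OF x] by (simp add: algebra_simps)
  moreover have "real (card {z \<in> ?L. R y z}) \<le> s" if "y \<in> ?L" for y
  proof -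
    have "card {z \<in> ?L. R y z} \<le> card {z \<in> L. R y z}" by (rule card_mono) (use Suc.prems(1) in auto)
    then show ?thesis using Suc.prems(4)[of y] that by simp
  qed
  ultimately have "\<exists>M \<subseteq> ?L. card M = m \<and> (\<forall>x\<in>M. \<forall>y\<in>M. x \<noteq> y \<longrightarrow> \<not> R x y)"
    using Suc.IH[of ?L, OF _ _ Suc.prems(3) _ Suc.prems(5)] Suc.prems(1,2) by simp
  then obtain M where M: "M \<subseteq> ?L" "card M = m" "\<forall>x\<in>M. \<forall>y\<in>M. x \<noteq> y \<longrightarrow> \<not> R x y" by blast
  have "M \<subseteq> L" using M(1) by auto
  then have "finite M" using Suc.prems(1) finite_subset by blast
  moreover have "x \<notin> M" using M(1) Suc.prems(2)[OF x] by auto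
  ultimately have "card (insert x M) = Suc m" using M(2) by simp
  moreover have "\<forall>y\<in>insert x M. \<forall>z\<in>insert x M. y \<noteq> z \<longrightarrow> \<not> R y z"
    using M Suc.prems(3) by blast
  moreover have "insert x M \<subseteq> L" using M(1) x by auto
  ultimately show ?case by blast
qed

text \<open>In the extremal graph \<open>h\<close> is \<open>n / (3 * r - 2)\<close> and the pair \<open>B 0\<close>, \<open>B 1\<close> has density \<open>1 / 2\<close>; all other
  pairs are complete.\<close>

locale partition_graph = rt_graph +
  fixes B :: "nat \<Rightarrow> 'a set" and h e :: real
  assumes B_Un: "V = (\<Union>i<r. B i)"
    and B_disj: "i < r \<Longrightarrow> j < r \<Longrightarrow> i \<noteq> j \<Longrightarrow> B i \<inter> B j = {}"
    and size01: "i < 2 \<Longrightarrow> \<bar>real (card (B i)) - 2 * h\<bar> \<le> e"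
    and size2: "2 \<le> i \<Longrightarrow> i < r \<Longrightarrow> \<bar>real (card (B i)) - 3 * h\<bar> \<le> e"
    and inner: "i < r \<Longrightarrow> v \<in> B i \<Longrightarrow> deg_in (B i) v \<le> e"
    and degree: "v \<in> V \<Longrightarrow> deg_in V v \<ge> real (card V) - 3 * h - e"
    and a_le: "a \<le> e"
    and cardV: "real (card V) = (3 * real r - 2) * h"
    and e_small: "100000 * real r * e \<le> h"
begin

lemma e_pos: "e > 0" using a_le a_pos by linarith

lemma e_h: "200000 * e \<le> h"
proof -
  have "2 * e \<le> real r * e" using r2 e_pos by (intro mult_right_mono) auto
  then show ?thesis using e_small by (simp add: mult.assoc)
qed

lemma h_pos: "h > 0" using e_h e_pos by linarith

lemma r01: "0 < r" "1 < r" "i < 2 \<Longrightarrow> i < r" using r2 by auto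

lemma BV: "i < r \<Longrightarrow> B i \<subseteq> V" using B_Un by auto

lemma finB: "i < r \<Longrightarrow> finite (B i)" using BV fin by blast

definition rest :: "'a set" where "rest = (\<Union>i\<in>{2..<r}. B i)"

lemma rest_eq: "rest = V - B 0 - B 1"
proof -
  have "{..<r} = insert 0 (insert 1 {2..<r})" using r2 by auto
  then have "V = B 0 \<union> B 1 \<union> rest" unfolding B_Un rest_def by auto
  moreover have "B 0 \<inter> rest = {}" "B 1 \<inter> rest = {}"
    using B_disj[of 0] B_disj[of 1] r01 by (fastforce simp: rest_def)+
  ultimately show ?thesis by auto
qed

lemma fin_rest: "finite rest" using rest_eq finite_V by simp

lemma nondeg_in_outside: "i < r \<Longrightarrow> v \<in> B i \<Longrightarrow> nondeg_in (V - B i) v \<le> 3 * h - real (card (B i)) + 2 * e"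
proof -
  assume i: "i < r" "v \<in> B i"
  have "deg_in (V - B i) v = deg_in V v - deg_in (B i) v" using deg_in_Diff[OF finite_V BV[OF i(1)]] .
  moreover have "deg_in (V - B i) v + nondeg_in (V - B i) v = real (card (V - B i))" by (rule deg_in_nondeg_in) (simp add: finite_V)
  moreover have "real (card (V - B i)) = real (card V) - real (card (B i))"
    using card_Diff_subset[OF finB BV] i card_mono[OF finite_V BV] by (simp add: of_nat_diff)
  moreover have "v \<in> V" using BV i by auto
  ultimately show ?thesis using degree[of v] inner[OF i] by linarith
qed

lemma nondeg_in_big: "2 \<le> i \<Longrightarrow> i < r \<Longrightarrow> j < r \<Longrightarrow> j \<noteq> i \<Longrightarrow> v \<in> B i \<Longrightarrow> nondeg_in (B j) v \<le> 3 * e"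
proof -
  assume i: "2 \<le> i" "i < r" "j < r" "j \<noteq> i" "v \<in> B i"
  have "nondeg_in (B j) v \<le> nondeg_in (V - B i) v"
    by (rule nondeg_in_mono) (use i BV[of j] B_disj[of i j] finite_V in auto)
  then show ?thesis using nondeg_in_outside[OF i(2,5)] size2[OF i(1,2)] by linarith
qed

lemma nondeg_in_big01: "v \<in> rest \<Longrightarrow> nondeg_in (B 0 \<union> B 1) v \<le> 3 * e"
proof -
  assume "v \<in> rest"
  then obtain i where i: "2 \<le> i" "i < r" "v \<in> B i" by (auto simp: rest_def)
  have "nondeg_in (B 0 \<union> B 1) v \<le> nondeg_in (V - B i) v"
    by (rule nondeg_in_mono) (use i BV[of 0] BV[of 1] B_disj[of i 0] B_disj[of i 1] r01 finite_V in auto)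
  then show ?thesis using nondeg_in_outside[OF i(2,3)] size2[OF i(1,2)] by linarith
qed

text \<open>A vertex of a part of size \<open>2 * h\<close> may miss one more unit \<open>h\<close>,
  and it may spread it freely over the opposite part and \<open>rest\<close>. Because of this
  freedom a single vertex of \<open>B 0\<close> need not be nearly complete to the large
  parts.\<close>

lemma nondeg_in_small: "i < 2 \<Longrightarrow> v \<in> B i \<Longrightarrow> nondeg_in (B (1 - i)) v + nondeg_in rest v \<le> h + 3 * e"
proof -
  assume i: "i < 2" "v \<in> B i"
  have i01: "i = 0 \<or> i = 1" using i by auto
  then have ir: "i < r" "1 - i < r" "i \<noteq> 1 - i" using r2 by auto
  have eq: "V - B i = B (1 - i) \<union> rest" "B (1 - i) \<inter> rest = {}"
    using i01 rest_eq BV[OF ir(1)] BV[OF ir(2)] B_disj[OF ir] by auto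
  have f: "finite (B (1 - i))" using finB ir by auto
  have "deg_in (V - B i) v = deg_in (B (1 - i)) v + deg_in rest v" unfolding eq(1) by (rule deg_in_Un[OF f fin_rest eq(2)])
  moreover have "card (V - B i) = card (B (1 - i)) + card rest" unfolding eq(1) by (rule card_Un_disjoint[OF f fin_rest eq(2)])
  ultimately have "nondeg_in (B (1 - i)) v + nondeg_in rest v = nondeg_in (V - B i) v"
    using deg_in_nondeg_in[OF f, of v] deg_in_nondeg_in[OF fin_rest, of v] deg_in_nondeg_in[of "V - B i" v] finite_V by simp
  then show ?thesis using nondeg_in_outside[OF ir(1) i(2)] size01[OF i(1)] by linarith
qed

lemma nondeg_in_rest: "2 \<le> j \<Longrightarrow> j < r \<Longrightarrow> nondeg_in (B j) v \<le> nondeg_in rest v"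
  by (rule nondeg_in_mono[OF _ fin_rest]) (auto simp: rest_def)

lemma deg_in_cross: "i < 2 \<Longrightarrow> v \<in> B i \<Longrightarrow> deg_in (B (1 - i)) v \<ge> h - 4 * e"
proof -
  assume i: "i < 2" "v \<in> B i"
  have "1 - i < r" "1 - i < 2" using r2 by auto
  then show ?thesis
    using nondeg_in_small[OF i] nondeg_in_nonneg[of rest v] deg_in_nondeg_in[OF finB, of "1 - i" v] size01[of "1 - i"] by linarith
qed

text \<open>Double counting: vertices of \<open>rest\<close> miss almost nothing of
  \<open>B 0 \<union> B 1\<close>, so few vertices there miss much of \<open>rest\<close>.\<close>

lemma atypical: "real (card {z \<in> B 0 \<union> B 1. nondeg_in rest z > h / 100}) \<le> h / 100"
proof -
  have f: "finite (B 0 \<union> B 1)" using finB r01 by auto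
  have "h / 100 * real (card {z \<in> B 0 \<union> B 1. nondeg_in rest z > h / 100}) \<le> (\<Sum>z\<in>B 0 \<union> B 1. nondeg_in rest z)"
    by (rule markov[OF f]) simp
  also have "\<dots> = (\<Sum>v\<in>rest. nondeg_in (B 0 \<union> B 1) v)" by (rule nondeg_in_sum_swap[OF f fin_rest])
  also have "\<dots> \<le> (\<Sum>v\<in>rest. 3 * e)" by (rule sum_mono) (rule nondeg_in_big01)
  also have "\<dots> = real (card rest) * (3 * e)" by simp
  also have "\<dots> \<le> real (card V) * (3 * e)"
    using e_pos card_mono[OF finite_V, of rest] rest_eq by (intro mult_right_mono) auto
  also have "\<dots> \<le> (3 * real r * h) * (3 * e)"
    using e_pos h_pos unfolding cardV by (intro mult_right_mono) auto
  also have "\<dots> = h * (9 * (real r * e))" by simp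
  also have "\<dots> \<le> h * (h / 10000)" using e_small h_pos by (intro mult_left_mono) auto
  finally have "h * real (card {z \<in> B 0 \<union> B 1. nondeg_in rest z > h / 100}) \<le> h * (h / 100)" by (simp add: field_simps)
  then show ?thesis using h_pos by simp
qed

lemma typical_subset:
  assumes "Y \<subseteq> B 0 \<union> B 1"
  shows "real (card {z \<in> Y. nondeg_in rest z \<le> h / 100}) \<ge> real (card Y) - h / 100"
proof -
  have f: "finite (B 0 \<union> B 1)" using finB r01 by auto
  have fY: "finite Y" using assms f finite_subset by blast
  have "card Y = card ({z \<in> Y. nondeg_in rest z \<le> h / 100} \<union> {z \<in> Y. nondeg_in rest z > h / 100})"
    by (rule arg_cong[where f=card]) auto
  also have "\<dots> \<le> card {z \<in> Y. nondeg_in rest z \<le> h / 100} + card {z \<in> Y. nondeg_in rest z > h / 100}" by (rule card_Un_le)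
  also have "card {z \<in> Y. nondeg_in rest z > h / 100} \<le> card {z \<in> B 0 \<union> B 1. nondeg_in rest z > h / 100}"
    by (rule card_mono) (use f assms in auto)
  finally show ?thesis using atypical by linarith
qed

text \<open>The large parts have about \<open>3 * h\<close> vertices. A clique that misses at most
  \<open>5 / 2 * h\<close> of each leaves about \<open>h / 2\<close>, enough for \<open>a\<close>
  and the losses in \<open>extend_bound\<close>.\<close>

lemma no_extension:
  assumes K: "is_clique K" "K \<subseteq> V" and J: "J \<subseteq> {2..<r}"
    and m: "\<And>j. j \<in> J \<Longrightarrow> (\<Sum>z\<in>K. nondeg_in (B j) z) \<le> 5 / 2 * h"
  shows "card K + 2 * card J < 2 * r"
proof (rule extend_bound[OF K, of J B "3 * e"])
  have jr: "2 \<le> j" "j < r" if "j \<in> J" for j using subsetD[OF J that] by auto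
  show "finite J" using J finite_subset by blast
  show "B j \<subseteq> V" if "j \<in> J" for j using BV jr(2)[OF that] by blast
  show "0 \<le> 3 * e" using e_pos by simp
  show "a + 2 * real (card J) * (3 * e) \<le> real (card (B j)) - (\<Sum>z\<in>K. nondeg_in (B j) z)" if j: "j \<in> J" for j
  proof -
    have "card J \<le> r" using card_mono[OF _ J] by simp
    then have "real (card J) * e \<le> real r * e" using e_pos by (intro mult_right_mono) auto
    moreover have "real (card (B j)) \<ge> 3 * h - e" using size2[OF jr[OF j]] by linarith
    ultimately show ?thesis using m[OF j] a_le e_small e_h h_pos by (simp add: algebra_simps)
  qed
  show "nondeg_in (B j) x \<le> 3 * e" if "i \<in> J" "j \<in> J" "i \<noteq> j" "x \<in> B i" for i j x
    by (rule nondeg_in_big) (use jr that in auto)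
qed

section \<open>Edges inside the two small parts\<close>

definition nbr :: "nat \<Rightarrow> 'a \<Rightarrow> 'a set" where "nbr i x = {z \<in> B i. adj x z}"

lemma card_nbr: "real (card (nbr i x)) = deg_in (B i) x" by (simp add: nbr_def deg_in_def)

lemma fin_nbr: "i < r \<Longrightarrow> finite (nbr i x)" using finB by (auto simp: nbr_def)

context
  fixes i i' :: nat
  assumes i2: "i < 2" and i': "i' = 1 - i"
begin

lemma ii: "i < r" "i' < r" "i' < 2" "1 - i' = i" "i \<noteq> i'" "B i \<subseteq> B 0 \<union> B 1" "B i' \<subseteq> B 0 \<union> B 1" "finite (B i)" "finite (B i')"
  "B i \<subseteq> V" "B i' \<subseteq> V"
proof -
  have i01: "i = 0 \<or> i = 1" using i2 by auto
  then show "B i \<subseteq> B 0 \<union> B 1" "B i' \<subseteq> B 0 \<union> B 1" using i' by auto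
  show "i < r" "i' < r" "i' < 2" "1 - i' = i" "i \<noteq> i'" using i01 i' r2 by auto
  then show "finite (B i)" "finite (B i')" "B i \<subseteq> V" "B i' \<subseteq> V" using finB BV by auto
qed

lemma sizes: "2 * h - e \<le> real (card (B i'))" "real (card (B i')) \<le> 2 * h + e"
  "2 * h - e \<le> real (card (B i))" "real (card (B i)) \<le> 2 * h + e"
  using size01[of i] size01[of i'] i2 ii by auto

text \<open>Otherwise the four vertices extend by an edge in each of the \<open>r - 2\<close> large
  parts, which gives \<open>4 + 2 * (r - 2)\<close> vertices.\<close>

lemma K4_bound:
  assumes "x \<in> B i" "y \<in> B i" "adj x y" "z \<in> B i'" "w \<in> B i'" "adj z w" "adj x z" "adj x w" "adj y z" "adj y w"
  shows "nondeg_in rest x + nondeg_in rest y + nondeg_in rest z + nondeg_in rest w > 5 / 2 * h"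
proof (rule ccontr)
  assume H: "\<not> ?thesis"
  have ne: "x \<noteq> y" "z \<noteq> w" "x \<noteq> z" "x \<noteq> w" "y \<noteq> z" "y \<noteq> w" using assms adj_irrefl by metis+
  have cl: "is_clique {x, y, z, w}" using assms adj_sym unfolding is_clique_def by blast
  have "card {x, y, z, w} + 2 * card {2..<r} < 2 * r"
  proof (rule no_extension[OF cl])
    show "{x, y, z, w} \<subseteq> V" using assms ii by auto
    show "(\<Sum>v\<in>{x, y, z, w}. nondeg_in (B j) v) \<le> 5 / 2 * h" if "j \<in> {2..<r}" for j
    proof -
      have "(\<Sum>v\<in>{x, y, z, w}. nondeg_in (B j) v) \<le> (\<Sum>v\<in>{x, y, z, w}. nondeg_in rest v)"
        using that by (intro sum_mono nondeg_in_rest) auto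
      also have "\<dots> \<le> 5 / 2 * h" using H ne by simp
      finally show ?thesis .
    qed
  qed simp
  then show False using ne r2 by simp
qed

lemma codegree_ge: "real (card (nbr i' x \<inter> nbr i' y)) \<ge> deg_in (B i') x + deg_in (B i') y - real (card (B i'))"
proof -
  have f: "finite (nbr i' x)" "finite (nbr i' y)" using fin_nbr ii by auto
  have "card (nbr i' x \<union> nbr i' y) \<le> card (B i')" by (rule card_mono) (use ii in \<open>auto simp: nbr_def\<close>)
  then show ?thesis using card_Un_Int[OF f] card_nbr[of i' x] card_nbr[of i' y] by linarith
qed

text \<open>The first half of a bootstrap. The two ends may miss about \<open>h\<close> each in
  \<open>rest\<close>, so \<open>K4_bound\<close> forbids only edges between typical common
  neighbours; this limits the common neighbourhood to \<open>h / 50\<close>. Then the ends together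
  miss almost \<open>2 * h\<close> in the opposite part, which nearly exhausts what they may miss,
  and little is left for \<open>rest\<close>.\<close>

lemma inner_edge_typical:
  assumes "x \<in> B i" "y \<in> B i" "adj x y"
  shows "nondeg_in rest x \<le> 3 / 100 * h"
proof -
  have mx: "nondeg_in rest x \<le> h + 3 * e" "nondeg_in rest y \<le> h + 3 * e"
    using nondeg_in_small[OF i2 assms(1)] nondeg_in_small[OF i2 assms(2)] nondeg_in_nonneg[of "B (1 - i)" x] nondeg_in_nonneg[of "B (1 - i)" y]
    by linarith+
  have "real (card (nbr i' x \<inter> nbr i' y)) \<le> 2 * (h / 100)"
  proof (rule ccontr)
    assume H: "\<not> ?thesis"
    let ?Y = "{z \<in> nbr i' x \<inter> nbr i' y. nondeg_in rest z \<le> h / 100}"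
    have "real (card ?Y) \<ge> real (card (nbr i' x \<inter> nbr i' y)) - h / 100"
      by (rule typical_subset) (use ii in \<open>auto simp: nbr_def\<close>)
    then have Yc: "real (card ?Y) \<ge> a" using H e_h a_le h_pos by linarith
    have YV: "?Y \<subseteq> V" using ii by (auto simp: nbr_def)
    obtain z w where zw: "z \<in> ?Y" "w \<in> ?Y" "adj z w" by (rule edge_ex[OF YV Yc])
    then have "nondeg_in rest x + nondeg_in rest y + nondeg_in rest z + nondeg_in rest w > 5 / 2 * h"
      using K4_bound[OF assms, of z w] by (auto simp: nbr_def)
    moreover have "nondeg_in rest z \<le> h / 100" "nondeg_in rest w \<le> h / 100" using zw by auto
    ultimately show False using mx e_h h_pos by linarith
  qed
  then have "deg_in (B i') x + deg_in (B i') y - real (card (B i')) \<le> 2 * (h / 100)"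
    using codegree_ge[of x y] by linarith
  moreover have "nondeg_in (B i') x + nondeg_in rest x \<le> h + 3 * e" "nondeg_in (B i') y + nondeg_in rest y \<le> h + 3 * e"
    using nondeg_in_small[OF i2] assms i' by auto
  moreover have "deg_in (B i') x + nondeg_in (B i') x = real (card (B i'))" "deg_in (B i') y + nondeg_in (B i') y = real (card (B i'))"
    using deg_in_nondeg_in ii by auto
  ultimately show ?thesis using sizes nondeg_in_nonneg[of rest y] e_h h_pos by linarith
qed

end

text \<open>The second half: an edge between common neighbours is itself an inner edge of the
  opposite part, so its ends satisfy \<open>inner_edge_typical\<close> as well, and already
  \<open>a\<close> common neighbours are too many.\<close>

lemma codegree_lt:
  assumes i: "i < 2" "i' = 1 - i" and xy: "x \<in> B i" "y \<in> B i" "adj x y"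
  shows "real (card (nbr i' x \<inter> nbr i' y)) < a"
proof (rule ccontr)
  assume H: "\<not> ?thesis"
  note ii = ii[OF i]
  have YV: "nbr i' x \<inter> nbr i' y \<subseteq> V" using ii by (auto simp: nbr_def)
  have Yc: "real (card (nbr i' x \<inter> nbr i' y)) \<ge> a" using H by simp
  obtain z w where zw: "z \<in> nbr i' x \<inter> nbr i' y" "w \<in> nbr i' x \<inter> nbr i' y" "adj z w"
    by (rule edge_ex[OF YV Yc])
  then have zw': "z \<in> B i'" "w \<in> B i'" by (auto simp: nbr_def)
  have "nondeg_in rest x + nondeg_in rest y + nondeg_in rest z + nondeg_in rest w > 5 / 2 * h"
    using K4_bound[OF i xy, of z w] zw by (auto simp: nbr_def)
  moreover have "nondeg_in rest x \<le> 3 / 100 * h" "nondeg_in rest y \<le> 3 / 100 * h"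
    using inner_edge_typical[OF i xy] inner_edge_typical[OF i xy(2,1) adj_sym[OF xy(3)]] .
  moreover have "nondeg_in rest z \<le> 3 / 100 * h" "nondeg_in rest w \<le> 3 / 100 * h"
    using inner_edge_typical[OF ii(3) ii(4)[symmetric] zw' zw(3)]
      inner_edge_typical[OF ii(3) ii(4)[symmetric] zw'(2,1) adj_sym[OF zw(3)]] .
  ultimately show False using h_pos by linarith
qed

end

section \<open>Counting the edges at one of the two small parts\<close>

locale half_graph = partition_graph +
  fixes i i' :: nat
  assumes i2: "i < 2" and i': "i' = 1 - i"
begin

lemmas ii' = ii[OF i2 i'] and sizes' = sizes[OF i2 i'] and codeg = codegree_lt[OF i2 i']

abbreviation "N \<equiv> nbr i"
abbreviation "X \<equiv> nbr i'"

lemma finX: "finite (X x)" "finite (N x)" using fin_nbr ii' by auto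

lemma X_ge: "x \<in> B i \<Longrightarrow> real (card (X x)) \<ge> h - 4 * e"
  using deg_in_cross[OF i2] i' by (simp add: card_nbr)

lemma X_sum: "x \<in> B i \<Longrightarrow> y \<in> B i \<Longrightarrow> adj x y \<Longrightarrow> real (card (X x)) + real (card (X y)) < real (card (B i')) + a"
  using codegree_ge[OF i2 i', of x y] codeg[of x y] by (simp add: card_nbr)

lemma X_le: "x \<in> B i \<Longrightarrow> y \<in> B i \<Longrightarrow> adj x y \<Longrightarrow> real (card (X x)) \<le> h + 6 * e"
  using X_sum[of x y] X_ge[of y] sizes' a_le by linarith

lemma X_Un_le: "real (card (X x \<union> X y \<union> X z)) \<le> 2 * h + e"
proof -
  have "card (X x \<union> X y \<union> X z) \<le> card (B i')" by (rule card_mono) (use ii' in \<open>auto simp: nbr_def\<close>)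
  then show ?thesis using sizes' by linarith
qed

text \<open>Three sets of about \<open>h\<close> vertices in a part of about \<open>2 * h\<close>
  must overlap in about \<open>h\<close> altogether. Adjacent vertices overlap in fewer than
  \<open>a\<close>, so the part contains no triangle.\<close>

lemma three_X:
  assumes "x \<in> B i" "y \<in> B i" "z \<in> B i"
  shows "real (card (X x \<inter> X y)) + real (card (X x \<inter> X z)) + real (card (X y \<inter> X z)) \<ge> h - 13 * e"
  using card_Un3_ge[OF finX(1) finX(1) finX(1), of x y z] X_Un_le[of x y z] X_ge[OF assms(1)] X_ge[OF assms(2)] X_ge[OF assms(3)]
  by linarith

lemma N_subset: "N x \<subseteq> B i" by (auto simp: nbr_def)

lemma N_inde: "x \<in> B i \<Longrightarrow> is_indep (N x)"
  unfolding is_indep_def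
proof (intro ballI notI)
  fix y z assume x: "x \<in> B i" and y: "y \<in> N x" and z: "z \<in> N x" and yz: "adj y z"
  have "real (card (X x \<inter> X y)) + real (card (X x \<inter> X z)) + real (card (X y \<inter> X z)) \<ge> h - 13 * e"
    using x y z by (intro three_X) (auto simp: nbr_def)
  moreover have "real (card (X x \<inter> X y)) < a" "real (card (X x \<inter> X z)) < a" "real (card (X y \<inter> X z)) < a"
    using codeg x y z yz by (auto simp: nbr_def)
  ultimately show False using a_le e_h e_pos by linarith
qed

text \<open>Both \<open>X x\<close> and \<open>X x'\<close> nearly complement
  \<open>X y\<close>.\<close>

lemma common_neighbour_overlap:
  assumes "x \<in> B i" "x' \<in> B i" "y \<in> B i" "adj x y" "adj x' y"
  shows "real (card (X x \<inter> X x')) \<ge> h - 15 * e"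
  using three_X[of x x' y] codeg[of x y] codeg[of x' y] assms a_le by linarith

text \<open>Three near-complementations along the path from \<open>x\<close> to \<open>x'\<close>
  make \<open>X x'\<close> nearly the complement of \<open>X x\<close>.\<close>

lemma neighbours_adjacent_overlap:
  assumes "x \<in> B i" "x' \<in> B i" "y \<in> B i" "y' \<in> B i" "adj x y" "adj x' y'" "adj y y'"
  shows "real (card (X x \<inter> X x')) \<le> 12 * e"
proof -
  have "real (card (X x \<inter> X x')) + real (card (X y)) + real (card (X y'))
    \<le> real (card ((X x \<inter> X x') \<union> X y \<union> X y')) + real (card (X x \<inter> X x' \<inter> X y))
      + real (card (X x \<inter> X x' \<inter> X y')) + real (card (X y \<inter> X y'))"
    by (rule card_Un3_ge) (use finX in auto)
  moreover have "card ((X x \<inter> X x') \<union> X y \<union> X y') \<le> card (B i')"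
    by (rule card_mono) (use ii' in \<open>auto simp: nbr_def\<close>)
  moreover have "card (X x \<inter> X x' \<inter> X y) \<le> card (X x \<inter> X y)" "card (X x \<inter> X x' \<inter> X y') \<le> card (X x' \<inter> X y')"
    using finX by (auto intro!: card_mono)
  moreover have "real (card (X x \<inter> X y)) < a" "real (card (X x' \<inter> X y')) < a" "real (card (X y \<inter> X y')) < a"
    using codeg assms by auto
  ultimately show ?thesis using X_ge[of y] X_ge[of y'] assms sizes' a_le by linarith
qed

text \<open>The conflict relation of the greedy choice: without a conflict the two inner
  neighbourhoods are disjoint and no edge joins them. A vertex is in conflict with itself as soon as
  it has an inner neighbour.\<close>

definition excl :: "'a \<Rightarrow> 'a \<Rightarrow> bool" where
  "excl x x' \<longleftrightarrow> (\<exists>y\<in>N x. \<exists>y'\<in>N x'. y = y' \<or> adj y y')"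

lemma excl_sym: "excl x x' \<Longrightarrow> excl x' x"
  unfolding excl_def using adj_sym by metis

text \<open>A conflict means a path of length 2 or 3 from \<open>x\<close>, so \<open>X x'\<close>
  nearly equals \<open>X x\<close> or nearly complements it. Within each kind the cross
  neighbourhoods almost agree, hence no two members are adjacent, and each kind has fewer than
  \<open>a\<close> members.\<close>

lemma card_excl:
  assumes x: "x \<in> B i"
  shows "real (card {x' \<in> B i. excl x x'}) \<le> 2 * a"
proof -
  let ?D = "{x' \<in> B i. \<exists>y\<in>N x. y \<in> N x'}" and ?E = "{x' \<in> B i. \<exists>y\<in>N x. \<exists>y'\<in>N x'. adj y y'}"
  have "is_indep ?D"
    unfolding is_indep_def
  proof (intro ballI notI)
    fix u v assume u: "u \<in> ?D" and v: "v \<in> ?D" and uv: "adj u v"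
    have ov: "real (card (X x \<inter> X t)) \<ge> h - 15 * e" if t: "t \<in> ?D" for t
    proof -
      obtain y where "y \<in> B i" "adj x y" "adj t y" using t by (auto simp: nbr_def)
      then show ?thesis using common_neighbour_overlap[OF x, of t y] t by simp
    qed
    obtain y where y: "y \<in> B i" "adj x y" using u by (auto simp: nbr_def)
    have "card (X x \<inter> X u) + card (X x \<inter> X v) = card ((X x \<inter> X u) \<union> (X x \<inter> X v)) + card ((X x \<inter> X u) \<inter> (X x \<inter> X v))"
      by (rule card_Un_Int) (use finX in auto)
    moreover have "card ((X x \<inter> X u) \<union> (X x \<inter> X v)) \<le> card (X x)" by (rule card_mono) (use finX in auto)
    moreover have "card ((X x \<inter> X u) \<inter> (X x \<inter> X v)) \<le> card (X u \<inter> X v)" by (rule card_mono) (use finX in auto)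
    moreover have "real (card (X u \<inter> X v)) < a" using codeg u v uv by auto
    ultimately show False using ov[OF u] ov[OF v] X_le[OF x y] a_le e_h e_pos by linarith
  qed
  then have 1: "real (card ?D) < a" using ii' by (intro indep) auto
  have "is_indep ?E"
    unfolding is_indep_def
  proof (intro ballI notI)
    fix u v assume u: "u \<in> ?E" and v: "v \<in> ?E" and uv: "adj u v"
    have ov: "real (card (X x \<inter> X t)) \<le> 12 * e" if t: "t \<in> ?E" for t
    proof -
      obtain y y' where "y \<in> B i" "adj x y" "y' \<in> B i" "adj t y'" "adj y y'" using t by (auto simp: nbr_def)
      then show ?thesis using neighbours_adjacent_overlap[OF x, of t y y'] t by simp
    qed
    have "real (card (X u \<inter> X v)) < a" using codeg u v uv by auto
    moreover have "real (card (X x \<inter> X u)) + real (card (X x \<inter> X v)) + real (card (X u \<inter> X v)) \<ge> h - 13 * e"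
      using u v x by (intro three_X) auto
    ultimately show False using ov[OF u] ov[OF v] a_le e_h e_pos by linarith
  qed
  then have 2: "real (card ?E) < a" using ii' by (intro indep) auto
  have "{x' \<in> B i. excl x x'} \<subseteq> ?D \<union> ?E" by (auto simp: excl_def)
  then have "card {x' \<in> B i. excl x x'} \<le> card (?D \<union> ?E)" by (rule card_mono[rotated]) (use ii' in auto)
  also have "\<dots> \<le> card ?D + card ?E" by (rule card_Un_le)
  finally show ?thesis using 1 2 by linarith
qed

text \<open>The set that the overview counts by \<open>t\<close>; it can be joined to any
  independent subset of the part.\<close>

definition isol :: "'a set" where "isol = {x \<in> B i. N x = {}}"

lemma isol_nonadj: "x \<in> isol \<Longrightarrow> y \<in> B i \<Longrightarrow> \<not> adj x y \<and> \<not> adj y x"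
  using adj_sym by (auto simp: isol_def nbr_def)

lemma isol_Un:
  assumes "A \<subseteq> B i" "is_indep A" "A \<inter> isol = {}"
  shows "real (card A) + real (card isol) < a"
proof -
  have s: "isol \<subseteq> B i" by (auto simp: isol_def)
  have f: "finite A" "finite isol" using assms(1) s ii' finite_subset by blast+
  have "is_indep (A \<union> isol)" using assms s isol_nonadj unfolding is_indep_def by blast
  then have "real (card (A \<union> isol)) < a" using assms(1) s ii' by (intro indep) auto
  then show ?thesis using card_Un_disjoint[OF f assms(3)] by simp
qed

lemma N_isol: "x \<in> B i \<Longrightarrow> N x \<inter> isol = {}"
  using isol_nonadj by (auto simp: nbr_def)

lemma finite_isol: "isol \<subseteq> B i" "finite isol"
  using ii' finite_subset by (auto simp: isol_def)

lemma isol_lt: "real (card isol) < a"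
  using isol_Un[of "{}"] by (simp add: is_indep_def)

lemma inner_degree: "x \<in> B i \<Longrightarrow> deg_in (B i) x \<le> a - real (card isol)"
  using isol_Un[OF N_subset N_inde N_isol] by (force simp: card_nbr)

text \<open>Vertices that are pairwise not \<open>excl\<close> have disjoint neighbourhoods inside the part, and
  the union of these with the isolated vertices is independent; so few vertices have large inner degree.\<close>

lemma inner_sum: "(\<Sum>x\<in>B i. deg_in (B i) x) \<le> (a - real (card isol)) * (h / 20)"
proof -
  define s where "s = a - real (card isol)"
  have s: "s > 0" using isol_lt by (simp add: s_def)
  define L where "L = {x \<in> B i. deg_in (B i) x > s / 100}"
  have fL: "finite L" "L \<subseteq> B i" using ii' by (auto simp: L_def)
  have L_bound: "real (card L) < 100 * (2 * a)"
  proof (rule ccontr)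
    assume H: "\<not> ?thesis"
    \<comment> \<open>A hundred disjoint neighbourhoods of more than \<open>s / 100\<close> vertices
      each would contain at least \<open>s\<close> vertices, and with \<open>isol\<close> they would
      form an independent set of size at least \<open>a\<close>.\<close>
    have "\<exists>M \<subseteq> L. card M = 100 \<and> (\<forall>x\<in>M. \<forall>y\<in>M. x \<noteq> y \<longrightarrow> \<not> excl x y)"
    proof (rule greedy_independent[OF fL(1) _ excl_sym])
      show "excl x x" if "x \<in> L" for x
      proof -
        have "deg_in (B i) x > 0" using that s by (auto simp: L_def)
        then have "N x \<noteq> {}" using card_nbr[of i x] by auto
        then show ?thesis by (auto simp: excl_def)
      qed
      show "real (card {y \<in> L. excl x y}) \<le> 2 * a" if "x \<in> L" for x
      proof -
        have "card {y \<in> L. excl x y} \<le> card {y \<in> B i. excl x y}" by (rule card_mono) (use ii' fL in auto)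
        then show ?thesis using card_excl[of x] that fL by auto
      qed
      show "0 < 2 * a" using a_pos by simp
      show "real 100 * (2 * a) \<le> real (card L)" using H by simp
    qed
    then obtain M where M: "M \<subseteq> L" "card M = 100" "\<And>x y. x \<in> M \<Longrightarrow> y \<in> M \<Longrightarrow> x \<noteq> y \<Longrightarrow> \<not> excl x y"
      by blast
    have fM: "finite M" using M(1) fL finite_subset by blast
    have MB: "x \<in> B i" if "x \<in> M" for x using M(1) fL that by auto
    let ?I = "\<Union>x\<in>M. N x"
    have "is_indep ?I"
      unfolding is_indep_def
    proof (intro ballI notI)
      fix y z assume "y \<in> ?I" "z \<in> ?I" and yz: "adj y z"
      then obtain u v where uv: "u \<in> M" "v \<in> M" "y \<in> N u" "z \<in> N v" by blast
      show False
      proof (cases "u = v")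
        case True then show False using N_inde[OF MB[OF uv(1)]] uv yz by (auto simp: is_indep_def)
      next
        case False then show False using M(3)[OF uv(1,2)] uv yz by (auto simp: excl_def)
      qed
    qed
    then have "real (card ?I) + real (card isol) < a"
      by (rule isol_Un[rotated]) (use N_isol MB N_subset in blast)+
    moreover have "card ?I = (\<Sum>x\<in>M. card (N x))"
    proof (rule card_UN_disjoint[OF fM])
      show "\<forall>x\<in>M. finite (N x)" using finX by blast
      show "\<forall>x\<in>M. \<forall>y\<in>M. x \<noteq> y \<longrightarrow> N x \<inter> N y = {}"
      proof (intro ballI impI)
        fix x y assume "x \<in> M" "y \<in> M" "x \<noteq> y"
        from M(3)[OF this] show "N x \<inter> N y = {}" unfolding excl_def by blast
      qed
    qed
    then have "real (card ?I) = (\<Sum>x\<in>M. deg_in (B i) x)" by (simp add: card_nbr)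
    moreover have "(\<Sum>x\<in>M. deg_in (B i) x) \<ge> (\<Sum>x\<in>M. s / 100)"
      using M(1) by (intro sum_mono) (auto simp: L_def)
    ultimately show False using M(2) by (simp add: s_def)
  qed
  have "(\<Sum>x\<in>B i. deg_in (B i) x) \<le> (\<Sum>x\<in>B i. s / 100 + s * of_bool (x \<in> L))"
  proof (rule sum_mono)
    fix x assume x: "x \<in> B i"
    show "deg_in (B i) x \<le> s / 100 + s * of_bool (x \<in> L)"
    proof -
      have "deg_in (B i) x \<le> s" using inner_degree[OF x] by (simp add: s_def)
      then show ?thesis using x s by (cases "x \<in> L") (auto simp: L_def)
    qed
  qed
  also have "\<dots> = s * (real (card (B i)) / 100 + (\<Sum>x\<in>B i. of_bool (x \<in> L)))"
    by (simp add: sum.distrib sum_distrib_left distrib_left del: sum_of_bool_eq)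
  also have "(\<Sum>x\<in>B i. of_bool (x \<in> L)) = real (card L)"
    using fL ii' by (simp add: Int_absorb1)
  \<comment> \<open>The first term is about \<open>h / 50\<close>, and \<open>card L\<close> is
    below \<open>200 * e\<close>, hence at most \<open>h / 1000\<close>.\<close>
  also have "s * (real (card (B i)) / 100 + real (card L)) \<le> s * (h / 20)"
    using s L_bound sizes' a_le e_h h_pos by (intro mult_left_mono) (simp_all add: field_simps)
  finally show ?thesis by (simp add: s_def)
qed

text \<open>Vertices of \<open>isol\<close> may see the whole opposite part, of \<open>b\<close>
  vertices. Among the others, adjacent vertices cannot both see more than
  \<open>(b + a) / 2\<close>, so the exceptions are independent; there are at most
  \<open>a - card isol\<close> of them, and by \<open>X_le\<close> they exceed this value by at most
  \<open>7 * e\<close>.\<close>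

lemma cross_sum:
  "(\<Sum>x\<in>B i. deg_in (B i') x) \<le> real (card isol) * real (card (B i'))
    + (real (card (B i)) - real (card isol)) * ((real (card (B i')) + a) / 2) + (a - real (card isol)) * (7 * e)"
proof -
  let ?b = "real (card (B i'))"
  define H where "H = {x \<in> B i - isol. deg_in (B i') x > (?b + a) / 2}"
  have HB: "H \<subseteq> B i" "H \<inter> isol = {}" by (auto simp: H_def)
  have fH: "finite H" using HB ii' finite_subset by blast
  have "is_indep H"
    unfolding is_indep_def
  proof (intro ballI notI)
    fix x y assume xy: "x \<in> H" "y \<in> H" "adj x y"
    then show False using X_sum[of x y] by (auto simp: H_def card_nbr)
  qed
  then have cH: "real (card H) \<le> a - real (card isol)" using isol_Un[OF HB(1) _ HB(2)] by simp
  have "(\<Sum>x\<in>B i. deg_in (B i') x) \<le> (\<Sum>x\<in>B i. (?b + a) / 2 + (?b - (?b + a) / 2) * of_bool (x \<in> isol) + 7 * e * of_bool (x \<in> H))"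
  proof (rule sum_mono)
    fix x assume x: "x \<in> B i"
    consider (1) "x \<in> isol" | (2) "x \<in> H" "x \<notin> isol" | (3) "x \<notin> isol" "x \<notin> H" by blast
    then show "deg_in (B i') x \<le> (?b + a) / 2 + (?b - (?b + a) / 2) * of_bool (x \<in> isol) + 7 * e * of_bool (x \<in> H)"
    proof cases
      case 1
      then have "x \<notin> H" by (simp add: H_def)
      then show ?thesis using 1 deg_in_le_card[of "B i'" x] ii' by simp
    next
      case 2
      then obtain y where "y \<in> N x" using x by (auto simp: isol_def)
      then have "deg_in (B i') x \<le> h + 6 * e" using X_le[OF x, of y] by (auto simp: nbr_def card_nbr[symmetric])
      then have "deg_in (B i') x \<le> (?b + a) / 2 + 7 * e" using sizes' a_pos e_pos by (simp add: field_simps)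
      then show ?thesis using 2 by simp
    next
      case 3
      then show ?thesis using x by (simp add: H_def)
    qed
  qed
  also have "\<dots> = real (card (B i)) * ((?b + a) / 2) + (?b - (?b + a) / 2) * (\<Sum>x\<in>B i. of_bool (x \<in> isol))
     + 7 * e * (\<Sum>x\<in>B i. of_bool (x \<in> H))"
    by (simp add: sum.distrib sum_distrib_left del: sum_of_bool_eq)
  also have "(\<Sum>x\<in>B i. of_bool (x \<in> isol)) = real (card isol)"
    using finite_isol ii' by (simp add: Int_absorb1)
  also have "(\<Sum>x\<in>B i. of_bool (x \<in> H)) = real (card H)"
    using HB ii' by (simp add: Int_absorb1)
  also have "real (card (B i)) * ((?b + a) / 2) + (?b - (?b + a) / 2) * real (card isol) + 7 * e * real (card H)
    \<le> real (card (B i)) * ((?b + a) / 2) + (?b - (?b + a) / 2) * real (card isol) + 7 * e * (a - real (card isol))"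
    using cH e_pos by simp
  finally show ?thesis by (simp add: algebra_simps)
qed

text \<open>One more vertex in \<open>isol\<close> is worth \<open>(b - a) / 2\<close>, nearly
  \<open>h\<close>, across the pair, where \<open>b\<close> is the size of the opposite part. This
  beats \<open>h / 20 + 7 * e\<close>, the coefficient of \<open>a - card isol\<close> in the other
  terms, so the bound is largest at \<open>card isol = a\<close>.\<close>

lemma half_sum:
  "(\<Sum>x\<in>B i. deg_in (B i') x + deg_in (B i) x)
    \<le> (real (card (B i)) * real (card (B i')) + a * real (card (B i)) + a * real (card (B i')) - a\<^sup>2) / 2"
proof -
  let ?b = "real (card (B i'))" and ?c = "real (card (B i))" and ?t = "real (card isol)"
  have "(a - ?t) * (7 * e + h / 20) \<le> (a - ?t) * ((?b - a) / 2)"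
    using isol_lt sizes' a_le e_h h_pos by (intro mult_left_mono) auto
  then have "(\<Sum>x\<in>B i. deg_in (B i') x + deg_in (B i) x) \<le> ?t * ?b + (?c - ?t) * ((?b + a) / 2) + (a - ?t) * ((?b - a) / 2)"
    using inner_sum cross_sum unfolding sum.distrib distrib_left by linarith
  also have "\<dots> = (?c * ?b + a * ?c + a * ?b - a\<^sup>2) / 2"
    by (simp add: power2_eq_square field_simps)
  finally show ?thesis .
qed

end

context partition_graph
begin

text \<open>A triangle in a large part would extend by a vertex of \<open>B 1\<close> and an edge of
  \<open>B 0\<close> to six vertices, and then by an edge in each of the \<open>r - 3\<close> other
  large parts to \<open>2 * r\<close>. So neighbourhoods inside the part are independent.\<close>

lemma large_inner_degree:
  assumes i: "2 \<le> i" "i < r" and x: "x \<in> B i"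
  shows "deg_in (B i) x \<le> a"
proof -
  have "is_indep (nbr i x)"
    unfolding is_indep_def
  proof (intro ballI notI)
    fix y z assume yz: "y \<in> nbr i x" "z \<in> nbr i x" "adj y z"
    then have B3: "x \<in> B i" "y \<in> B i" "z \<in> B i" "adj x y" "adj x z" using x by (auto simp: nbr_def)
    have ne: "x \<noteq> y" "x \<noteq> z" "y \<noteq> z" using B3 yz adj_irrefl by auto
    let ?T = "{x, y, z}"
    define C where "C j = {v \<in> B j. \<forall>u\<in>?T. adj u v}" for j
    have C: "real (card (C j)) \<ge> real (card (B j)) - 9 * e" if "j < 2" for j
    proof -
      have j: "j < r" "j \<noteq> i" using that i by auto
      have "real (card (C j)) \<ge> real (card (B j)) - (\<Sum>u\<in>?T. nondeg_in (B j) u)"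
        unfolding C_def by (rule common_nb) (use finB j in auto)
      moreover have "(\<Sum>u\<in>?T. nondeg_in (B j) u) \<le> 9 * e"
        using nondeg_in_big[OF i j, of x] nondeg_in_big[OF i j, of y] nondeg_in_big[OF i j, of z] B3 ne by simp
      ultimately show ?thesis by linarith
    qed
    let ?C1 = "{v \<in> C 1. nondeg_in rest v \<le> h / 100}"
    have "real (card ?C1) \<ge> real (card (C 1)) - h / 100" by (rule typical_subset) (auto simp: C_def)
    moreover have "real (card (B 1)) \<ge> 2 * h - e" using size01[of 1] by simp
    ultimately have "real (card ?C1) > 0" using C[of 1] e_h h_pos by linarith
    then obtain u where u: "u \<in> ?C1" by (metis card.empty ex_in_conv less_irrefl of_nat_0)
    let ?C0 = "{v \<in> C 0 \<inter> nbr 0 u. nondeg_in rest v \<le> h / 100}"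
    have "u \<in> B 1" using u by (auto simp: C_def)
    then have "deg_in (B 0) u \<ge> h - 4 * e" using deg_in_cross[of 1 u] by simp
    moreover have "card (C 0) + card (nbr 0 u) = card (C 0 \<union> nbr 0 u) + card (C 0 \<inter> nbr 0 u)"
      by (rule card_Un_Int) (use finB r01 in \<open>auto simp: C_def nbr_def\<close>)
    moreover have "card (C 0 \<union> nbr 0 u) \<le> card (B 0)"
      by (rule card_mono) (use finB r01 in \<open>auto simp: C_def nbr_def\<close>)
    ultimately have "real (card (C 0 \<inter> nbr 0 u)) \<ge> h - 13 * e" using C[of 0] card_nbr[of 0 u] by linarith
    moreover have "real (card ?C0) \<ge> real (card (C 0 \<inter> nbr 0 u)) - h / 100"
      by (rule typical_subset) (auto simp: C_def)
    ultimately have "real (card ?C0) \<ge> a" using a_le e_h h_pos by linarith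
    moreover have "?C0 \<subseteq> V" using BV[OF r01(1)] by (auto simp: C_def)
    ultimately obtain v w where vw: "v \<in> ?C0" "w \<in> ?C0" "adj v w" using edge_ex[of ?C0] by auto
    let ?K = "{x, y, z, u, v, w}"
    have adjs: "adj p q" if "p \<in> ?T" "q \<in> {u, v, w}" for p q using that u vw by (auto simp: C_def)
    have uv: "adj u v" "adj u w" using vw by (auto simp: nbr_def)
    have cl: "is_clique ?K"
      using adjs[of x] adjs[of y] adjs[of z] uv vw(3) B3(4,5) yz(3) adj_sym unfolding is_clique_def by blast
    have ne': "p \<noteq> q" if "p \<in> ?T" "q \<in> {u, v, w}" for p q using adjs[OF that] adj_irrefl by auto
    have ne'': "u \<noteq> v" "u \<noteq> w" "v \<noteq> w" using uv vw(3) adj_irrefl by auto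
    have nn: "x \<noteq> u" "x \<noteq> v" "x \<noteq> w" "y \<noteq> u" "y \<noteq> v" "y \<noteq> w" "z \<noteq> u" "z \<noteq> v" "z \<noteq> w"
      by (rule ne'; simp)+
    have cK: "card ?K = 6" using ne ne'' nn by simp
    have "card ?K + 2 * card ({2..<r} - {i}) < 2 * r"
    proof (rule no_extension[OF cl])
      show "?K \<subseteq> V" using B3 u vw BV[of 0] BV[of 1] BV[OF i(2)] r01 by (auto simp: C_def)
      show "(\<Sum>p\<in>?K. nondeg_in (B j) p) \<le> 5 / 2 * h" if j: "j \<in> {2..<r} - {i}" for j
      proof -
        have jr: "2 \<le> j" "j < r" "j \<noteq> i" using j by auto
        have "(\<Sum>p\<in>?K. nondeg_in (B j) p) = nondeg_in (B j) x + nondeg_in (B j) y + nondeg_in (B j) z + nondeg_in (B j) u + nondeg_in (B j) v + nondeg_in (B j) w"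
          using ne ne'' nn by (simp add: add.assoc)
        moreover have "nondeg_in (B j) x \<le> 3 * e" "nondeg_in (B j) y \<le> 3 * e" "nondeg_in (B j) z \<le> 3 * e"
          using nondeg_in_big[OF i jr(2,3)] B3 by auto
        moreover have "nondeg_in (B j) u \<le> h / 100" "nondeg_in (B j) v \<le> h / 100" "nondeg_in (B j) w \<le> h / 100"
          by (rule order_trans[OF nondeg_in_rest[OF jr(1,2)]], use u vw in simp)+
        ultimately show ?thesis using e_h h_pos by linarith
      qed
    qed auto
    moreover have "Suc (card ({2..<r} - {i})) = r - 2" using card_Suc_Diff1[of "{2..<r}" i] i by simp
    ultimately show False using cK by linarith
  qed
  moreover have "nbr i x \<subseteq> V" using BV i by (auto simp: nbr_def)
  ultimately show ?thesis using indep[of "nbr i x"] by (simp add: card_nbr)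
qed

lemma deg_in_le_outside: "i < r \<Longrightarrow> deg_in V x \<le> deg_in (B i) x + real (card V) - real (card (B i))"
proof -
  assume i: "i < r"
  have "deg_in (V - B i) x = deg_in V x - deg_in (B i) x" by (rule deg_in_Diff[OF finite_V BV[OF i]])
  moreover have "deg_in (V - B i) x \<le> real (card (V - B i))" by (rule deg_in_le_card) (simp add: finite_V)
  moreover have "real (card (V - B i)) = real (card V) - real (card (B i))"
    using card_Diff_subset[OF finB BV] i card_mono[OF finite_V BV] by (simp add: of_nat_diff)
  ultimately show ?thesis by linarith
qed

text \<open>What is subtracted is the quadratic form
  \<open>(b 0)\<^sup>2 + (b 1)\<^sup>2 + b 0 * b 1\<close> plus the squares of the other sizes. It
  lies above its tangent at \<open>2 * h\<close>, \<open>2 * h\<close>, \<open>3 * h\<close>, ...,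
  where all partial derivatives equal \<open>6 * h\<close>, so only the total number of vertices
  enters.\<close>

theorem edge_bound:
  "(\<Sum>x\<in>V. deg_in V x) \<le> (real (card V))\<^sup>2 - 3 * h * real (card V) + a * real (card V) - a\<^sup>2"
proof -
  define b where "b i = real (card (B i))" for i
  let ?n = "real (card V)"
  have split: "(\<Sum>i<r. f i) = f 0 + f 1 + (\<Sum>i\<in>{2..<r}. f i)" for f :: "nat \<Rightarrow> real"
  proof -
    have "{..<r} = insert 0 (insert 1 {2..<r})" using r2 by auto
    then show ?thesis by (simp add: add.assoc)
  qed
  have part: "(\<Sum>x\<in>V. f x) = (\<Sum>i<r. \<Sum>x\<in>B i. f x)" for f :: "'a \<Rightarrow> real"
    unfolding B_Un by (rule sum.UNION_disjoint) (use finB B_disj in auto)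
  have nb: "?n = (\<Sum>i<r. b i)" using part[of "\<lambda>_. 1"] by (simp add: b_def)
  define T where "T = (\<Sum>i\<in>{2..<r}. b i)"
  have n_eq: "?n = b 0 + b 1 + T" unfolding nb split T_def ..
  have big: "(\<Sum>x\<in>B i. deg_in V x) \<le> b i * (a + ?n) - (b i)\<^sup>2" if i: "2 \<le> i" "i < r" for i
  proof -
    have "(\<Sum>x\<in>B i. deg_in V x) \<le> (\<Sum>x\<in>B i. a + ?n - b i)"
      using deg_in_le_outside[OF i(2)] large_inner_degree[OF i] by (intro sum_mono) (smt (verit) b_def)
    then show ?thesis by (simp add: b_def power2_eq_square algebra_simps)
  qed
  have small: "(\<Sum>x\<in>B i. deg_in V x) \<le> (b i * b (1 - i) + a * b i + a * b (1 - i) - a\<^sup>2) / 2 + b i * T"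
    if i: "i < 2" for i
  proof -
    note ii = ii[OF i refl]
    have half: "half_graph V adj r a B h e i (1 - i)" by unfold_locales (use i in auto)
    have i01: "i = 0 \<or> i = 1" using i by auto
    have Veq: "V = (B (1 - i) \<union> B i) \<union> rest" "(B (1 - i) \<union> B i) \<inter> rest = {}"
      using rest_eq i01 BV[OF r01(1)] BV[OF r01(2)] by auto
    have "deg_in V x = deg_in (B (1 - i)) x + deg_in (B i) x + deg_in rest x" for x
      using deg_in_Un[of "B (1 - i) \<union> B i" rest x] deg_in_Un[of "B (1 - i)" "B i" x] Veq ii fin_rest B_disj[of "1 - i" i] by auto
    moreover have "real (card rest) = T"
    proof -
      have "card V = card (B (1 - i) \<union> B i) + card rest"
        by (subst Veq(1), rule card_Un_disjoint) (use Veq ii fin_rest in auto)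
      moreover have "card (B (1 - i) \<union> B i) = card (B (1 - i)) + card (B i)"
        by (rule card_Un_disjoint) (use ii B_disj[of "1 - i" i] in auto)
      ultimately show ?thesis using n_eq i01 by (auto simp: b_def)
    qed
    ultimately have "deg_in V x \<le> (deg_in (B (1 - i)) x + deg_in (B i) x) + T" for x
      using deg_in_le_card[OF fin_rest, of x] by simp
    then have "(\<Sum>x\<in>B i. deg_in V x) \<le> (\<Sum>x\<in>B i. (deg_in (B (1 - i)) x + deg_in (B i) x) + T)" by (intro sum_mono)
    also have "\<dots> = (\<Sum>x\<in>B i. deg_in (B (1 - i)) x + deg_in (B i) x) + b i * T"
      by (simp add: sum.distrib b_def)
    finally show ?thesis using half_graph.half_sum[OF half] unfolding b_def by linarith
  qed
  have "(\<Sum>x\<in>V. deg_in V x) \<le> ((b 0 * b 1 + a * b 0 + a * b 1 - a\<^sup>2) / 2 + b 0 * T)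
     + ((b 1 * b 0 + a * b 1 + a * b 0 - a\<^sup>2) / 2 + b 1 * T) + (\<Sum>i\<in>{2..<r}. b i * (a + ?n) - (b i)\<^sup>2)"
    unfolding part split using small[of 0] small[of 1] big
    by (intro add_mono sum_mono) auto
  also have "(\<Sum>i\<in>{2..<r}. b i * (a + ?n) - (b i)\<^sup>2) = T * (a + ?n) - (\<Sum>i\<in>{2..<r}. (b i)\<^sup>2)"
    by (simp add: sum_subtractf sum_distrib_right T_def)
  finally have up: "(\<Sum>x\<in>V. deg_in V x) \<le> b 0 * b 1 + a * ?n - a\<^sup>2 + (b 0 + b 1) * T + T * ?n - (\<Sum>i\<in>{2..<r}. (b i)\<^sup>2)"
    by (simp add: n_eq algebra_simps)
  have "(\<Sum>i\<in>{2..<r}. (b i)\<^sup>2) \<ge> (\<Sum>i\<in>{2..<r}. 6 * h * b i - 9 * h\<^sup>2)"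
  proof (rule sum_mono)
    fix i
    have "0 \<le> (b i - 3 * h)\<^sup>2" by simp
    then show "6 * h * b i - 9 * h\<^sup>2 \<le> (b i)\<^sup>2" by (simp add: power2_eq_square algebra_simps)
  qed
  also have "(\<Sum>i\<in>{2..<r}. 6 * h * b i - 9 * h\<^sup>2) = 6 * h * T - 9 * h\<^sup>2 * (real r - 2)"
    using r2 by (simp add: sum_subtractf sum_distrib_left T_def of_nat_diff)
  finally have sq: "(\<Sum>i\<in>{2..<r}. (b i)\<^sup>2) \<ge> 6 * h * T - 9 * h\<^sup>2 * (real r - 2)" .
  \<comment> \<open>Four times the form in \<open>b 0\<close> and \<open>b 1\<close> is
    \<open>(b 0 - b 1)\<^sup>2 + 3 * (b 0 + b 1)\<^sup>2\<close>.\<close>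
  have "0 \<le> (b 0 - b 1)\<^sup>2 + 3 * (b 0 + b 1 - 4 * h)\<^sup>2" by simp
  then have sq01: "(b 0)\<^sup>2 + (b 1)\<^sup>2 + b 0 * b 1 \<ge> 6 * h * (b 0 + b 1) - 12 * h\<^sup>2"
    by (simp add: power2_eq_square algebra_simps)
  have "3 * h * ?n = 9 * h\<^sup>2 * (real r - 2) + 12 * h\<^sup>2"
    unfolding cardV by (simp add: power2_eq_square algebra_simps)
  moreover have "6 * h * T + 6 * h * (b 0 + b 1) = 6 * h * ?n" by (simp add: n_eq algebra_simps)
  moreover have "b 0 * b 1 + (b 0 + b 1) * T + T * ?n = ?n\<^sup>2 - ((b 0)\<^sup>2 + (b 1)\<^sup>2 + b 0 * b 1)"
    by (simp add: n_eq power2_eq_square algebra_simps)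
  ultimately show ?thesis using up sq sq01 by linarith
qed

end

section \<open>From an approximate to an exact partition\<close>

text \<open>The errors \<open>g \<lless> s \<lless> t \<lless> k \<lless> h\<close> are numbers of vertices, not proportions.\<close>

locale approx_graph = rt_graph +
  fixes A :: "nat \<Rightarrow> 'a set" and h g q s t k n :: real
  assumes n_def: "n = real (card V)"
    and A_sub: "i < r \<Longrightarrow> A i \<subseteq> V"
    and A_disj: "i < r \<Longrightarrow> j < r \<Longrightarrow> i \<noteq> j \<Longrightarrow> A i \<inter> A j = {}"
    and A_cover: "real (card (V - (\<Union>i<r. A i))) \<le> g"
    and A_inner: "i < r \<Longrightarrow> arcs (A i) (A i) \<le> g\<^sup>2"
    and A01: "arcs (A 0) (A 1) \<le> real (card (A 0)) * real (card (A 1)) / 2 + g\<^sup>2"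
    and degree: "v \<in> V \<Longrightarrow> deg_in V v \<ge> n - 3 * h - q"
    and n_eq: "n = (3 * real r - 2) * h"
    and a_le: "a \<le> t"
    and g_pos: "0 < g" and q: "0 \<le> q" "q \<le> g" "q * n \<le> g\<^sup>2"
    and gs: "10 * (real r * g) \<le> s" and st: "1000 * (real r * s) \<le> t"
    and tk: "1000 * (real r * t) \<le> k" and kh: "200000 * (real r * k) \<le> h"
    and st2: "4 * real r * s * n \<le> t\<^sup>2" and tk2: "20 * t * n \<le> k\<^sup>2"
begin

lemma r_ge: "0 \<le> x \<Longrightarrow> 2 * x \<le> real r * x"
  using r2 by (intro mult_right_mono) auto

lemma s_pos: "0 < s" using gs r_ge[of g] g_pos by linarith
lemma t_pos: "0 < t" using st r_ge[of s] s_pos by linarith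
lemma k_pos: "0 < k" using tk r_ge[of t] t_pos by linarith
lemma h_pos: "0 < h" using kh r_ge[of k] k_pos by linarith
lemma gs': "20 * g \<le> s" using gs r_ge[of g] g_pos by linarith
lemma st': "2000 * s \<le> t" using st r_ge[of s] s_pos by linarith
lemma tk': "2000 * t \<le> k" using tk r_ge[of t] t_pos by linarith
lemma kh': "400000 * k \<le> h" using kh r_ge[of k] k_pos by linarith

lemma n_ge: "4 * h \<le> n"
proof -
  have "4 * h \<le> (3 * real r - 2) * h" using r2 h_pos by (intro mult_right_mono) auto
  then show ?thesis by (simp add: n_eq)
qed

lemma n_pos: "0 < n" using n_ge h_pos by linarith

lemma finA: "i < r \<Longrightarrow> finite (A i)" using A_sub fin by blast

lemma cardA_le: "i < r \<Longrightarrow> real (card (A i)) \<le> n"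
  using card_mono[OF finite_V A_sub] n_def by simp

lemma card_Diff_A: "X \<subseteq> V \<Longrightarrow> real (card (V - X)) = n - real (card X)"
  using card_Diff_subset[OF fin, of X V] card_mono[OF finite_V, of X] by (simp add: n_def of_nat_diff)

lemma r01: "0 < r" "1 < r" "i < 2 \<Longrightarrow> i < r" using r2 by auto

lemma A_deg_sum: "i < r \<Longrightarrow> real (card (A i)) * (n - 3 * h - q) \<le> arcs (A i) V"
proof -
  assume i: "i < r"
  have "(\<Sum>x\<in>A i. n - 3 * h - q) \<le> (\<Sum>x\<in>A i. deg_in V x)" using degree A_sub[OF i] by (intro sum_mono) auto
  then show ?thesis by (simp add: arcs_def)
qed

text \<open>On average a vertex of \<open>A i\<close> misses nearly all of \<open>A i\<close>, but
  it may miss only about \<open>3 * h\<close> vertices.\<close>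

lemma A_upper:
  assumes "i < r"
  shows "real (card (A i)) \<le> 3 * h + 2 * g"
proof (rule ccontr)
  let ?x = "real (card (A i))"
  assume H: "\<not> ?thesis"
  have "arcs (A i) V = arcs (A i) (A i \<union> (V - A i))" using A_sub[OF assms] by (simp add: Un_absorb1)
  also have "\<dots> = arcs (A i) (A i) + arcs (A i) (V - A i)"
    by (rule arcs_Un_right) (use finA[OF assms] finite_V in auto)
  also have "\<dots> \<le> g\<^sup>2 + ?x * (n - ?x)"
    using arcs_le_prod[of "V - A i" "A i"] A_inner[OF assms] card_Diff_A[OF A_sub[OF assms]] finite_V by simp
  finally have "?x * (?x - 3 * h - q) \<le> g\<^sup>2" using A_deg_sum[OF assms] by (simp add: algebra_simps)
  moreover have "(2 * g) * g \<le> ?x * (?x - 3 * h - q)"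
    using H g_pos h_pos q by (intro mult_mono) auto
  ultimately show False using mult_pos_pos[OF g_pos g_pos] by (simp add: power2_eq_square)
qed

text \<open>The same count, with half of the opposite part missing too. The total error
  \<open>2 * g\<^sup>2\<close> is divided by the size of the part, which therefore has to be at
  least \<open>g\<close>.\<close>

lemma A01_upper:
  assumes i: "i < 2" and x: "real (card (A i)) \<ge> g"
  shows "real (card (A i)) + real (card (A (1 - i))) / 2 \<le> 3 * h + 4 * g"
proof (rule ccontr)
  let ?x = "real (card (A i))" and ?y = "real (card (A (1 - i)))"
  assume H: "\<not> ?thesis"
  have i01: "i = 0 \<or> i = 1" using i by auto
  have ir: "i < r" "1 - i < r" "i \<noteq> 1 - i" using i01 r01 by auto
  have e01: "arcs (A i) (A (1 - i)) \<le> ?x * ?y / 2 + g\<^sup>2"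
    using A01 i01 arcs_sym[OF finA[OF r01(1)] finA[OF r01(2)]] by (auto simp: mult.commute)
  let ?R = "V - (A i \<union> A (1 - i))"
  have "arcs (A i) V = arcs (A i) ((A i \<union> A (1 - i)) \<union> ?R)"
    using A_sub[OF ir(1)] A_sub[OF ir(2)] by (simp add: Un_absorb1)
  also have "\<dots> = arcs (A i) (A i \<union> A (1 - i)) + arcs (A i) ?R"
    by (rule arcs_Un_right) (use finA[OF ir(1)] finA[OF ir(2)] finite_V in auto)
  also have "arcs (A i) (A i \<union> A (1 - i)) = arcs (A i) (A i) + arcs (A i) (A (1 - i))"
    by (rule arcs_Un_right) (use finA[OF ir(1)] finA[OF ir(2)] A_disj[OF ir] in auto)
  also have "arcs (A i) ?R \<le> ?x * (n - (?x + ?y))"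
  proof -
    have "real (card ?R) = n - (?x + ?y)"
      using card_Diff_A[of "A i \<union> A (1 - i)"] A_sub[OF ir(1)] A_sub[OF ir(2)]
        card_Un_disjoint[OF finA[OF ir(1)] finA[OF ir(2)] A_disj[OF ir]] by simp
    then show ?thesis using arcs_le_prod[of ?R "A i"] finite_V by simp
  qed
  finally have "?x * (?x + ?y / 2 - 3 * h - q) \<le> 2 * g\<^sup>2"
    using A_deg_sum[OF ir(1)] e01 A_inner[OF ir(1)] by (simp add: algebra_simps)
  moreover have "g * (3 * g) \<le> ?x * (?x + ?y / 2 - 3 * h - q)"
    using H x g_pos h_pos q by (intro mult_mono) auto
  ultimately show False using mult_pos_pos[OF g_pos g_pos] by (simp add: power2_eq_square)
qed

lemma sum_split: "(\<Sum>i<r. f i) = f 0 + f 1 + (\<Sum>i\<in>{2..<r}. f i)" for f :: "nat \<Rightarrow> real"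
proof -
  have "{..<r} = insert 0 (insert 1 {2..<r})" using r2 by auto
  then show ?thesis by (simp add: add.assoc)
qed

lemma cardA_sum: "n - g \<le> real (card (A 0)) + real (card (A 1)) + (\<Sum>i\<in>{2..<r}. real (card (A i)))"
proof -
  have "card (\<Union>i<r. A i) = (\<Sum>i<r. card (A i))"
    by (rule card_UN_disjoint) (use finA A_disj in auto)
  then have "real (card (\<Union>i<r. A i)) = (\<Sum>i<r. real (card (A i)))" by simp
  moreover have "(\<Union>i<r. A i) \<subseteq> V" using A_sub by auto
  ultimately show ?thesis using card_Diff_A[of "\<Union>i<r. A i"] A_cover sum_split[of "\<lambda>i. real (card (A i))"] by simp
qed

text \<open>The upper bounds for all parts add up to about \<open>n\<close>, so each is nearly
  attained. First it is checked that neither \<open>A 0\<close> nor \<open>A 1\<close> is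
  negligible: the other one would have about \<open>4 * h\<close> vertices, more than
  \<open>A01_upper\<close> permits.\<close>

lemma A_sizes01:
  "2 * h - s \<le> real (card (A 0))" "real (card (A 0)) \<le> 2 * h + s"
  "2 * h - s \<le> real (card (A 1))" "real (card (A 1)) \<le> 2 * h + s"
  "real (card (A 0)) + real (card (A 1)) \<le> 4 * h + 6 * g"
proof -
  let ?x = "real (card (A 0))" and ?y = "real (card (A 1))"
  have "(\<Sum>i\<in>{2..<r}. real (card (A i))) \<le> (\<Sum>i\<in>{2..<r}. 3 * h + 2 * g)"
    by (intro sum_mono A_upper) auto
  also have "\<dots> = (real r - 2) * (3 * h + 2 * g)" using r2 by (simp add: of_nat_diff)
  finally have "n - g \<le> ?x + ?y + (real r - 2) * (3 * h + 2 * g)" using cardA_sum by linarith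
  then have u: "?x + ?y \<ge> 4 * h - 2 * (real r * g)" using g_pos by (simp add: n_eq algebra_simps)
  have rg: "10 * (real r * g) \<le> s" "2 * g \<le> real r * g" using gs r_ge[of g] g_pos by auto
  have small: "s \<le> h / 1000" using st' tk' kh' k_pos t_pos s_pos by linarith
  have xg: "?x \<ge> g"
  proof (rule ccontr)
    assume "\<not> ?thesis"
    then have "?y \<ge> g" using u rg small h_pos g_pos by linarith
    then have "?y + ?x / 2 \<le> 3 * h + 4 * g" using A01_upper[of 1] by simp
    with \<open>\<not> g \<le> ?x\<close> show False using u rg small h_pos g_pos by linarith
  qed
  have yg: "?y \<ge> g"
  proof (rule ccontr)
    assume "\<not> ?thesis"
    moreover from this have "?x + ?y / 2 \<le> 3 * h + 4 * g" using A01_upper[of 0] xg by simp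
    ultimately show False using u rg small h_pos g_pos by linarith
  qed
  have "?x + ?y / 2 \<le> 3 * h + 4 * g" "?y + ?x / 2 \<le> 3 * h + 4 * g"
    using A01_upper[of 0] A01_upper[of 1] xg yg by simp_all
  then show "2 * h - s \<le> ?x" "?x \<le> 2 * h + s" "2 * h - s \<le> ?y" "?y \<le> 2 * h + s" "?x + ?y \<le> 4 * h + 6 * g"
    using u rg g_pos by linarith+
qed

lemma A_sizes2:
  assumes i: "2 \<le> i" "i < r"
  shows "3 * h - s \<le> real (card (A i))" "real (card (A i)) \<le> 3 * h + s"
proof -
  show "real (card (A i)) \<le> 3 * h + s" using A_upper[OF i(2)] gs' g_pos by linarith
  have "(\<Sum>j\<in>{2..<r}. real (card (A j))) = real (card (A i)) + (\<Sum>j\<in>{2..<r} - {i}. real (card (A j)))"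
    by (rule sum.remove) (use i in auto)
  also have "(\<Sum>j\<in>{2..<r} - {i}. real (card (A j))) \<le> (\<Sum>j\<in>{2..<r} - {i}. 3 * h + 2 * g)"
    by (intro sum_mono A_upper) auto
  also have "\<dots> = (real r - 3) * (3 * h + 2 * g)"
  proof -
    have "Suc (card ({2..<r} - {i})) = r - 2" using card_Suc_Diff1[of "{2..<r}" i] i by simp
    then have "real (card ({2..<r} - {i})) = real r - 3" using i by linarith
    then show ?thesis by simp
  qed
  finally have "n - g \<le> 4 * h + 6 * g + real (card (A i)) + (real r - 3) * (3 * h + 2 * g)"
    using cardA_sum A_sizes01(5) by linarith
  then have "real (card (A i)) \<ge> 3 * h - g - 2 * (real r * g)" using g_pos by (simp add: n_eq algebra_simps)
  then show "3 * h - s \<le> real (card (A i))" using gs r_ge[of g] g_pos by linarith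
qed

lemma A_ge: "i < r \<Longrightarrow> real (card (A i)) \<ge> 2 * h - s"
proof -
  assume "i < r"
  then consider "i = 0" | "i = 1" | "2 \<le> i" "i < r" by linarith
  then show ?thesis using A_sizes01 A_sizes2(1)[of i] h_pos by cases auto
qed

lemma nondeg_in_sum_large:
  assumes i: "2 \<le> i" "i < r"
  shows "(\<Sum>x\<in>A i. nondeg_in (V - A i) x) \<le> 2 * s * n"
proof -
  let ?x = "real (card (A i))"
  have "nondeg_in (V - A i) x = (n - ?x) - (deg_in V x - deg_in (A i) x)" for x
    using deg_in_nondeg_in[of "V - A i" x] deg_in_Diff[OF finite_V A_sub[OF i(2)]] card_Diff_A[OF A_sub[OF i(2)]] finite_V by simp
  then have "(\<Sum>x\<in>A i. nondeg_in (V - A i) x) = ?x * (n - ?x) - (arcs (A i) V - arcs (A i) (A i))"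
    by (simp add: sum_subtractf arcs_def)
  also have "\<dots> \<le> ?x * (3 * h - ?x + q) + g\<^sup>2"
    using A_deg_sum[OF i(2)] A_inner[OF i(2)] by (simp add: algebra_simps)
  also have "\<dots> \<le> ?x * (s + q) + g\<^sup>2"
    using A_sizes2[OF i] by (intro add_right_mono mult_left_mono) auto
  also have "\<dots> \<le> n * (s + q) + g\<^sup>2"
    using cardA_le[OF i(2)] s_pos q by (intro add_right_mono mult_right_mono) auto
  also have "\<dots> \<le> 2 * s * n"
  proof -
    have "g * g \<le> g * n" using gs' st' tk' kh' n_ge k_pos t_pos s_pos h_pos g_pos by (intro mult_left_mono) linarith+
    moreover have "g * n \<le> s / 20 * n" using gs' n_pos by (intro mult_right_mono) auto
    moreover have "q * n \<le> g * n" using q n_pos by (intro mult_right_mono) auto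
    moreover have "0 \<le> g * n" using g_pos n_pos by simp
    ultimately show ?thesis by (simp add: power2_eq_square algebra_simps)
  qed
  finally show ?thesis .
qed

lemma nondeg_in_sum:
  assumes ij: "i < r" "j < r" "i \<noteq> j" "2 \<le> i \<or> 2 \<le> j"
  shows "(\<Sum>x\<in>A i. nondeg_in (A j) x) \<le> 2 * s * n"
proof -
  have *: "(\<Sum>x\<in>A i. nondeg_in (A j) x) \<le> 2 * s * n" if "i < r" "j < r" "i \<noteq> j" "2 \<le> i" for i j
  proof -
    have "(\<Sum>x\<in>A i. nondeg_in (A j) x) \<le> (\<Sum>x\<in>A i. nondeg_in (V - A i) x)"
    proof (intro sum_mono nondeg_in_mono)
      show "A j \<subseteq> V - A i" using A_sub[OF that(2)] A_disj[OF that(1,2,3)] by blast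
      show "finite (V - A i)" using finite_V by simp
    qed
    then show ?thesis using nondeg_in_sum_large[OF that(4,1)] by linarith
  qed
  show ?thesis
  proof (cases "2 \<le> i")
    case True then show ?thesis using * ij by blast
  next
    case False
    then show ?thesis using *[of j i] ij nondeg_in_sum_swap[OF finA[OF ij(1)] finA[OF ij(2)]] by simp
  qed
qed

text \<open>The vertices that behave as in the extremal graph towards each part. Nothing is demanded
  between \<open>A 0\<close> and \<open>A 1\<close>, where only a density is under control.\<close>

definition core :: "nat \<Rightarrow> 'a set" where
  "core i = {x \<in> A i. deg_in (A i) x \<le> t \<and> (\<forall>j<r. j \<noteq> i \<longrightarrow> 2 \<le> i \<or> 2 \<le> j \<longrightarrow> nondeg_in (A j) x \<le> t)}"

lemma core_sub: "core i \<subseteq> A i" by (auto simp: core_def)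

lemma atypical_card:
  assumes i: "i < r"
  shows "real (card (A i - core i)) \<le> t"
proof -
  let ?D = "{x \<in> A i. deg_in (A i) x > t}"
  let ?J = "{j. j < r \<and> j \<noteq> i \<and> (2 \<le> i \<or> 2 \<le> j)}"
  let ?M = "\<lambda>j. {x \<in> A i. nondeg_in (A j) x > t}"
  have fJ: "finite ?J" "card ?J \<le> r" using card_mono[of "{..<r}" ?J] by auto
  have f: "finite (A i)" by (rule finA[OF i])
  have "A i - core i \<subseteq> ?D \<union> (\<Union>j\<in>?J. ?M j)" by (auto simp: core_def not_le)
  then have "card (A i - core i) \<le> card (?D \<union> (\<Union>j\<in>?J. ?M j))" by (rule card_mono[rotated]) (use f fJ in auto)
  also have "\<dots> \<le> card ?D + card (\<Union>j\<in>?J. ?M j)" by (rule card_Un_le)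
  also have "card (\<Union>j\<in>?J. ?M j) \<le> (\<Sum>j\<in>?J. card (?M j))" by (rule card_UN_le[OF fJ(1)])
  finally have "card (A i - core i) \<le> card ?D + (\<Sum>j\<in>?J. card (?M j))" by simp
  then have "real (card (A i - core i)) \<le> real (card ?D + (\<Sum>j\<in>?J. card (?M j)))" by (rule of_nat_mono)
  then have "t * real (card (A i - core i)) \<le> t * (real (card ?D) + (\<Sum>j\<in>?J. real (card (?M j))))"
    using t_pos by (intro mult_left_mono) auto
  also have "\<dots> = t * real (card ?D) + (\<Sum>j\<in>?J. t * real (card (?M j)))"
    by (simp add: distrib_left sum_distrib_left)
  also have "t * real (card ?D) \<le> arcs (A i) (A i)" unfolding arcs_def by (rule markov[OF f]) simp
  also have "(\<Sum>j\<in>?J. t * real (card (?M j))) \<le> (\<Sum>j\<in>?J. 2 * s * n)"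
  proof (rule sum_mono)
    fix j assume "j \<in> ?J"
    then have "(\<Sum>x\<in>A i. nondeg_in (A j) x) \<le> 2 * s * n" using nondeg_in_sum[OF i] by auto
    moreover have "t * real (card (?M j)) \<le> (\<Sum>x\<in>A i. nondeg_in (A j) x)" by (rule markov[OF f]) simp
    ultimately show "t * real (card (?M j)) \<le> 2 * s * n" by linarith
  qed
  also have "(\<Sum>j\<in>?J. 2 * s * n) \<le> real r * (2 * s * n)"
    using fJ s_pos n_pos by (simp add: mult_right_mono)
  also have "arcs (A i) (A i) + real r * (2 * s * n) \<le> t * t"
  proof -
    have "g * g \<le> s * n"
      using gs' st' tk' kh' n_ge k_pos t_pos s_pos h_pos g_pos by (intro mult_mono) linarith+
    moreover have "real r * (2 * s * n) = 2 * (real r * (s * n))" by simp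
    moreover have "0 < s * n" using s_pos n_pos by simp
    ultimately have "g\<^sup>2 \<le> real r * (2 * s * n)" using r_ge[of "s * n"] by (simp add: power2_eq_square)
    then show ?thesis using A_inner[OF i] st2 by (simp add: power2_eq_square algebra_simps)
  qed
  finally show ?thesis using t_pos by simp
qed

lemma core_card: "X \<subseteq> A i \<Longrightarrow> i < r \<Longrightarrow> real (card (X \<inter> core i)) \<ge> real (card X) - t"
proof -
  assume X: "X \<subseteq> A i" "i < r"
  have f: "finite (A i)" "finite X" using finA X finite_subset by blast+
  have "card X = card ((X \<inter> core i) \<union> (X - core i))" by (rule arg_cong[where f=card]) auto
  also have "\<dots> \<le> card (X \<inter> core i) + card (X - core i)" by (rule card_Un_le)
  also have "card (X - core i) \<le> card (A i - core i)" by (rule card_mono) (use f X in auto)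
  finally show ?thesis using atypical_card[OF X(2)] by linarith
qed

text \<open>Between cores every vertex misses at most \<open>t\<close>, so
  \<open>extend_bound\<close> finds an edge in each of the \<open>r - 2\<close> large parts wherever
  \<open>K\<close> leaves enough room.\<close>

lemma no_extension:
  assumes K: "is_clique K" "K \<subseteq> V" and Y: "\<And>j. 2 \<le> j \<Longrightarrow> j < r \<Longrightarrow> Y j \<subseteq> core j"
    and m: "\<And>j. 2 \<le> j \<Longrightarrow> j < r \<Longrightarrow> real (card (Y j)) - (\<Sum>z\<in>K. nondeg_in (Y j) z) \<ge> 3 * (real r * t)"
  shows "card K < 4"
proof -
  have "card K + 2 * card {2..<r} < 2 * r"
  proof (rule extend_bound[OF K, of "{2..<r}" Y t])
    show "Y j \<subseteq> V" if "j \<in> {2..<r}" for j using Y[of j] core_sub[of j] A_sub[of j] that by auto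
    show "a + 2 * real (card {2..<r}) * t \<le> real (card (Y j)) - (\<Sum>z\<in>K. nondeg_in (Y j) z)" if j: "j \<in> {2..<r}" for j
    proof -
      have "real (card {2..<r}) * t \<le> real r * t" using t_pos by (intro mult_right_mono) auto
      moreover have "3 * (real r * t) \<le> real (card (Y j)) - (\<Sum>z\<in>K. nondeg_in (Y j) z)" using m[of j] j by auto
      ultimately show ?thesis using a_le r_ge[of t] t_pos by linarith
    qed
    show "nondeg_in (Y j) x \<le> t" if ij: "i \<in> {2..<r}" "j \<in> {2..<r}" "i \<noteq> j" "x \<in> Y i" for i j x
    proof -
      have "nondeg_in (Y j) x \<le> nondeg_in (A j) x"
        by (rule nondeg_in_mono) (use Y[of j] core_sub[of j] ij finA in auto)
      also have "\<dots> \<le> t" using Y[of i] ij by (auto simp: core_def)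
      finally show ?thesis .
    qed
  qed (use t_pos in auto)
  then show ?thesis using r2 by simp
qed

lemma nondeg_in_core:
  assumes "x \<in> core i" "i < r" "j < r" "j \<noteq> i" "2 \<le> i \<or> 2 \<le> j" "Y \<subseteq> A j"
  shows "nondeg_in Y x \<le> t"
  using nondeg_in_mono[OF assms(6) finA[OF assms(3)], of x] assms(1-5) by (auto simp: core_def)

lemma no_typical_K4:
  assumes "x \<in> core 0" "x' \<in> core 0" "y \<in> core 1" "y' \<in> core 1"
    "adj x x'" "adj y y'" "adj x y" "adj x y'" "adj x' y" "adj x' y'"
  shows False
proof -
  let ?K = "{x, x', y, y'}"
  have ne: "x \<noteq> x'" "y \<noteq> y'" "x \<noteq> y" "x \<noteq> y'" "x' \<noteq> y" "x' \<noteq> y'"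
    using assms(5-10) adj_irrefl by auto
  have "is_clique ?K" using assms(5-10) adj_sym unfolding is_clique_def by blast
  moreover have "?K \<subseteq> V" using assms(1-4) core_sub A_sub r01 by blast
  ultimately have "card ?K < 4"
  proof (rule no_extension[where Y = core])
    show "core j \<subseteq> core j" for j ..
    fix j assume j: "2 \<le> j" "j < r"
    have "(\<Sum>z\<in>?K. nondeg_in (core j) z) = nondeg_in (core j) x + nondeg_in (core j) x' + nondeg_in (core j) y + nondeg_in (core j) y'"
      using ne by (simp add: add.assoc)
    also have "\<dots> \<le> t + t + t + t"
      using assms(1-4) j r01 core_sub by (intro add_mono nondeg_in_core[of _ 0] nondeg_in_core[of _ 1]) auto
    finally have "(\<Sum>z\<in>?K. nondeg_in (core j) z) \<le> 4 * t" by simp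
    moreover have "real (card (core j)) \<ge> 3 * h - s - t"
      using core_card[of "A j" j] j A_sizes2[OF j] core_sub[of j] by (simp add: Int_absorb1)
    ultimately show "3 * (real r * t) \<le> real (card (core j)) - (\<Sum>z\<in>?K. nondeg_in (core j) z)"
      using tk st' tk' kh' s_pos t_pos k_pos by linarith
  qed
  then show False using ne by simp
qed

text \<open>Assumption \<open>A01\<close> concerns the whole pair, whereas
  \<open>sparse_part_exists\<close> needs the bound for subsets. Two adjacent typical vertices that
  both see more than half of \<open>Y\<close>, by the margin \<open>t\<close>, have enough common
  neighbours to span an edge between typical ones, against \<open>no_typical_K4\<close>.\<close>

lemma half_density:
  assumes X: "X \<subseteq> A 0" and Y: "Y \<subseteq> A 1"
  shows "arcs X Y \<le> real (card X) * real (card Y) / 2 + 3 * t * n"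
proof -
  let ?y = "real (card Y)"
  have f: "finite X" "finite Y" using X Y finA r01 finite_subset by blast+
  have XV: "X \<subseteq> V" "Y \<subseteq> V" using X Y A_sub r01 by blast+
  have le_n: "real (card X) \<le> n" "?y \<le> n" using XV card_mono[OF finite_V] n_def by auto
  define H where "H = {x \<in> X \<inter> core 0. deg_in Y x > ?y / 2 + t}"
  have "is_indep H"
    unfolding is_indep_def
  proof (intro ballI notI)
    fix x x' assume x: "x \<in> H" "x' \<in> H" "adj x x'"
    let ?C = "{y \<in> Y. \<forall>z\<in>{x, x'}. adj z y}"
    have "x \<noteq> x'" using x adj_irrefl by auto
    then have "real (card ?C) \<ge> ?y - (nondeg_in Y x + nondeg_in Y x')" using common_nb[of "{x, x'}" Y] f by simp
    then have "real (card ?C) \<ge> 2 * t" using deg_in_nondeg_in[OF f(2), of x] deg_in_nondeg_in[OF f(2), of x'] x by (auto simp: H_def)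
    then have "real (card (?C \<inter> core 1)) \<ge> a" using core_card[of ?C 1] Y r01 a_le by force
    moreover have "?C \<inter> core 1 \<subseteq> V" using XV by auto
    ultimately obtain y y' where y: "y \<in> ?C \<inter> core 1" "y' \<in> ?C \<inter> core 1" "adj y y'"
      using edge_ex[of "?C \<inter> core 1"] by blast
    then show False using no_typical_K4[of x x' y y'] x by (auto simp: H_def)
  qed
  then have cH: "real (card H) < a" using XV by (intro indep) (auto simp: H_def)
  have "arcs X Y \<le> (\<Sum>x\<in>X. (?y / 2 + t) + ?y * of_bool (x \<in> H) + ?y * of_bool (x \<in> X - core 0))"
    unfolding arcs_def
  proof (rule sum_mono)
    fix x assume x: "x \<in> X"
    show "deg_in Y x \<le> (?y / 2 + t) + ?y * of_bool (x \<in> H) + ?y * of_bool (x \<in> X - core 0)"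
      using deg_in_le_card[OF f(2), of x] x t_pos by (cases "x \<in> core 0"; cases "x \<in> H") (auto simp: H_def)
  qed
  also have "\<dots> = real (card X) * (?y / 2 + t) + ?y * (\<Sum>x\<in>X. of_bool (x \<in> H)) + ?y * (\<Sum>x\<in>X. of_bool (x \<in> X - core 0))"
    by (simp only: sum.distrib sum_distrib_left[symmetric] sum_constant distrib_left)
  also have "(\<Sum>x\<in>X. of_bool (x \<in> H)) = real (card H)"
    using f by (simp add: H_def Int_def)
  also have "(\<Sum>x\<in>X. of_bool (x \<in> X - core 0)) = real (card (X - core 0))"
    using f by (simp add: Int_def set_diff_eq)
  also have "real (card X) * (?y / 2 + t) + ?y * real (card H) + ?y * real (card (X - core 0))
    \<le> real (card X) * (?y / 2) + n * t + n * t + n * t"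
  proof -
    have "card (X - core 0) \<le> card (A 0 - core 0)" by (rule card_mono) (use X finA r01 in auto)
    then have "real (card (X - core 0)) \<le> t" using atypical_card[OF r01(1)] by linarith
    then have "?y * real (card (X - core 0)) \<le> n * t" "?y * real (card H) \<le> n * t" "real (card X) * t \<le> n * t"
      using le_n t_pos n_pos cH a_le by (intro mult_mono; simp)+
    then show ?thesis by (simp add: distrib_left)
  qed
  finally show ?thesis by (simp add: algebra_simps)
qed

lemma cross_degree:
  assumes i: "i < 2" and x: "x \<in> A i"
  shows "deg_in (A (1 - i)) x \<ge> h - 3 * s - deg_in (A i) x"
proof -
  have i01: "i = 0 \<or> i = 1" using i by auto
  have ir: "i < r" "1 - i < r" "i \<noteq> 1 - i" using i01 r01 by auto
  note fi = finA[OF ir(1)] finA[OF ir(2)]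
  let ?U = "A i \<union> A (1 - i)"
  have U: "?U \<subseteq> V" using A_sub[OF ir(1)] A_sub[OF ir(2)] by auto
  have "deg_in (V - ?U) x = deg_in V x - deg_in ?U x" by (rule deg_in_Diff[OF finite_V U])
  moreover have "deg_in ?U x = deg_in (A i) x + deg_in (A (1 - i)) x" by (rule deg_in_Un[OF fi A_disj[OF ir]])
  moreover have "deg_in (V - ?U) x \<le> real (card (V - ?U))" by (rule deg_in_le_card) (simp add: finite_V)
  moreover have "real (card (V - ?U)) = n - (real (card (A i)) + real (card (A (1 - i))))"
    using card_Diff_A[OF U] card_Un_disjoint[OF fi A_disj[OF ir]] by simp
  moreover have "real (card (A i)) + real (card (A (1 - i))) \<ge> 4 * h - 2 * s"
    using A_ge[OF ir(1)] A_ge[OF ir(2)] by linarith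
  moreover have "deg_in V x \<ge> n - 3 * h - q" using degree x A_sub[OF ir(1)] by auto
  ultimately show ?thesis using q gs' g_pos by linarith
qed

text \<open>Suppose that \<open>v\<close> has \<open>k\<close> neighbours in every part. There are
  few edges between \<open>N 0\<close> and \<open>N 1\<close>, since \<open>v\<close>, a vertex of
  \<open>N 1\<close> and an edge in \<open>N 0\<close> would extend too far. But vertices of
  \<open>N 0\<close> need about half of \<open>A 1\<close> as neighbours, and
  \<open>half_density\<close> gives them no surplus outside \<open>N 1\<close>; the deficit of about
  half of \<open>card (N 0) * card (N 1)\<close>, at least \<open>k\<^sup>2 / 2\<close>, is too
  large for the errors.\<close>

lemma sparse_part_exists:
  assumes v: "v \<in> V"
  shows "\<exists>i<r. deg_in (A i) v < k"
proof (rule ccontr)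
  assume "\<not> ?thesis"
  then have big: "deg_in (A i) v \<ge> k" if "i < r" for i using that by force
  define N where "N i = {y \<in> A i. adj v y}" for i
  have cN: "real (card (N i)) = deg_in (A i) v" for i by (simp add: N_def deg_in_def)
  have NA: "N i \<subseteq> A i" for i by (auto simp: N_def)
  have fN: "finite (N i)" if "i < r" for i using NA finA[OF that] finite_subset by blast
  define P0 where "P0 = N 0 \<inter> core 0"
  have P1: "deg_in P0 z < a" if z: "z \<in> N 1 \<inter> core 1" for z
  proof (rule ccontr)
    assume "\<not> ?thesis"
    then have "real (card {x \<in> P0. adj z x}) \<ge> a" by (simp add: deg_in_def)
    moreover have "{x \<in> P0. adj z x} \<subseteq> V" using A_sub[OF r01(1)] by (auto simp: P0_def N_def)
    ultimately obtain x x' where x: "x \<in> {x \<in> P0. adj z x}" "x' \<in> {x \<in> P0. adj z x}" "adj x x'"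
      using edge_ex[of "{x \<in> P0. adj z x}"] by blast
    let ?K = "{v, z, x, x'}"
    have adjs: "adj v z" "adj v x" "adj v x'" "adj z x" "adj z x'" "adj x x'" using x z by (auto simp: P0_def N_def)
    then have ne: "v \<noteq> z" "v \<noteq> x" "v \<noteq> x'" "z \<noteq> x" "z \<noteq> x'" "x \<noteq> x'" using adj_irrefl by auto
    have "is_clique ?K" using adjs adj_sym unfolding is_clique_def by blast
    moreover have "?K \<subseteq> V" using v x z A_sub[OF r01(1)] A_sub[OF r01(2)] by (auto simp: P0_def N_def)
    ultimately have "card ?K < 4"
    proof (rule no_extension[where Y = "\<lambda>j. N j \<inter> core j"])
      show "N j \<inter> core j \<subseteq> core j" for j by simp
      fix j assume j: "2 \<le> j" "j < r"
      let ?Y = "N j \<inter> core j"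
      have YA: "?Y \<subseteq> A j" using NA by auto
      \<comment> \<open>The vertex \<open>v\<close> may be atypical, but \<open>?Y\<close> lies
        inside its neighbourhood, so \<open>v\<close> costs nothing.\<close>
      have "{y \<in> ?Y. \<not> adj v y} = {}" by (auto simp: N_def)
      then have "nondeg_in ?Y v = 0" by (simp only: nondeg_in_def card.empty of_nat_0)
      moreover have "nondeg_in ?Y z \<le> t" by (rule nondeg_in_core[of _ 1 j]) (use z j r01 YA in auto)
      moreover have "nondeg_in ?Y x \<le> t" by (rule nondeg_in_core[of _ 0 j]) (use x j r01 YA in \<open>auto simp: P0_def\<close>)
      moreover have "nondeg_in ?Y x' \<le> t" by (rule nondeg_in_core[of _ 0 j]) (use x j r01 YA in \<open>auto simp: P0_def\<close>)
      moreover have "(\<Sum>z\<in>?K. nondeg_in ?Y z) = nondeg_in ?Y v + nondeg_in ?Y z + nondeg_in ?Y x + nondeg_in ?Y x'"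
        using ne by (simp add: add.assoc)
      moreover have "real (card ?Y) \<ge> k - t" using core_card[OF NA j(2)] cN[of j] big[OF j(2)] by linarith
      ultimately show "3 * (real r * t) \<le> real (card ?Y) - (\<Sum>z\<in>?K. nondeg_in ?Y z)"
        using tk tk' r_ge[of t] t_pos by linarith
    qed
    then show False using ne by simp
  qed
  have N0: "real (card (N 0)) \<le> n" "real (card (N 1)) \<le> n"
    using NA A_sub r01 card_mono[OF finite_V] n_def by (meson of_nat_mono order_trans)+
  have "arcs (N 0) (N 1) = arcs (N 1) (N 0)" by (rule arcs_sym) (use fN r01 in auto)
  also have "\<dots> \<le> (\<Sum>z\<in>N 1. a + t + n * of_bool (z \<in> N 1 - core 1))"
    unfolding arcs_def
  proof (rule sum_mono)
    fix z assume z: "z \<in> N 1"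
    show "deg_in (N 0) z \<le> a + t + n * of_bool (z \<in> N 1 - core 1)"
    proof (cases "z \<in> core 1")
      case True
      have "deg_in (N 0) z = deg_in P0 z + deg_in (N 0 - core 0) z"
        using deg_in_Un[of P0 "N 0 - core 0" z] fN[OF r01(1)] by (simp add: P0_def Int_Diff_Un Diff_Int_distrib Int_Diff)
      moreover have "deg_in (N 0 - core 0) z \<le> t"
      proof -
        have "deg_in (N 0 - core 0) z \<le> real (card (N 0 - core 0))" by (rule deg_in_le_card) (use fN r01 in auto)
        also have "card (N 0 - core 0) \<le> card (A 0 - core 0)" by (rule card_mono) (use NA finA r01 in auto)
        finally show ?thesis using atypical_card[OF r01(1)] by simp
      qed
      ultimately show ?thesis using P1[of z] z True by simp
    next
      case False
      then show ?thesis using z deg_in_le_card[OF fN[OF r01(1)], of z] N0 a_pos t_pos by simp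
    qed
  qed
  also have "\<dots> = real (card (N 1)) * (a + t) + n * real (card (N 1 - core 1))"
    using fN[OF r01(2)] by (simp add: sum.distrib sum_distrib_left[symmetric] Int_def set_diff_eq)
  also have "\<dots> \<le> n * (a + t) + n * t"
  proof -
    have "card (N 1 - core 1) \<le> card (A 1 - core 1)" by (rule card_mono) (use NA finA r01 in auto)
    then have "real (card (N 1 - core 1)) \<le> t" using atypical_card[OF r01(2)] by linarith
    then show ?thesis using N0 a_pos t_pos n_pos by (intro add_mono mult_mono) auto
  qed
  also have "\<dots> \<le> 3 * t * n" using mult_left_mono[OF a_le, of n] n_pos by (simp add: algebra_simps)
  finally have e1: "arcs (N 0) (N 1) \<le> 3 * t * n" .
  have e2: "arcs (N 0) (A 1 - N 1) \<le> real (card (N 0)) * (real (card (A 1)) - real (card (N 1))) / 2 + 3 * t * n"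
  proof -
    have "real (card (A 1 - N 1)) = real (card (A 1)) - real (card (N 1))"
      using card_Diff_subset[OF fN[OF r01(2)] NA] card_mono[OF finA[OF r01(2)] NA] by (simp add: of_nat_diff)
    then show ?thesis using half_density[OF NA[of 0], of "A 1 - N 1"] by simp
  qed
  have e3: "arcs (N 0) (A 1) = arcs (N 0) (N 1) + arcs (N 0) (A 1 - N 1)"
    using arcs_Un_right[of "N 1" "A 1 - N 1" "N 0"] fN[OF r01(2)] finA[OF r01(2)] NA[of 1] by (simp add: Un_absorb1)
  have "(\<Sum>x\<in>N 0. h - 3 * s - deg_in (A 0) x) \<le> arcs (N 0) (A 1)"
    unfolding arcs_def using cross_degree[of 0] NA[of 0] by (intro sum_mono) auto
  moreover have "(\<Sum>x\<in>N 0. deg_in (A 0) x) \<le> g\<^sup>2"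
  proof -
    have "(\<Sum>x\<in>N 0. deg_in (A 0) x) \<le> arcs (A 0) (A 0)"
      unfolding arcs_def by (rule sum_mono2) (use NA finA r01 in auto)
    then show ?thesis using A_inner[OF r01(1)] by linarith
  qed
  ultimately have e4: "real (card (N 0)) * (h - 3 * s) - g\<^sup>2 \<le> arcs (N 0) (A 1)"
    by (simp add: sum_subtractf)
  define c P where "c = real (card (N 0))" and "P = real (card (N 0)) * real (card (N 1))"
  have "c * real (card (A 1)) \<le> c * (2 * h + s)"
    using A_sizes01(4) by (intro mult_left_mono) (auto simp: c_def)
  then have "c * real (card (A 1)) \<le> 2 * (c * h) + c * s" by (simp add: distrib_left)
  moreover have "arcs (N 0) (A 1 - N 1) \<le> (c * real (card (A 1)) - P) / 2 + 3 * t * n"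
    using e2 by (simp add: c_def P_def right_diff_distrib)
  moreover have "c * h - 3 * (c * s) - g\<^sup>2 \<le> arcs (N 0) (A 1)"
    using e4 by (simp add: c_def right_diff_distrib)
  ultimately have "P / 2 \<le> 7 / 2 * (c * s) + g\<^sup>2 + 6 * t * n"
    using e1 e3 by (simp add: field_simps)
  then have "real (card (N 0)) * real (card (N 1)) / 2 \<le> real (card (N 0)) * (7 / 2 * s) + g\<^sup>2 + 6 * t * n"
    by (simp add: c_def P_def)
  also have "\<dots> \<le> n * (7 / 2 * s) + n * s + 6 * t * n"
  proof -
    have "g * g \<le> n * s"
      using gs' st' tk' kh' n_ge k_pos t_pos s_pos h_pos g_pos by (intro mult_mono) linarith+
    moreover have "real (card (N 0)) * (7 / 2 * s) \<le> n * (7 / 2 * s)" using N0 s_pos by (intro mult_right_mono) auto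
    ultimately show ?thesis by (simp add: power2_eq_square)
  qed
  also have "\<dots> \<le> 7 * t * n"
  proof -
    have "9 / 2 * s \<le> t" using st' s_pos by linarith
    from mult_left_mono[OF this, of n] n_pos show ?thesis by (simp add: algebra_simps)
  qed
  finally have "real (card (N 0)) * real (card (N 1)) \<le> 14 * t * n" by simp
  moreover have "k * k \<le> real (card (N 0)) * real (card (N 1))"
    using big r01 cN k_pos by (intro mult_mono) auto
  ultimately have "20 * t * n \<le> 14 * t * n" using tk2 unfolding power2_eq_square by linarith
  then show False using mult_pos_pos[OF n_pos t_pos] by simp
qed

text \<open>Every vertex is assigned to a part in which it has few neighbours. Core vertices have
  many neighbours in all other parts and keep their place, so the parts hardly change, while inner
  degrees become small at every vertex and not only on average.\<close>

theorem approx_edge_bound: "(\<Sum>x\<in>V. deg_in V x) \<le> n\<^sup>2 - 3 * h * n + a * n - a\<^sup>2"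
proof -
  define \<beta> where "\<beta> v = (SOME i. i < r \<and> deg_in (A i) v < k)" for v
  have \<beta>: "\<beta> v < r" "deg_in (A (\<beta> v)) v < k" if "v \<in> V" for v
    using someI_ex[OF sparse_part_exists[OF that]] by (auto simp: \<beta>_def)
  define B where "B i = {v \<in> V. \<beta> v = i}" for i
  have coreB: "core i \<subseteq> B i" if i: "i < r" for i
  proof
    fix v assume v: "v \<in> core i"
    then have vA: "v \<in> A i" and vV: "v \<in> V" using core_sub A_sub[OF i] by auto
    have "\<beta> v = i"
    proof (rule ccontr)
      let ?j = "\<beta> v"
      assume ne: "?j \<noteq> i"
      have j: "?j < r" using \<beta> vV by blast
      have "deg_in (A ?j) v \<ge> k"
      proof (cases "2 \<le> i \<or> 2 \<le> ?j")
        case True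
        then have "nondeg_in (A ?j) v \<le> t" using nondeg_in_core[OF v i j ne True] by simp
        then show ?thesis using deg_in_nondeg_in[OF finA[OF j], of v] A_ge[OF j] st' tk' kh' s_pos t_pos k_pos by linarith
      next
        case False
        then have "?j = 1 - i" "i < 2" using ne by auto
        moreover have "deg_in (A i) v \<le> t" using v by (simp add: core_def)
        ultimately show ?thesis using cross_degree[of i v] vA st' tk' kh' s_pos t_pos k_pos by simp
      qed
      then show False using \<beta>(2)[OF vV] by linarith
    qed
    then show "v \<in> B i" using vV by (simp add: B_def)
  qed
  define W where "W = V - (\<Union>i<r. core i)"
  have W: "real (card W) \<le> 2 * (real r * t)"
  proof -
    have "W \<subseteq> (V - (\<Union>i<r. A i)) \<union> (\<Union>i<r. A i - core i)" by (auto simp: W_def)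
    then have "card W \<le> card ((V - (\<Union>i<r. A i)) \<union> (\<Union>i<r. A i - core i))"
      by (rule card_mono[rotated]) (use finite_V finA in auto)
    also have "\<dots> \<le> card (V - (\<Union>i<r. A i)) + card (\<Union>i<r. A i - core i)" by (rule card_Un_le)
    also have "card (\<Union>i<r. A i - core i) \<le> (\<Sum>i<r. card (A i - core i))" by (rule card_UN_le) simp
    finally have "card W \<le> card (V - (\<Union>i<r. A i)) + (\<Sum>i<r. card (A i - core i))" by simp
    then have "real (card W) \<le> real (card (V - (\<Union>i<r. A i)) + (\<Sum>i<r. card (A i - core i)))" by (rule of_nat_mono)
    also have "\<dots> = real (card (V - (\<Union>i<r. A i))) + (\<Sum>i<r. real (card (A i - core i)))" by simp
    also have "(\<Sum>i<r. real (card (A i - core i))) \<le> (\<Sum>i<r. t)" by (intro sum_mono atypical_card) simp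
    finally have "real (card W) \<le> real (card (V - (\<Union>i<r. A i))) + real r * t" by simp
    then show ?thesis using A_cover gs' st' s_pos r_ge[of t] t_pos by linarith
  qed
  have fW: "finite W" "finite (B i)" for i using finite_V by (auto simp: W_def B_def)
  have BA: "B i - A i \<subseteq> W" if i: "i < r" for i
  proof
    fix v assume v: "v \<in> B i - A i"
    have False if "j < r" "v \<in> core j" for j
    proof -
      have "v \<in> B j" using coreB that by blast
      then have "j = i" using v by (simp add: B_def)
      then show False using v that core_sub by blast
    qed
    then show "v \<in> W" using v by (auto simp: W_def B_def)
  qed
  have cB: "real (card (B i)) \<le> real (card (A i)) + k / 2" "real (card (B i)) \<ge> real (card (A i)) - k / 2"
    "real (card (B i - A i)) \<le> k / 2" if i: "i < r" for i
  proof -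
    have "card (B i - A i) \<le> card W" by (rule card_mono) (use fW BA[OF i] in auto)
    then show 1: "real (card (B i - A i)) \<le> k / 2" using W tk t_pos r_ge[of t] by linarith
    have "card (B i) \<le> card (A i \<union> (B i - A i))" by (rule card_mono) (use fW finA[OF i] in auto)
    also have "\<dots> \<le> card (A i) + card (B i - A i)" by (rule card_Un_le)
    finally show "real (card (B i)) \<le> real (card (A i)) + k / 2" using 1 by linarith
    have "card (core i) \<le> card (B i)" by (rule card_mono) (use fW coreB[OF i] in auto)
    moreover have "real (card (core i)) \<ge> real (card (A i)) - t"
      using core_card[of "A i" i] i core_sub[of i] by (simp add: Int_absorb1)
    ultimately show "real (card (B i)) \<ge> real (card (A i)) - k / 2" using tk' t_pos by linarith
  qed
  have "partition_graph V adj r a B h (2 * k)"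
  proof unfold_locales
    show "V = (\<Union>i<r. B i)" using \<beta>(1) by (auto simp: B_def)
    show "B i \<inter> B j = {}" if "i \<noteq> j" for i j using that by (auto simp: B_def)
    show "\<bar>real (card (B i)) - 2 * h\<bar> \<le> 2 * k" if "i < 2" for i
    proof -
      have "i = 0 \<or> i = 1" using that by auto
      then have "2 * h - s \<le> real (card (A i))" "real (card (A i)) \<le> 2 * h + s" using A_sizes01 by auto
      then show ?thesis using cB[OF r01(3)[OF that]] st' tk' s_pos t_pos by linarith
    qed
    show "\<bar>real (card (B i)) - 3 * h\<bar> \<le> 2 * k" if "2 \<le> i" "i < r" for i
      using cB[OF that(2)] A_sizes2[OF that] st' tk' s_pos t_pos by linarith
    show "deg_in (B i) v \<le> 2 * k" if "i < r" "v \<in> B i" for i v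
    proof -
      have v: "v \<in> V" "\<beta> v = i" using that(2) by (auto simp: B_def)
      have "deg_in (B i) v \<le> deg_in (A i \<union> (B i - A i)) v" by (rule deg_in_mono) (use fW finA[OF that(1)] in auto)
      also have "\<dots> = deg_in (A i) v + deg_in (B i - A i) v" by (rule deg_in_Un) (use fW finA[OF that(1)] in auto)
      also have "deg_in (B i - A i) v \<le> real (card (B i - A i))" by (rule deg_in_le_card) (use fW in auto)
      finally show ?thesis using \<beta>(2)[OF v(1)] v(2) cB(3)[OF that(1)] k_pos by simp
    qed
    show "deg_in V v \<ge> real (card V) - 3 * h - 2 * k" if "v \<in> V" for v
      using degree[OF that] n_def q gs' st' tk' s_pos t_pos g_pos by linarith
    show "a \<le> 2 * k" using a_le tk' t_pos by linarith
    show "real (card V) = (3 * real r - 2) * h" using n_eq n_def by simp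
    show "100000 * real r * (2 * k) \<le> h" using kh by simp
  qed
  from partition_graph.edge_bound[OF this] show ?thesis by (simp add: n_def)
qed

end

section \<open>Transfer from cells to vertices\<close>

text \<open>The error \<open>e\<close> of the weighted minimum degree is spent in fifths: one each
  on the degree condition, on \<open>\<gamma>\<close> and on the bad pairs at a vertex, and two on
  the vertices outside \<open>V'\<close>.\<close>

locale regular_graph = rt_graph +
  fixes S :: "'a set set" and n h e \<gamma> z :: real
  assumes n_def: "n = real (card V)" and n_eq: "n = (3 * real r - 2) * h" and n_pos: "0 < n"
    and finS: "finite S"
    and few_irreg: "real (card {(x, y) \<in> V \<times> V. irreg (z\<^sup>2) (cell S x) (cell S y)}) \<le> z\<^sup>2 * n\<^sup>2"
    and degree: "v \<in> V \<Longrightarrow> deg_in V v \<ge> n - 3 * h - e / 5 * n"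
    and z: "0 < z" "z \<le> e / 5" and \<gamma>: "0 < \<gamma>" "\<gamma> \<le> e / 5" "2 * z\<^sup>2 \<le> \<gamma>"
      "(real (2 * r) + 1) * z\<^sup>2 \<le> (\<gamma> / 2) ^ (2 * r)"
    and e_small: "5 * real r * e * (3 * real r - 2) < 2"
    and a_small: "a \<le> z\<^sup>2 * (z\<^sup>2 * n / 2 ^ card S)"
begin

definition bad :: "'a \<Rightarrow> 'a \<Rightarrow> bool" where
  "bad x y \<longleftrightarrow> irreg (z\<^sup>2) (cell S x) (cell S y)"

text \<open>Small cells are dropped because \<open>a\<close> must be small against every cell in
  use, and cells in many bad pairs because the weighted degree has to be large at every single
  vertex.\<close>

definition V' :: "'a set" where
  "V' = {x \<in> V. z\<^sup>2 * n / 2 ^ card S \<le> real (card (cell S x)) \<and> real (card {y \<in> V. bad x y}) \<le> z * n}"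

text \<open>The weighted graph lives on vertices instead of cells: members of a cell are twins, so
  cell sizes enter as multiplicities. Apart from bad pairs, a weight falls short of the density by
  at most \<open>\<gamma>\<close>.\<close>

definition w :: "'a \<Rightarrow> 'a \<Rightarrow> real" where
  "w x y = (if bad x y \<or> cdens S x y < \<gamma> then 0 else if cdens S x y < 1 / 2 + \<gamma> then 1 / 2 else 1)"

lemma V'_sub: "V' \<subseteq> V" by (auto simp: V'_def)

lemma e_bound: "0 < e" "e < 1 / 20"
proof -
  show e: "0 < e" using z by simp
  have "40 * e \<le> 5 * real r * e * (3 * real r - 2)"
  proof -
    have "10 * e * 4 \<le> (5 * real r * e) * (3 * real r - 2)"
      using r2 e by (intro mult_mono) auto
    then show ?thesis by simp
  qed
  then show "e < 1 / 20" using e_small by linarith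
qed

lemma zz: "0 < z\<^sup>2" "z\<^sup>2 \<le> e / 5" "\<gamma> \<le> 1"
proof -
  show "0 < z\<^sup>2" using z by simp
  have "z \<le> 1" using z e_bound by linarith
  then have "z * z \<le> z * 1" using z by (intro mult_left_mono) auto
  then show "z\<^sup>2 \<le> e / 5" using z unfolding power2_eq_square by linarith
  show "\<gamma> \<le> 1" using \<gamma> e_bound by linarith
qed

lemma bad_sym: "bad x y \<longleftrightarrow> bad y x"
  using irreg_sym[OF finite_cell finite_cell] by (auto simp: bad_def)

lemma w_sym: "w x y = w y x"
  using bad_sym[of x y] cdens_sym[of S x y] by (simp add: w_def)

lemma w_le: "cdens S x y \<le> w x y + \<gamma> + of_bool (bad x y)"
  using cdens_bounds(2)[of S x y] \<gamma> by (auto simp: w_def)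

lemma w_vals: "w x y = 0 \<or> w x y = 1 / 2 \<or> w x y = 1"
  by (simp add: w_def)

lemma bad_eq: "bad x = bad x'" "w x = w x'" if "x' \<in> cell S x"
  using cell_eq[OF that] by (auto simp: bad_def w_def cdens_def)

lemma V'_cell: "x \<in> V' \<Longrightarrow> x' \<in> cell S x \<Longrightarrow> x' \<in> V'"
proof -
  assume x: "x \<in> V'" and x': "x' \<in> cell S x"
  have "x' \<in> V" using x' cell_subset by blast
  then show ?thesis using x unfolding V'_def mem_Collect_eq bad_eq(1)[OF x'] cell_eq[OF x'] by simp
qed

lemma a_cell: "x \<in> V' \<Longrightarrow> a \<le> z\<^sup>2 * real (card (cell S x))"
proof -
  assume "x \<in> V'"
  then have "z\<^sup>2 * (z\<^sup>2 * n / 2 ^ card S) \<le> z\<^sup>2 * real (card (cell S x))"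
    using zz by (intro mult_left_mono) (auto simp: V'_def)
  then show ?thesis using a_small by linarith
qed

lemma w_pos: "w x y > 0 \<Longrightarrow> \<not> irreg (z\<^sup>2) (cell S x) (cell S y) \<and> \<gamma> \<le> dens (cell S x) (cell S y)"
  by (auto simp: w_def bad_def cdens_def split: if_splits)

lemma w_one: "w x y = 1 \<Longrightarrow> 1 / 2 + \<gamma> \<le> dens (cell S x) (cell S y)"
  by (auto simp: w_def bad_def cdens_def split: if_splits)

lemma power_bound: "l \<le> 2 * r \<Longrightarrow> (real (2 * r) + 1) * z\<^sup>2 \<le> 1 * (\<gamma> / 2) ^ l"
proof -
  assume l: "l \<le> 2 * r"
  have "0 \<le> \<gamma> / 2" "\<gamma> / 2 \<le> 1" using \<gamma>(1) zz(3) by linarith+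
  then have "(\<gamma> / 2) ^ (2 * r) \<le> (\<gamma> / 2) ^ l" by (rule power_decreasing[OF l])
  then show ?thesis using \<gamma>(4) by simp
qed

text \<open>A cell that is regular with itself and not sparse would contain a K_(2r):
  \<open>embed\<close> is applied to a constant family with \<open>2 * r\<close> indices, each
  contributing one vertex.\<close>

lemma w_refl: "x \<in> V' \<Longrightarrow> w x x = 0"
proof (rule ccontr)
  assume x: "x \<in> V'" and "w x x \<noteq> 0"
  then have p: "w x x > 0" using w_vals[of x x] by auto
  have "\<exists>K \<subseteq> (\<Union>i\<in>{..<2 * r} \<union> {}. cell S x). is_clique K \<and> card K = card {..<2 * r} + 2 * card ({} :: nat set)"
    by (rule embed[where C = "\<lambda>_. cell S x" and \<epsilon> = "z\<^sup>2" and \<gamma> = \<gamma> and \<rho> = 1 and m = "2 * r"])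
       (use w_pos[OF p] a_cell[OF x] cell_subset zz \<gamma> power_bound[of "2 * r"] in auto)
  then obtain K where K: "K \<subseteq> (\<Union>i\<in>{..<2 * r} \<union> {}. cell S x)" "is_clique K"
    "card K = card {..<2 * r} + 2 * card ({} :: nat set)" by blast
  have "K \<subseteq> V" using K(1) cell_subset by blast
  then show False using no_clique[OF _ K(2)] K(3) by simp
qed

lemma small_weighted_clique:
  assumes sub: "Q \<subseteq> V'" "P \<subseteq> V'" and disj: "Q \<inter> P = {}"
    and full: "\<And>x y. x \<in> Q \<Longrightarrow> y \<in> Q \<Longrightarrow> x \<noteq> y \<Longrightarrow> w x y = 1"
    and pos: "\<And>x y. x \<in> Q \<union> P \<Longrightarrow> y \<in> Q \<union> P \<Longrightarrow> x \<noteq> y \<Longrightarrow> w x y > 0"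
    and card: "card P + card Q \<le> 2 * r"
  shows "2 * card Q + card P < 2 * r"
proof -
  have f: "finite P" "finite Q" using sub V'_sub fin by blast+
  have "\<exists>K \<subseteq> (\<Union>i\<in>P \<union> Q. cell S i). is_clique K \<and> card K = card P + 2 * card Q"
  proof (rule embed[OF f, where C = "cell S" and \<epsilon> = "z\<^sup>2" and \<gamma> = \<gamma> and \<rho> = 1 and m = "2 * r"])
    show "P \<inter> Q = {}" using disj by auto
    show "cell S i \<subseteq> V" for i by (rule cell_subset)
    show "a \<le> z\<^sup>2 * real (card (cell S i))" if "i \<in> P \<union> Q" for i using a_cell that sub by blast
    show "\<not> irreg (z\<^sup>2) (cell S i) (cell S j) \<and> \<gamma> \<le> dens (cell S i) (cell S j)" if "i \<in> P \<union> Q" "j \<in> P \<union> Q" "i \<noteq> j" for i j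
      by (rule w_pos) (rule pos, use that in auto)
    show "1 / 2 + \<gamma> \<le> dens (cell S i) (cell S j)" if "i \<in> Q" "j \<in> Q" "i \<noteq> j" for i j
      by (rule w_one) (rule full, use that in auto)
    show "(real (2 * r) + 1) * z\<^sup>2 \<le> 1 * (\<gamma> / 2) ^ (card P + card Q)" by (rule power_bound[OF card])
  qed (use zz \<gamma> card in auto)
  then obtain K where K: "K \<subseteq> (\<Union>i\<in>P \<union> Q. cell S i)" "is_clique K" "card K = card P + 2 * card Q" by blast
  have "K \<subseteq> V" using K(1) cell_subset by blast
  then show ?thesis using no_clique[OF _ K(2)] K(3) by simp
qed

text \<open>The constants allow \<open>embed\<close> at most \<open>2 * r\<close> cells, so a
  weighted clique that is too large is first cut down to that many members while its clique size
  stays at least \<open>2 * r\<close>.\<close>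

lemma no_weighted_clique:
  assumes sub: "Q \<subseteq> V'" "P \<subseteq> V'" and disj: "Q \<inter> P = {}"
    and full: "\<And>x y. x \<in> Q \<Longrightarrow> y \<in> Q \<Longrightarrow> x \<noteq> y \<Longrightarrow> w x y = 1"
    and pos: "\<And>x y. x \<in> Q \<union> P \<Longrightarrow> y \<in> Q \<union> P \<Longrightarrow> x \<noteq> y \<Longrightarrow> w x y > 0"
  shows "2 * card Q + card P < 2 * r"
proof (rule ccontr)
  assume H: "\<not> ?thesis"
  have f: "finite P" "finite Q" using sub V'_sub fin by blast+
  have "\<exists>Q' P'. Q' \<subseteq> Q \<and> P' \<subseteq> P \<and> card P' + card Q' \<le> 2 * r \<and> 2 * card Q' + card P' \<ge> 2 * r"
  proof (cases "r \<le> card Q")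
    case True
    then obtain Q' where "Q' \<subseteq> Q" "card Q' = r" using obtain_subset_with_card_n by metis
    then show ?thesis by (intro exI[of _ Q'] exI[of _ "{}"]) simp
  next
    case False
    then have "2 * r - 2 * card Q \<le> card P" using H by simp
    then obtain P' where "P' \<subseteq> P" "card P' = 2 * r - 2 * card Q" using obtain_subset_with_card_n by metis
    then show ?thesis using False by (intro exI[of _ Q] exI[of _ P']) simp
  qed
  then obtain Q' P' where *: "Q' \<subseteq> Q" "P' \<subseteq> P" "card P' + card Q' \<le> 2 * r" "2 * card Q' + card P' \<ge> 2 * r" by blast
  have "2 * card Q' + card P' < 2 * r"
    by (rule small_weighted_clique) (use * sub disj full pos in blast)+
  then show False using *(4) by simp
qed

lemma V_minus_V': "real (card (V - V')) \<le> 2 / 5 * e * n"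
proof -
  let ?A = "{x \<in> V. real (card (cell S x)) < z\<^sup>2 * n / 2 ^ card S}"
  let ?B = "{x \<in> V. real (card {y \<in> V. bad x y}) > z * n}"
  have "?A \<subseteq> (\<Union>C\<in>{C \<in> cell S ` V. real (card C) < z\<^sup>2 * n / 2 ^ card S}. C)" using cell_self by blast
  then have "card ?A \<le> card (\<Union>C\<in>{C \<in> cell S ` V. real (card C) < z\<^sup>2 * n / 2 ^ card S}. C)"
    by (rule card_mono[rotated]) (use finite_V in auto)
  also have "\<dots> \<le> (\<Sum>C\<in>{C \<in> cell S ` V. real (card C) < z\<^sup>2 * n / 2 ^ card S}. card C)"
    by (rule card_UN_le) (use finite_V in auto)
  finally have "real (card ?A) \<le> real (\<Sum>C\<in>{C \<in> cell S ` V. real (card C) < z\<^sup>2 * n / 2 ^ card S}. card C)"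
    by (rule of_nat_mono)
  also have "\<dots> = (\<Sum>C\<in>{C \<in> cell S ` V. real (card C) < z\<^sup>2 * n / 2 ^ card S}. real (card C))"
    by (rule of_nat_sum)
  also have "\<dots> \<le> (\<Sum>C\<in>{C \<in> cell S ` V. real (card C) < z\<^sup>2 * n / 2 ^ card S}. z\<^sup>2 * n / 2 ^ card S)"
    by (intro sum_mono) auto
  also have "\<dots> = real (card {C \<in> cell S ` V. real (card C) < z\<^sup>2 * n / 2 ^ card S}) * (z\<^sup>2 * n / 2 ^ card S)" by simp
  also have "\<dots> \<le> 2 ^ card S * (z\<^sup>2 * n / 2 ^ card S)"
  proof (intro mult_right_mono)
    have "card {C \<in> cell S ` V. real (card C) < z\<^sup>2 * n / 2 ^ card S} \<le> card (cell S ` V)"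
      by (rule card_mono) (use finite_V in auto)
    also have "\<dots> \<le> 2 ^ card S" by (rule card_cells[OF finS])
    finally have "real (card {C \<in> cell S ` V. real (card C) < z\<^sup>2 * n / 2 ^ card S}) \<le> real (2 ^ card S)"
      by (rule of_nat_mono)
    then show "real (card {C \<in> cell S ` V. real (card C) < z\<^sup>2 * n / 2 ^ card S}) \<le> 2 ^ card S" by simp
  qed (use n_pos in auto)
  also have "\<dots> = z\<^sup>2 * n" by simp
  also have "\<dots> \<le> e / 5 * n" using zz n_pos by (intro mult_right_mono) auto
  finally have A: "real (card ?A) \<le> e / 5 * n" .
  have "z * n * real (card ?B) \<le> (\<Sum>x\<in>V. real (card {y \<in> V. bad x y}))"
    by (rule markov[OF finite_V]) simp
  also have "\<dots> = real (card (SIGMA x:V. {y \<in> V. bad x y}))"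
    using finite_V by (simp add: card_SigmaI)
  also have "(SIGMA x:V. {y \<in> V. bad x y}) = {(x, y) \<in> V \<times> V. irreg (z\<^sup>2) (cell S x) (cell S y)}"
    by (auto simp: bad_def)
  also have "real (card \<dots>) \<le> z\<^sup>2 * n\<^sup>2" by (rule few_irreg)
  also have "\<dots> = z * n * (z * n)" by (simp add: power2_eq_square)
  finally have "real (card ?B) \<le> z * n" using z n_pos by simp
  also have "\<dots> \<le> e / 5 * n" using z n_pos by (intro mult_right_mono) auto
  finally have B: "real (card ?B) \<le> e / 5 * n" .
  have "V - V' \<subseteq> ?A \<union> ?B" by (auto simp: V'_def not_le)
  then have "card (V - V') \<le> card (?A \<union> ?B)" by (rule card_mono[rotated]) (use finite_V in auto)
  also have "\<dots> \<le> card ?A + card ?B" by (rule card_Un_le)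
  finally show ?thesis using A B by simp
qed

lemma card_V': "real (card V') = n - real (card (V - V'))" "real (card V') \<le> n"
  using card_Diff_subset[OF fin V'_sub] V'_sub card_mono[OF finite_V V'_sub] by (simp_all add: n_def of_nat_diff)

text \<open>Averaged over the cell of \<open>x\<close>, the degree condition becomes a lower bound
  for the sum of the densities at \<open>x\<close>; what remains is the loss from densities to
  weights.\<close>

lemma w_degree:
  assumes x: "x \<in> V'"
  shows "(1 - 3 / (3 * real r - 2) - e) * real (card V') \<le> (\<Sum>y\<in>V'. w x y)"
proof -
  have xV: "x \<in> V" using x V'_sub by auto
  let ?c = "real (card (cell S x))"
  have c: "?c > 0" using card_cell_pos[OF xV] by simp
  have "?c * (n - 3 * h - e / 5 * n) \<le> arcs (cell S x) V"
  proof -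
    have "(\<Sum>v\<in>cell S x. n - 3 * h - e / 5 * n) \<le> (\<Sum>v\<in>cell S x. deg_in V v)"
      using degree cell_subset by (intro sum_mono) blast
    then show ?thesis by (simp add: arcs_def)
  qed
  also have "arcs (cell S x) V = (\<Sum>v\<in>cell S x. \<Sum>y\<in>V. cdens S v y)"
    using sum_cdens[OF sat_cell sat_V, of S S x] by simp
  also have "\<dots> = (\<Sum>v\<in>cell S x. \<Sum>y\<in>V. cdens S x y)"
    by (intro sum.cong refl) (simp add: cdens_def cell_eq)
  also have "\<dots> = ?c * (\<Sum>y\<in>V. cdens S x y)" by simp
  finally have "n - 3 * h - e / 5 * n \<le> (\<Sum>y\<in>V. cdens S x y)" using c by simp
  also have "(\<Sum>y\<in>V. cdens S x y) = (\<Sum>y\<in>V'. cdens S x y) + (\<Sum>y\<in>V - V'. cdens S x y)"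
    using sum.subset_diff[OF V'_sub finite_V, of "cdens S x"] by simp
  also have "(\<Sum>y\<in>V - V'. cdens S x y) \<le> (\<Sum>y\<in>V - V'. 1)" by (intro sum_mono cdens_bounds)
  also have "(\<Sum>y\<in>V'. cdens S x y) \<le> (\<Sum>y\<in>V'. w x y + \<gamma> + of_bool (bad x y))" by (intro sum_mono w_le)
  also have "(\<Sum>y\<in>V'. w x y + \<gamma> + of_bool (bad x y)) = (\<Sum>y\<in>V'. w x y) + real (card V') * \<gamma> + real (card {y \<in> V'. bad x y})"
    using V'_sub fin by (simp add: sum.distrib Int_def)
  finally have 1: "n - 3 * h - e / 5 * n \<le> (\<Sum>y\<in>V'. w x y) + real (card V') * \<gamma> + real (card {y \<in> V'. bad x y}) + real (card (V - V'))"
    by simp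
  have "real (card V') * \<gamma> \<le> n * (e / 5)" using card_V'(2) \<gamma> n_pos by (intro mult_mono) auto
  moreover have "real (card {y \<in> V'. bad x y}) \<le> n * (e / 5)"
  proof -
    have "card {y \<in> V'. bad x y} \<le> card {y \<in> V. bad x y}" by (rule card_mono) (use V'_sub finite_V in auto)
    then have "real (card {y \<in> V'. bad x y}) \<le> z * n" using x by (auto simp: V'_def)
    also have "\<dots> \<le> e / 5 * n" using z n_pos by (intro mult_right_mono) auto
    finally show ?thesis by (simp add: mult.commute)
  qed
  ultimately have "n - 3 * h - e * n \<le> (\<Sum>y\<in>V'. w x y)" using 1 V_minus_V' by (simp add: field_simps)
  moreover have "(1 - 3 / (3 * real r - 2) - e) * real (card V') \<le> (1 - 3 / (3 * real r - 2) - e) * n"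
  proof (rule mult_left_mono[OF card_V'(2)])
    have "3 / (3 * real r - 2) \<le> 3 / 4" using r2 by (intro divide_left_mono) auto
    then show "0 \<le> 1 - 3 / (3 * real r - 2) - e" using e_bound by linarith
  qed
  moreover have "(1 - 3 / (3 * real r - 2) - e) * n = n - 3 * h - e * n"
  proof -
    have "3 / (3 * real r - 2) * n = 3 * h" using r2 by (simp add: n_eq)
    then show ?thesis by (simp add: left_diff_distrib)
  qed
  ultimately show ?thesis by linarith
qed

lemma bad_total: "(\<Sum>x\<in>X. \<Sum>y\<in>Y. of_bool (bad x y)) \<le> z\<^sup>2 * n\<^sup>2" if "X \<subseteq> V" "Y \<subseteq> V"
proof -
  have "(\<Sum>x\<in>X. \<Sum>y\<in>Y. of_bool (bad x y)) \<le> (\<Sum>x\<in>V. \<Sum>y\<in>V. of_bool (bad x y) :: real)"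
    by (rule order_trans[OF sum_mono[OF sum_mono2] sum_mono2]) (use that finite_V in \<open>auto intro: sum_nonneg\<close>)
  also have "\<dots> = real (card (SIGMA x:V. {y \<in> V. bad x y}))"
    using finite_V by (simp add: card_SigmaI Int_def)
  also have "(SIGMA x:V. {y \<in> V. bad x y}) = {(x, y) \<in> V \<times> V. irreg (z\<^sup>2) (cell S x) (cell S y)}"
    by (auto simp: bad_def)
  also have "real (card \<dots>) \<le> z\<^sup>2 * n\<^sup>2" by (rule few_irreg)
  finally show ?thesis .
qed

lemma arcs_le_weight:
  assumes X: "sat S X" and Y: "sat S Y" and c: "\<And>x y. x \<in> X \<Longrightarrow> y \<in> Y \<Longrightarrow> w x y \<le> c"
  shows "arcs X Y \<le> c * (real (card X) * real (card Y)) + 2 / 5 * e * n\<^sup>2"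
proof -
  have XY: "X \<subseteq> V" "Y \<subseteq> V" using X Y by (auto simp: sat_def)
  have le: "real (card X) \<le> n" "real (card Y) \<le> n" using XY card_mono[OF finite_V] n_def by auto
  have "arcs X Y = (\<Sum>x\<in>X. \<Sum>y\<in>Y. cdens S x y)" by (rule sum_cdens[OF X Y, symmetric])
  also have "\<dots> \<le> (\<Sum>x\<in>X. \<Sum>y\<in>Y. (c + \<gamma>) + of_bool (bad x y))"
    using w_le c by (intro sum_mono) (smt (verit))
  also have "\<dots> = (c + \<gamma>) * (real (card X) * real (card Y)) + (\<Sum>x\<in>X. \<Sum>y\<in>Y. of_bool (bad x y))"
    by (simp only: sum.distrib sum_constant) (simp add: algebra_simps)
  also have "\<dots> \<le> (c + \<gamma>) * (real (card X) * real (card Y)) + z\<^sup>2 * n\<^sup>2" using bad_total[OF XY] by simp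
  finally have "arcs X Y \<le> c * (real (card X) * real (card Y)) + \<gamma> * (real (card X) * real (card Y)) + z\<^sup>2 * n\<^sup>2"
    by (simp add: distrib_right)
  moreover have "\<gamma> * (real (card X) * real (card Y)) \<le> e / 5 * (n * n)"
    using le \<gamma> n_pos by (intro mult_mono) auto
  moreover have "z\<^sup>2 * n\<^sup>2 \<le> e / 5 * n\<^sup>2" using zz by (intro mult_right_mono) auto
  ultimately show ?thesis by (simp add: power2_eq_square field_simps)
qed

theorem stability:
  obtains A where "\<And>i. i < r \<Longrightarrow> A i \<subseteq> V" "\<And>i j. i < r \<Longrightarrow> j < r \<Longrightarrow> i \<noteq> j \<Longrightarrow> A i \<inter> A j = {}"
    "real (card (V - (\<Union>i<r. A i))) \<le> 7 * real r * e * n"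
    "\<And>i. i < r \<Longrightarrow> arcs (A i) (A i) \<le> e * n\<^sup>2"
    "arcs (A 0) (A 1) \<le> real (card (A 0)) * real (card (A 1)) / 2 + e * n\<^sup>2"
proof -
  have V'_ne: "V' \<noteq> {}"
  proof
    assume "V' = {}"
    then have "n \<le> 2 / 5 * e * n" using V_minus_V' n_def by simp
    then show False using e_bound n_pos by simp
  qed
  interpret W: wgraph_deg V' w r e
  proof unfold_locales
    show "finite V'" by (rule fin[OF V'_sub])
    show "w x y = w y x" for x y by (rule w_sym)
    show "w x y = 0 \<or> w x y = 1 / 2 \<or> w x y = 1" for x y by (rule w_vals)
    show "w x x = 0" if "x \<in> V'" for x by (rule w_refl[OF that])
    show "2 \<le> r" by (rule r2)
    show "2 * card Q + card P < 2 * r" if "Q \<subseteq> V'" "P \<subseteq> V'" "Q \<inter> P = {}"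
      "\<And>x y. x \<in> Q \<Longrightarrow> y \<in> Q \<Longrightarrow> x \<noteq> y \<Longrightarrow> w x y = 1"
      "\<And>x y. x \<in> Q \<union> P \<Longrightarrow> y \<in> Q \<union> P \<Longrightarrow> x \<noteq> y \<Longrightarrow> 0 < w x y" for Q P
      by (rule no_weighted_clique[OF that])
    show "V' \<noteq> {}" by (rule V'_ne)
    show "0 \<le> e" using e_bound by simp
    show "5 * real r * e * (3 * real r - 2) < 2" by (rule e_small)
    show "(1 - 3 / (3 * real r - 2) - e) * real (card V') \<le> sum (w x) V'" if "x \<in> V'" for x
      by (rule w_degree[OF that])
  qed
  obtain u where u: "W.frame u" "real (card (V' - (\<Union>i<r. W.frame_class u i))) \<le> 2 * (3 * real r - 2) * e * real (card V')"
    "\<And>i v v'. i < r \<Longrightarrow> v \<in> W.frame_class u i \<Longrightarrow> v' \<in> W.frame_class u i \<Longrightarrow> w v v' = 0"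
    "\<And>v v'. v \<in> W.frame_class u 0 \<Longrightarrow> v' \<in> W.frame_class u 1 \<Longrightarrow> w v v' \<le> 1 / 2"
    by (rule W.weighted_stability) (rule that; assumption)
  have cV: "W.frame_class u i \<subseteq> V'" for i by (auto simp: W.frame_class_def)
  have sat: "sat S (W.frame_class u i)" for i
    unfolding sat_def
  proof (intro conjI ballI)
    show "W.frame_class u i \<subseteq> V" using cV V'_sub by blast
    show "cell S x \<subseteq> W.frame_class u i" if x: "x \<in> W.frame_class u i" for x
    proof
      fix x' assume x': "x' \<in> cell S x"
      then have "w x' = w x" using bad_eq(2) by metis
      then show "x' \<in> W.frame_class u i" using x V'_cell[OF _ x'] by (auto simp: W.frame_class_def)
    qed
  qed
  show ?thesis
  proof (rule that[of "W.frame_class u"])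
    show "W.frame_class u i \<subseteq> V" for i using cV V'_sub by blast
    show "W.frame_class u i \<inter> W.frame_class u j = {}" if "i < r" "j < r" "i \<noteq> j" for i j
    proof -
      have False if v: "v \<in> W.frame_class u i" "v \<in> W.frame_class u j" for v
      proof -
        have "w v (u i) = pattern i i" "w v (u i) = pattern j i" using v \<open>i < r\<close> by (auto simp: W.frame_class_def)
        then show False using \<open>i \<noteq> j\<close> by (auto simp: pattern_def split: if_splits)
      qed
      then show ?thesis by blast
    qed
    have "V - (\<Union>i<r. W.frame_class u i) \<subseteq> (V - V') \<union> (V' - (\<Union>i<r. W.frame_class u i))" by auto
    then have "card (V - (\<Union>i<r. W.frame_class u i)) \<le> card ((V - V') \<union> (V' - (\<Union>i<r. W.frame_class u i)))"
      by (rule card_mono[rotated]) (use finite_V fin[OF V'_sub] in auto)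
    also have "\<dots> \<le> card (V - V') + card (V' - (\<Union>i<r. W.frame_class u i))" by (rule card_Un_le)
    finally have "real (card (V - (\<Union>i<r. W.frame_class u i))) \<le> 2 / 5 * e * n + 2 * (3 * real r - 2) * e * real (card V')"
      using V_minus_V' u(2) by linarith
    also have "2 * (3 * real r - 2) * e * real (card V') \<le> 2 * (3 * real r - 2) * e * n"
      using card_V'(2) e_bound r2 by (intro mult_left_mono) auto
    finally have "real (card (V - (\<Union>i<r. W.frame_class u i))) \<le> 6 * real r * (e * n) - 18 / 5 * (e * n)"
      by (simp add: algebra_simps)
    moreover have "0 \<le> real r * (e * n)" "0 \<le> e * n" using e_bound n_pos by auto
    moreover have "7 * real r * e * n = 7 * (real r * (e * n))" "6 * real r * (e * n) = 6 * (real r * (e * n))" by simp_all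
    ultimately show "real (card (V - (\<Union>i<r. W.frame_class u i))) \<le> 7 * real r * e * n" by linarith
    have en: "2 / 5 * e * n\<^sup>2 \<le> e * n\<^sup>2" using e_bound by (intro mult_right_mono) auto
    show "arcs (W.frame_class u i) (W.frame_class u i) \<le> e * n\<^sup>2" if "i < r" for i
      using arcs_le_weight[OF sat sat, of i i 0] u(3)[OF that] en by simp
    show "arcs (W.frame_class u 0) (W.frame_class u 1) \<le> real (card (W.frame_class u 0)) * real (card (W.frame_class u 1)) / 2 + e * n\<^sup>2"
      using arcs_le_weight[OF sat sat, of 0 1 "1 / 2"] u(4) en by simp
  qed
qed

end

section \<open>The theorem\<close>

text \<open>Fixes the hierarchy of errors. A square is taken where a total error becomes an error
  per vertex or meets a product of two set sizes, and only a factor of order \<open>1 / r\<close>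
  where errors of parts are added; \<open>z\<close> is much smaller still because of the power in
  \<open>embed\<close>.\<close>

lemma (in rt_graph) min_degree_edge_bound:
  fixes c k t s g e \<gamma> z n :: real and K :: nat
  assumes n: "n = real (card V)" "V \<noteq> {}"
    and c: "c * (3 * real r - 2) = 1"
    and defs: "k = c / (200000 * real r)" "t = k\<^sup>2 / 20" "s = t\<^sup>2 / (4 * real r)" "g = s / (10 * real r)"
      "e = g\<^sup>2 / (7 * real r)" "\<gamma> = e / 5" "z = (\<gamma> / 2) ^ (2 * r) / (real (2 * r) + 1)"
    and K: "real K * (z\<^sup>2) ^ 5 > 1"
    and a: "a \<le> z\<^sup>2 * (z\<^sup>2 * n / 2 ^ reg_bound K)"
    and deg: "\<And>v. v \<in> V \<Longrightarrow> deg_in V v \<ge> (1 - 3 * c - e / 5) * n"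
  shows "(\<Sum>x\<in>V. deg_in V x) \<le> (1 - 3 * c) * n\<^sup>2 + a * n - a\<^sup>2"
proof -
  have n_pos: "n > 0" using n finite_V by (simp add: card_gt_0_iff)
  have r: "real r \<ge> 2" using r2 by simp
  have L: "3 * real r - 2 \<ge> 4" using r by simp
  have "0 < c * (3 * real r - 2)" using c by simp
  then have c_pos: "0 < c" using L by (simp add: zero_less_mult_iff)
  have c_le: "c \<le> 1 / 4"
  proof -
    have "c * 4 \<le> c * (3 * real r - 2)" using L c_pos by (intro mult_left_mono) auto
    then show ?thesis using c by simp
  qed
  have sq_le: "x\<^sup>2 \<le> x" if "0 < x" "x \<le> 1" for x :: real
    using mult_left_mono[OF that(2), of x] that(1) by (simp add: power2_eq_square)
  have div_le: "x / (m * real r) \<le> x / m" "x / (m * real r) > 0" if "0 < x" "0 < m" for x m :: real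
    using that r by (auto intro!: divide_left_mono)
  have k: "0 < k" "k \<le> 1 / 200000" using div_le[OF c_pos, of 200000] c_le by (simp_all add: defs(1))
  have kr: "200000 * (real r * k) = c" using r by (simp add: defs(1))
  have t: "0 < t" "t \<le> 1 / 200000" using k sq_le[of k] by (simp_all add: defs(2))
  have s: "0 < s" "s \<le> t" using div_le[of "t\<^sup>2" 4] t sq_le[of t] by (simp_all add: defs(3))
  have sr: "4 * (real r * s) = t\<^sup>2" using r by (simp add: defs(3))
  have g: "0 < g" "g \<le> s" using div_le[of s 10] s by (simp_all add: defs(4))
  have gr: "10 * (real r * g) = s" using r by (simp add: defs(4))
  have e: "0 < e" "e \<le> g\<^sup>2" "e \<le> g" using div_le[of "g\<^sup>2" 7] g sq_le[of g] s t by (simp_all add: defs(5))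
  have er: "7 * (real r * e) = g\<^sup>2" using r by (simp add: defs(5))
  have \<gamma>: "0 < \<gamma>" "\<gamma> \<le> 1" using e g s t by (simp_all add: defs(6))
  have zr: "(real (2 * r) + 1) * z = (\<gamma> / 2) ^ (2 * r)" using r by (simp add: defs(7))
  have z: "0 < z" "z \<le> \<gamma> / 2"
  proof -
    show "0 < z" using \<gamma> r unfolding defs(7) by (intro divide_pos_pos zero_less_power) auto
    then have "1 * z \<le> (real (2 * r) + 1) * z" by (intro mult_right_mono) auto
    also have "\<dots> = (\<gamma> / 2) ^ (2 * r)" by (rule zr)
    also have "\<dots> \<le> (\<gamma> / 2) ^ 1" using \<gamma> r2 by (intro power_decreasing) auto
    finally show "z \<le> \<gamma> / 2" by simp
  qed
  have zz: "z\<^sup>2 \<le> z" "0 < z\<^sup>2" using z \<gamma> sq_le[of z] by simp_all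
  define h where "h = c * n"
  have n_eq: "n = (3 * real r - 2) * h"
  proof -
    have "(3 * real r - 2) * h = (c * (3 * real r - 2)) * n" by (simp add: h_def)
    then show ?thesis using c by simp
  qed
  have deg': "deg_in V v \<ge> n - 3 * h - e / 5 * n" if "v \<in> V" for v
    using deg[OF that] by (simp add: h_def algebra_simps)
  obtain S where S: "finite S" "card S \<le> reg_bound K"
    "real (card {(x, y) \<in> V \<times> V. irreg (z\<^sup>2) (cell S x) (cell S y)}) \<le> z\<^sup>2 * (real (card V))\<^sup>2"
    using regularity[OF zz(2) K] by blast
  have "regular_graph V adj r a S n h e \<gamma> z"
  proof unfold_locales
    show "real (card {(x, y) \<in> V \<times> V. irreg (z\<^sup>2) (cell S x) (cell S y)}) \<le> z\<^sup>2 * n\<^sup>2"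
      using S(3) n by simp
    show "z \<le> e / 5" using z \<gamma> by (simp add: defs(6))
    show "2 * z\<^sup>2 \<le> \<gamma>" using zz z by linarith
    have "(real (2 * r) + 1) * z\<^sup>2 \<le> (real (2 * r) + 1) * z" using zz by (intro mult_left_mono) auto
    then show "(real (2 * r) + 1) * z\<^sup>2 \<le> (\<gamma> / 2) ^ (2 * r)" using zr by linarith
    show "5 * real r * e * (3 * real r - 2) < 2"
    proof -
      have "g * (3 * real r - 2) \<le> 1"
      proof -
        have "k \<le> c / 200000" using div_le(1)[OF c_pos, of 200000] by (simp add: defs(1))
        moreover have "t \<le> k / 20" using sq_le[of k] k by (simp add: defs(2))
        ultimately have "g \<le> c" using g s k c_pos by linarith
        then have "g * (3 * real r - 2) \<le> c * (3 * real r - 2)" using L by (intro mult_right_mono) auto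
        then show ?thesis using c by simp
      qed
      then have "g * (g * (3 * real r - 2)) \<le> g * 1" using g by (intro mult_left_mono) auto
      moreover have "5 * real r * e * (3 * real r - 2) = 5 / 7 * ((7 * (real r * e)) * (3 * real r - 2))" by simp
      moreover have "(7 * (real r * e)) * (3 * real r - 2) = g * (g * (3 * real r - 2))"
        unfolding er by (simp add: power2_eq_square)
      ultimately show ?thesis using g s t by linarith
    qed
    show "a \<le> z\<^sup>2 * (z\<^sup>2 * n / 2 ^ card S)"
    proof -
      have "z\<^sup>2 * n / 2 ^ reg_bound K \<le> z\<^sup>2 * n / 2 ^ card S"
        using S(2) zz n_pos by (intro divide_left_mono power_increasing) auto
      then have "z\<^sup>2 * (z\<^sup>2 * n / 2 ^ reg_bound K) \<le> z\<^sup>2 * (z\<^sup>2 * n / 2 ^ card S)"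
        using zz by (intro mult_left_mono) auto
      then show ?thesis using a by linarith
    qed
  qed (use n n_eq n_pos S deg' z \<gamma> in \<open>auto simp: defs(6)\<close>)
  then interpret R: regular_graph V adj r a S n h e \<gamma> z .
  obtain A where A: "\<And>i. i < r \<Longrightarrow> A i \<subseteq> V" "\<And>i j. i < r \<Longrightarrow> j < r \<Longrightarrow> i \<noteq> j \<Longrightarrow> A i \<inter> A j = {}"
    "real (card (V - (\<Union>i<r. A i))) \<le> 7 * real r * e * n"
    "\<And>i. i < r \<Longrightarrow> arcs (A i) (A i) \<le> e * n\<^sup>2"
    "arcs (A 0) (A 1) \<le> real (card (A 0)) * real (card (A 1)) / 2 + e * n\<^sup>2"
    by (rule R.stability) (rule that; assumption)
  have en: "e * n\<^sup>2 \<le> (g * n)\<^sup>2" using e n_pos by (simp add: power_mult_distrib mult_right_mono)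
  have "approx_graph V adj r a A h (g * n) (e / 5 * n) (s * n) (t * n) (k * n) n"
  proof unfold_locales
    show "n = real (card V)" by (rule n(1))
    show "A i \<subseteq> V" if "i < r" for i by (rule A(1)[OF that])
    show "A i \<inter> A j = {}" if "i < r" "j < r" "i \<noteq> j" for i j by (rule A(2)[OF that])
    show "real (card (V - (\<Union>i<r. A i))) \<le> g * n"
    proof -
      have "7 * real r * e * n = g\<^sup>2 * n" using er by simp
      also have "\<dots> \<le> g * n" using sq_le[of g] g s t n_pos by (intro mult_right_mono) auto
      finally show ?thesis using A(3) by linarith
    qed
    show "arcs (A i) (A i) \<le> (g * n)\<^sup>2" if "i < r" for i using A(4)[OF that] en by linarith
    show "arcs (A 0) (A 1) \<le> real (card (A 0)) * real (card (A 1)) / 2 + (g * n)\<^sup>2" using A(5) en by linarith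
    show "n - 3 * h - e / 5 * n \<le> deg_in V v" if "v \<in> V" for v by (rule deg'[OF that])
    show "n = (3 * real r - 2) * h" by (rule n_eq)
    show "a \<le> t * n"
    proof -
      have "z\<^sup>2 * n / 2 ^ reg_bound K \<le> z\<^sup>2 * n / 1"
        using zz n_pos by (intro divide_left_mono) auto
      then have "z\<^sup>2 * (z\<^sup>2 * n / 2 ^ reg_bound K) \<le> 1 * (z\<^sup>2 * n)"
        using zz z \<gamma> n_pos by (intro mult_mono) auto
      moreover have "z\<^sup>2 \<le> t" using zz z \<gamma> e g s t defs(6) by linarith
      then have "z\<^sup>2 * n \<le> t * n" using n_pos by (intro mult_right_mono) auto
      ultimately show ?thesis using a by linarith
    qed
    show "0 < g * n" "0 \<le> e / 5 * n" using g e n_pos by auto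
    show "e / 5 * n \<le> g * n" using e n_pos by (intro mult_right_mono) auto
    show "e / 5 * n * n \<le> (g * n)\<^sup>2"
    proof -
      have "e / 5 * (n * n) \<le> e * (n * n)" using e n_pos by (intro mult_right_mono) auto
      then show ?thesis using en by (simp add: power2_eq_square)
    qed
    show "10 * (real r * (g * n)) \<le> s * n" using gr by (simp add: mult.assoc[symmetric])
    show "1000 * (real r * (s * n)) \<le> t * n"
    proof -
      have "1000 * (real r * s) = 250 * t * t" using sr unfolding power2_eq_square by linarith
      also have "\<dots> \<le> 1 * t" using t by (intro mult_right_mono) auto
      finally have "1000 * (real r * s) * n \<le> t * n" using n_pos by (intro mult_right_mono) auto
      then show ?thesis by (simp add: mult.assoc)
    qed
    show "1000 * (real r * (t * n)) \<le> k * n"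
    proof -
      have "1000 * (real r * t) = (50 * (real r * k)) * k" by (simp add: defs(2) power2_eq_square)
      also have "\<dots> \<le> 1 * k" using kr c_le c_pos k by (intro mult_right_mono) auto
      finally have "1000 * (real r * t) * n \<le> k * n" using n_pos by (intro mult_right_mono) auto
      then show ?thesis by (simp add: mult.assoc)
    qed
    show "200000 * (real r * (k * n)) \<le> h"
      using kr by (simp add: h_def mult.assoc[symmetric])
    show "4 * real r * (s * n) * n \<le> (t * n)\<^sup>2"
    proof -
      have "4 * real r * (s * n) * n = 4 * (real r * s) * n\<^sup>2" by (simp add: power2_eq_square)
      also have "\<dots> = (t * n)\<^sup>2" unfolding sr by (simp add: power_mult_distrib)
      finally show ?thesis by simp
    qed
    show "20 * (t * n) * n \<le> (k * n)\<^sup>2"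
      by (simp add: defs(2) power2_eq_square mult_ac)
  qed
  from approx_graph.approx_edge_bound[OF this] show ?thesis
    by (simp add: h_def power2_eq_square algebra_simps)
qed

section \<open>Passage to a subset of large minimum degree\<close>

lemma (in sgraph) arcs_remove:
  assumes "U \<subseteq> V" "x \<in> U"
  shows "arcs U U = arcs (U - {x}) (U - {x}) + 2 * deg_in U x"
proof -
  have f: "finite U" using fin assms by blast
  have d: "deg_in (U - {x}) x = deg_in U x"
    unfolding deg_in_def using adj_irrefl[of x] by (intro arg_cong[where f="\<lambda>X. real (card X)"]) auto
  have "U = (U - {x}) \<union> {x}" using assms by auto
  then have "arcs U U = arcs U ((U - {x}) \<union> {x})" by simp
  also have "\<dots> = arcs U (U - {x}) + arcs U {x}" by (rule arcs_Un_right) (use f in auto)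
  also have "arcs U (U - {x}) = arcs (U - {x}) (U - {x}) + deg_in (U - {x}) x"
    unfolding arcs_def using sum.remove[OF f assms(2), of "deg_in (U - {x})"] by simp
  also have "arcs U {x} = arcs {x} U" by (rule arcs_sym) (use f in auto)
  also have "\<dots> = deg_in U x" by (simp add: arcs_def)
  finally show ?thesis using d by simp
qed

lemma sum_degrees:
  assumes "finite V" "E \<subseteq> [V]\<^bsup>2\<^esup>"
  shows "(\<Sum>x\<in>V. card {y \<in> V. {x, y} \<in> E}) = 2 * card E"
proof -
  have fE: "finite E" using assms finite_imp_finite_nsets finite_subset by metis
  have E: "A \<subseteq> V" "card A = 2" if "A \<in> E" for A using assms(2) that by (auto simp: nsets_def)
  have "card {y \<in> V. {x, y} \<in> E} = card {A \<in> E. x \<in> A}" for x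
  proof (rule bij_betw_same_card[of "\<lambda>y. {x, y}"], rule bij_betwI')
    show "({x, y} = {x, y'}) = (y = y')" for y y' by (auto simp: doubleton_eq_iff)
    show "{x, y} \<in> {A \<in> E. x \<in> A}" if "y \<in> {y \<in> V. {x, y} \<in> E}" for y using that by auto
    show "\<exists>y\<in>{y \<in> V. {x, y} \<in> E}. A = {x, y}" if A: "A \<in> {A \<in> E. x \<in> A}" for A
    proof -
      obtain u v where uv: "A = {u, v}" using E(2)[of A] A by (auto simp: card_2_iff)
      then show ?thesis using A E(1)[of A] by (auto simp: insert_commute)
    qed
  qed
  then have "(\<Sum>x\<in>V. card {y \<in> V. {x, y} \<in> E}) = (\<Sum>x\<in>V. card {A \<in> E. x \<in> A})" by simp
  also have "\<dots> = 2 * card E"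
    by (rule sum_multicount[OF assms(1) fE]) (use E assms(1) in \<open>auto simp: Int_absorb1 Int_def[symmetric] Collect_conj_eq\<close>)
  finally show ?thesis .
qed

theorem theorem1p2:
  fixes r :: nat
  assumes "r \<ge> 2"
  shows "\<exists>\<delta>\<^sub>0 :: real. \<delta>\<^sub>0 > 0 \<and>
    (\<forall>\<delta> \<le> \<delta>\<^sub>0. \<forall>(V :: 'a set) E n.
      finite_simple_graph V E \<longrightarrow> card V = n \<longrightarrow>
      real (independence_number V E) < \<delta> * real n \<longrightarrow>
      real (card E) > ((3 * real r - 5) / (3 * real r - 2) + \<delta> - \<delta>\<^sup>2) * ((real n)\<^sup>2 / 2) \<longrightarrow>
      contains_complete (2 * r) V E)"
proof -
  define c k t s g e \<gamma> z :: real where "c = 1 / (3 * real r - 2)" and "k = c / (200000 * real r)"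
    and "t = k\<^sup>2 / 20" and "s = t\<^sup>2 / (4 * real r)" and "g = s / (10 * real r)" and "e = g\<^sup>2 / (7 * real r)"
    and "\<gamma> = e / 5" and "z = (\<gamma> / 2) ^ (2 * r) / (real (2 * r) + 1)"
  note defs = k_def t_def s_def g_def e_def \<gamma>_def z_def
  have L: "3 * real r - 2 \<ge> 4" using assms by simp
  have c: "c * (3 * real r - 2) = 1" "0 < c" "c \<le> 1 / 4"
    using L by (simp_all add: c_def field_simps)
  have frac: "(3 * real r - 5) / (3 * real r - 2) = 1 - 3 * c"
    using L by (simp add: c_def field_simps)
  have pos: "0 < k" "0 < t" "0 < s" "0 < g" "0 < e" "0 < \<gamma>" "0 < z"
    using c(2) assms by (simp_all add: defs)
  have le1: "x / (m * real r) \<le> 1" if "0 \<le> x" "x \<le> 1" "1 \<le> m" for x m :: real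
  proof -
    have "1 * 1 \<le> m * real r" using that assms by (intro mult_mono) auto
    then show ?thesis using that by (simp add: divide_le_eq)
  qed
  have k1: "k \<le> 1" using le1[of c 200000] c by (simp add: k_def)
  have t1: "t \<le> 1" using k1 pos power_le_one[of k 2] by (simp add: t_def)
  have s1: "s \<le> 1" unfolding s_def using t1 pos by (intro le1 power_le_one) auto
  have g1: "g \<le> 1" unfolding g_def using s1 pos by (intro le1) auto
  have e1: "e \<le> 1" unfolding e_def using g1 pos by (intro le1 power_le_one) auto
  obtain K :: nat where K: "real K * (z\<^sup>2) ^ 5 > 1"
    using reals_Archimedean3[of "(z\<^sup>2) ^ 5"] pos by auto
  define d where "d = min (e / 5) (z\<^sup>2 * (z\<^sup>2 / 2 ^ reg_bound K))"
  have d: "0 < d" "d \<le> e / 5" "d \<le> z\<^sup>2 * (z\<^sup>2 / 2 ^ reg_bound K)"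
  proof -
    show "0 < d" unfolding d_def using pos by simp
    show "d \<le> e / 5" "d \<le> z\<^sup>2 * (z\<^sup>2 / 2 ^ reg_bound K)"
      unfolding d_def by (rule min.cobounded1, rule min.cobounded2)
  qed
  \<comment> \<open>The factor \<open>e / 10\<close> prepares for a smaller vertex set
    \<open>U\<close>: its square size will be at least \<open>e / 10\<close> times that of the
    graph, so \<open>\<delta> * n\<close> is still at most \<open>d * card U\<close>.\<close>
  define \<delta>\<^sub>0 where "\<delta>\<^sub>0 = d * (e / 10)"
  have "\<delta>\<^sub>0 > 0" using d pos by (simp add: \<delta>\<^sub>0_def)
  moreover have "contains_complete (2 * r) V E"
    if \<delta>: "\<delta> \<le> \<delta>\<^sub>0" and G: "finite_simple_graph V E" and n: "card V = n"
      and ind: "real (independence_number V E) < \<delta> * real n"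
      and edges: "real (card E) > ((3 * real r - 5) / (3 * real r - 2) + \<delta> - \<delta>\<^sup>2) * ((real n)\<^sup>2 / 2)"
    for \<delta> :: real and V :: "'a set" and E :: "'a set set" and n :: nat
  proof (rule ccontr)
    assume no: "\<not> contains_complete (2 * r) V E"
    have fV: "finite V" and E2: "E \<subseteq> [V]\<^bsup>2\<^esup>" using G by (auto simp: finite_simple_graph_def)
    define adj where "adj x y \<longleftrightarrow> {x, y} \<in> E" for x y
    define a where "a = \<delta> * real n"
    have graph: "sgraph U adj" if "U \<subseteq> V" for U
    proof unfold_locales
      show "finite U" using fV that finite_subset by blast
      show "adj y x" if "adj x y" for x y using that by (simp add: adj_def insert_commute)
      show "\<not> adj x x" for x using E2 by (auto simp: adj_def nsets_def)
    qed
    interpret G: sgraph V adj by (rule graph) simp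
    have free: "rt_graph U adj r a" if U: "U \<subseteq> V" for U
    proof -
      interpret sgraph U adj by (rule graph[OF U])
      show ?thesis
      proof unfold_locales
        show "2 \<le> r" by (rule assms)
        show "card K < 2 * r" if K: "K \<subseteq> U" "is_clique K" for K
        proof (rule ccontr)
          assume "\<not> ?thesis"
          then obtain K' where "K' \<subseteq> K" "card K' = 2 * r" using obtain_subset_with_card_n[of "2 * r" K] by auto
          then have "K' \<subseteq> V \<and> card K' = 2 * r \<and> clique K' E"
            using K U unfolding is_clique_def clique_def adj_def by blast
          then show False using no by (auto simp: contains_complete_def)
        qed
        show "real (card I) < a" if I: "I \<subseteq> U" "is_indep I" for I
        proof -
          have "I \<subseteq> V" "indep I E" using I U by (auto simp: is_indep_def indep_def adj_def)
          then have "card I \<in> {card S |S. S \<subseteq> V \<and> indep S E}" by blast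
          moreover have "finite {card S |S. S \<subseteq> V \<and> indep S E}"
            using fV by (intro finite_image_set[of "\<lambda>S. S \<subseteq> V \<and> indep S E" card]) (auto intro: finite_subset[of _ "Pow V"])
          ultimately have "card I \<le> independence_number V E" unfolding independence_number_def by (intro Max_ge)
          then show ?thesis using ind by (simp add: a_def)
        qed
      qed
    qed
    have n0: "real n > 0" using ind by (cases "n = 0") auto
    interpret GV: rt_graph V adj r a by (rule free) simp
    have a0: "0 < a" by (rule GV.a_pos)
    \<comment> \<open>Values \<open>\<delta> \<le> 0\<close> cannot occur here: the empty set is
      independent, so \<open>a\<close> is positive.\<close>
    have \<delta>0: "0 < \<delta>" using a0 n0 by (simp add: a_def zero_less_mult_iff)
    have \<delta>1: "\<delta> \<le> d * (e / 10)" "\<delta> \<le> 1"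
    proof -
      show "\<delta> \<le> d * (e / 10)" using \<delta> by (simp add: \<delta>\<^sub>0_def)
      also have "\<dots> \<le> 1 * 1" using d e1 pos by (intro mult_mono) auto
      finally show "\<delta> \<le> 1" by simp
    qed
    \<comment> \<open>Instead of deleting vertices one by one, \<open>\<phi>\<close> is maximised
      over all subsets; a maximiser has minimum degree about \<open>c' * card U\<close>. Since
      \<open>c'\<close> is below \<open>1 - 3 * c\<close> by \<open>e / 10\<close>, the value at
      \<open>V\<close> is so large that the maximiser cannot be small.\<close>
    define c' where "c' = 1 - 3 * c - e / 10"
    have c'0: "0 \<le> c'" using c e1 pos by (simp add: c'_def)
    define \<phi> where "\<phi> U = G.arcs U U - c' * (real (card U))\<^sup>2" for U
    have "Max (\<phi> ` Pow V) \<in> \<phi> ` Pow V" by (rule Max_in) (use fV in auto)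
    then obtain U where U: "U \<subseteq> V" "\<phi> U = Max (\<phi> ` Pow V)" by auto
    have max: "\<phi> W \<le> \<phi> U" if "W \<subseteq> V" for W
      unfolding U(2) by (rule Max_ge) (use fV that in auto)
    let ?u = "real (card U)"
    have eV: "G.arcs V V = 2 * real (card E)"
    proof -
      have "G.arcs V V = real (\<Sum>x\<in>V. card {y \<in> V. {x, y} \<in> E})" by (simp add: G.arcs_def G.deg_in_def adj_def)
      then show ?thesis using sum_degrees[OF fV E2] by simp
    qed
    have big: "G.arcs U U > c' * ?u\<^sup>2 + e / 10 * (real n)\<^sup>2 + (a * real n - a\<^sup>2)"
    proof -
      have "2 * real (card E) > (1 - 3 * c + \<delta> - \<delta>\<^sup>2) * (real n)\<^sup>2" using edges by (simp add: frac)
      also have "(1 - 3 * c + \<delta> - \<delta>\<^sup>2) * (real n)\<^sup>2 = c' * (real n)\<^sup>2 + e / 10 * (real n)\<^sup>2 + (a * real n - a\<^sup>2)"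
        by (simp add: c'_def a_def power2_eq_square algebra_simps)
      finally show ?thesis using max[of V] eV n by (simp add: \<phi>_def)
    qed
    have an: "a * real n - a\<^sup>2 \<ge> 0"
    proof -
      have "a * a \<le> a * (1 * real n)" unfolding a_def using \<delta>0 \<delta>1 n0 by (intro mult_left_mono mult_right_mono) auto
      then show ?thesis by (simp add: power2_eq_square)
    qed
    have fU: "finite U" using U fV finite_subset by blast
    have "G.arcs U U \<le> ?u\<^sup>2" using G.arcs_le_prod[OF fU, of U] by (simp add: power2_eq_square)
    then have u2: "e / 10 * (real n)\<^sup>2 \<le> ?u\<^sup>2" using big an c'0 by (smt (verit) mult_nonneg_nonneg zero_le_power2)
    have a_le: "a \<le> d * ?u"
    proof (rule power2_le_imp_le)
      have "a \<le> d * (e / 10) * real n" unfolding a_def using \<delta>1 n0 by (intro mult_right_mono) auto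
      then have "a\<^sup>2 \<le> (d * (e / 10) * real n)\<^sup>2" using a0 by (intro power_mono) auto
      also have "\<dots> = d\<^sup>2 * (e / 10 * (e / 10 * (real n)\<^sup>2))" by (simp add: power2_eq_square)
      also have "\<dots> \<le> d\<^sup>2 * (1 * (e / 10 * (real n)\<^sup>2))" using e1 pos by (intro mult_left_mono mult_right_mono) auto
      also have "\<dots> \<le> d\<^sup>2 * ?u\<^sup>2" using u2 by (intro mult_left_mono) auto
      finally show "a\<^sup>2 \<le> (d * ?u)\<^sup>2" by (simp add: power_mult_distrib)
      show "0 \<le> d * ?u" using d by simp
    qed
    have U_ne: "U \<noteq> {}" using a_le a0 by auto
    interpret H: rt_graph U adj r a by (rule free[OF U(1)])
    \<comment> \<open>A single vertex is independent. Thus \<open>a\<close>, and with it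
      \<open>card U\<close>, is large enough to absorb the term \<open>c' / 2\<close> that arises
      when one vertex is deleted.\<close>
    have "1 < a"
    proof -
      obtain x where "x \<in> U" using U_ne by blast
      then show ?thesis using H.indep[of "{x}"] H.adj_irrefl by (auto simp: H.is_indep_def)
    qed
    then have u_ge: "1 \<le> e / 5 * ?u" using a_le mult_right_mono[OF d(2), of ?u] by simp
    have deg: "G.deg_in U x \<ge> (1 - 3 * c - e / 5) * ?u" if x: "x \<in> U" for x
    proof -
      have cU: "real (card (U - {x})) = ?u - 1" using card_Suc_Diff1[OF fU x] by linarith
      have "\<phi> (U - {x}) \<le> \<phi> U" by (rule max) (use U in auto)
      then have "2 * G.deg_in U x \<ge> c' * (?u\<^sup>2 - (?u - 1)\<^sup>2)"
        using G.arcs_remove[OF U(1) x] cU by (simp add: \<phi>_def algebra_simps)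
      then have "G.deg_in U x \<ge> c' * ?u - c' / 2" by (simp add: power2_eq_square algebra_simps)
      moreover have "c' \<le> 1" using c pos by (simp add: c'_def)
      moreover have "c' * ?u = (1 - 3 * c - e / 5) * ?u + (e / 5 * ?u) / 2"
        by (simp add: c'_def algebra_simps)
      ultimately show ?thesis using u_ge by linarith
    qed
    \<comment> \<open>The bound is applied to \<open>U\<close> with \<open>a\<close> still taken
      from the whole graph; the term \<open>- a\<^sup>2\<close> then agrees with that in
      \<open>big\<close>, and the other terms only grow from \<open>card U\<close> to
      \<open>n\<close>.\<close>
    have "(\<Sum>x\<in>U. G.deg_in U x) \<le> (1 - 3 * c) * ?u\<^sup>2 + a * ?u - a\<^sup>2"
    proof (rule H.min_degree_edge_bound[OF refl U_ne c(1) defs K])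
      have "d * ?u \<le> z\<^sup>2 * (z\<^sup>2 / 2 ^ reg_bound K) * ?u" using d by (intro mult_right_mono) auto
      then show "a \<le> z\<^sup>2 * (z\<^sup>2 * ?u / 2 ^ reg_bound K)" using a_le by simp
      show "(1 - 3 * c - e / 5) * ?u \<le> G.deg_in U v" if "v \<in> U" for v by (rule deg[OF that])
    qed
    moreover have "(\<Sum>x\<in>U. G.deg_in U x) = G.arcs U U" by (simp add: G.arcs_def)
    moreover have un: "?u \<le> real n" using card_mono[OF fV U(1)] n by simp
    then have "a * ?u \<le> a * real n" "e / 10 * ?u\<^sup>2 \<le> e / 10 * (real n)\<^sup>2"
      using a0 pos by (auto intro!: mult_left_mono power_mono)
    moreover have "(1 - 3 * c) * ?u\<^sup>2 = c' * ?u\<^sup>2 + e / 10 * ?u\<^sup>2" by (simp add: c'_def algebra_simps)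
    ultimately show False using big by linarith
  qed
  ultimately show ?thesis by blast
qed

end
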